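(* Let $\Gamma$ be a hyperbolic group, let $d$ be the metric on $\Gamma$ coming from its Cayley graph, and let $C$ be a constant such that for all $s\in\mathbb{D}$ the function $x\mapsto s^{d(x,e)}$ belongs to $M_0A(\Gamma)$ with $$\|s^{d(\cdot,e)}\|_{M_0A(\Gamma)}\le C\,\frac{|1-s|}{1-|s|}$$ (such a constant exists by a theorem of N. Ozawa). Then for every $\phi\in\mathcal{C}$ the function $$\tilde\phi(x)=\phi(d(x,e)),\qquad x\in\Gamma,$$ is a completely bounded Fourier multiplier on $\Gamma$, and $\|\tilde\phi\|_{M_0A(\Gamma)}\le\frac{8C}{\pi}\|\phi\|_{\mathcal{C}}$.
   Context: $\mathbb{D}=\{s\in\mathbb{C}:|s|<1\}$ and $s^0=1$ for all $s$. A hyperbolic group is a finitely generated discrete group that is hyperbolic in the sense of Gromov; $d:\Gamma\times\Gamma\to\mathbb{N}_0$ is the (left-invariant) word metric with respect to a Cayley graph of $\Gamma$ for a finite symmetric generating set; $e$ is the unit of $\Gamma$. Ozawa's theorem (Weak amenability of hyperbolic groups, 2008, Theorem 1(1)), which may be taken as known, states that a constant $C\ge 1$ as in the claim exists. $M_0A(\Gamma)$ is the space of completely bounded Fourier multipliers (equivalently Herz–Schur multipliers) on $\Gamma$: functions $\varphi:\Gamma\to\mathbb{C}$ for which there are a Hilbert space $K$ and bounded maps $\alpha,\beta:\Gamma\to K$ with $\varphi(y^{-1}x)=\langle\alpha(x),\beta(y)\rangle$ for all $x,y\in\Gamma$; $\|\varphi\|_{M_0A(\Gamma)}$ is the infimum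 of $\sup_x\|\alpha(x)\|\,\sup_y\|\beta(y)\|$ over such representations. It equals the cb-norm of the map $\lambda(g)\mapsto\varphi(g)\lambda(g)$ on $C_r^*(\Gamma)$. $\mathcal{C}$ is the set of functions $\phi:\mathbb{N}_0\to\mathbb{C}$ for which the Hankel matrix $h=(\phi(i+j)-\phi(i+j+1))_{i,j\ge0}$ is of trace class on $\ell^2(\mathbb{N}_0)$. For $\phi\in\mathcal{C}$ the matrix $k=(\phi(i+j+1)-\phi(i+j+2))_{i,j\ge0}$ is also of trace class, $c=\lim_{n\to\infty}\phi(n)$ exists, and $\|\phi\|_{\mathcal{C}}=\|h\|_1+\|k\|_1+|c|$, with $\|\cdot\|_1$ the trace-class norm. *)

theory Defs
  imports Complex_Main "HOL-Algebra.Generated_Groups"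
begin

section \<open>Word metrics and hyperbolic groups\<close>

definition finite_symmetric_generating_set :: "('a, 'b) monoid_scheme \<Rightarrow> 'a set \<Rightarrow> bool" where
  "finite_symmetric_generating_set G S \<longleftrightarrow>
     finite S \<and> S \<subseteq> carrier G \<and> (\<forall>s\<in>S. inv\<^bsub>G\<^esub> s \<in> S) \<and> generate G S = carrier G"

text \<open>
  Graph distance in the Cayley graph with edges \<open>x \<midarrow> x s\<close>, \<open>s \<in> S\<close>: the list \<open>ws\<close> is the
  sequence of labels along an edge path from \<open>x\<close> to \<open>y\<close>. Such a path exists whenever \<open>S\<close> is a
  symmetric generating set; the metric is left-invariant.
\<close>

definition word_dist :: "('a, 'b) monoid_scheme \<Rightarrow> 'a set \<Rightarrow> 'a \<Rightarrow> 'a \<Rightarrow> nat" where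
  "word_dist G S x y =
     (LEAST n. \<exists>ws. length ws = n \<and> set ws \<subseteq> S \<and> foldl (\<lambda>g s. g \<otimes>\<^bsub>G\<^esub> s) x ws = y)"

definition gromov_product :: "('a \<Rightarrow> 'a \<Rightarrow> real) \<Rightarrow> 'a \<Rightarrow> 'a \<Rightarrow> 'a \<Rightarrow> real" where
  "gromov_product d w x y = (d x w + d y w - d x y) / 2"

definition gromov_hyperbolic :: "'a set \<Rightarrow> ('a \<Rightarrow> 'a \<Rightarrow> real) \<Rightarrow> bool" where
  "gromov_hyperbolic X d \<longleftrightarrow>
     (\<exists>\<delta>\<ge>0. \<forall>w\<in>X. \<forall>x\<in>X. \<forall>y\<in>X. \<forall>z\<in>X.
        gromov_product d w x z \<ge> min (gromov_product d w x y) (gromov_product d w y z) - \<delta>)"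

definition hyperbolic_group :: "('a, 'b) monoid_scheme \<Rightarrow> bool" where
  "hyperbolic_group G \<longleftrightarrow> group G \<and>
     (\<exists>S. finite_symmetric_generating_set G S \<and>
          gromov_hyperbolic (carrier G) (\<lambda>x y. real (word_dist G S x y)))"


section \<open>Complex Hilbert spaces with explicit carrier\<close>

record 'h hilbert =
  hcarrier :: "'h set"
  hzero :: 'h
  hadd :: "'h \<Rightarrow> 'h \<Rightarrow> 'h"
  hscale :: "complex \<Rightarrow> 'h \<Rightarrow> 'h"
  hinner :: "'h \<Rightarrow> 'h \<Rightarrow> complex"

definition hnorm :: "'h hilbert \<Rightarrow> 'h \<Rightarrow> real" where
  "hnorm H v = sqrt (Re (hinner H v v))"

definition hdist :: "'h hilbert \<Rightarrow> 'h \<Rightarrow> 'h \<Rightarrow> real" where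
  "hdist H u v = hnorm H (hadd H u (hscale H (-1) v))"

locale complex_hilbert =
  fixes H :: "'h hilbert"
  assumes zero_closed: "hzero H \<in> hcarrier H"
    and add_closed: "\<lbrakk>u \<in> hcarrier H; v \<in> hcarrier H\<rbrakk> \<Longrightarrow> hadd H u v \<in> hcarrier H"
    and scale_closed: "u \<in> hcarrier H \<Longrightarrow> hscale H a u \<in> hcarrier H"
    and add_assoc: "\<lbrakk>u \<in> hcarrier H; v \<in> hcarrier H; w \<in> hcarrier H\<rbrakk>
          \<Longrightarrow> hadd H (hadd H u v) w = hadd H u (hadd H v w)"
    and add_commute: "\<lbrakk>u \<in> hcarrier H; v \<in> hcarrier H\<rbrakk> \<Longrightarrow> hadd H u v = hadd H v u"
    and add_zero: "u \<in> hcarrier H \<Longrightarrow> hadd H u (hzero H) = u"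
    and add_minus: "u \<in> hcarrier H \<Longrightarrow> hadd H u (hscale H (-1) u) = hzero H"
    and scale_add_right: "\<lbrakk>u \<in> hcarrier H; v \<in> hcarrier H\<rbrakk>
          \<Longrightarrow> hscale H a (hadd H u v) = hadd H (hscale H a u) (hscale H a v)"
    and scale_add_left: "u \<in> hcarrier H
          \<Longrightarrow> hscale H (a + b) u = hadd H (hscale H a u) (hscale H b u)"
    and scale_scale: "u \<in> hcarrier H \<Longrightarrow> hscale H a (hscale H b u) = hscale H (a * b) u"
    and scale_one: "u \<in> hcarrier H \<Longrightarrow> hscale H 1 u = u"
    and inner_add_left: "\<lbrakk>u \<in> hcarrier H; v \<in> hcarrier H; w \<in> hcarrier H\<rbrakk>
          \<Longrightarrow> hinner H (hadd H u v) w = hinner H u w + hinner H v w"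
    and inner_scale_left: "\<lbrakk>u \<in> hcarrier H; v \<in> hcarrier H\<rbrakk>
          \<Longrightarrow> hinner H (hscale H a u) v = a * hinner H u v"
    and inner_commute: "\<lbrakk>u \<in> hcarrier H; v \<in> hcarrier H\<rbrakk> \<Longrightarrow> hinner H u v = cnj (hinner H v u)"
    and inner_nonneg: "u \<in> hcarrier H \<Longrightarrow> 0 \<le> Re (hinner H u u)"
    and inner_eq_zero: "\<lbrakk>u \<in> hcarrier H; hinner H u u = 0\<rbrakk> \<Longrightarrow> u = hzero H"
    and complete: "\<lbrakk>\<And>n::nat. X n \<in> hcarrier H;
          \<And>e::real. e > 0 \<Longrightarrow> \<exists>N. \<forall>m\<ge>N. \<forall>n\<ge>N. hdist H (X m) (X n) < e\<rbrakk>
          \<Longrightarrow> \<exists>v\<in>hcarrier H. (\<lambda>n. hdist H (X n) v) \<longlonglongrightarrow> 0"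


section \<open>Herz--Schur multipliers\<close>

definition herz_schur_rep ::
  "('a, 'b) monoid_scheme \<Rightarrow> 'h hilbert \<Rightarrow> ('a \<Rightarrow> 'h) \<Rightarrow> ('a \<Rightarrow> 'h) \<Rightarrow> ('a \<Rightarrow> complex) \<Rightarrow> bool" where
  "herz_schur_rep G H \<alpha> \<beta> \<phi> \<longleftrightarrow>
     complex_hilbert H \<and>
     \<alpha> \<in> carrier G \<rightarrow> hcarrier H \<and> \<beta> \<in> carrier G \<rightarrow> hcarrier H \<and>
     bdd_above ((\<lambda>x. hnorm H (\<alpha> x)) ` carrier G) \<and>
     bdd_above ((\<lambda>y. hnorm H (\<beta> y)) ` carrier G) \<and>
     (\<forall>x\<in>carrier G. \<forall>y\<in>carrier G. \<phi> (inv\<^bsub>G\<^esub> y \<otimes>\<^bsub>G\<^esub> x) = hinner H (\<alpha> x) (\<beta> y))"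

text \<open>
  HOL cannot quantify over all types inside a formula, so the Hilbert space ranges over all
  Hilbert space structures whose carrier is a set of elements of the type
  \<open>'a + 'a \<Rightarrow> complex\<close>. This loses nothing: by \<open>herz_schur_rep_any_type\<close> below, a representation
  in a Hilbert space over any type yields one over this type with the same norms.
\<close>

definition M0A :: "('a, 'b) monoid_scheme \<Rightarrow> ('a \<Rightarrow> complex) set" where
  "M0A G = {\<phi>. \<exists>(H :: ('a + 'a \<Rightarrow> complex) hilbert) \<alpha> \<beta>. herz_schur_rep G H \<alpha> \<beta> \<phi>}"

definition M0A_norm :: "('a, 'b) monoid_scheme \<Rightarrow> ('a \<Rightarrow> complex) \<Rightarrow> real" where
  "M0A_norm G \<phi> =
     Inf {(SUP x\<in>carrier G. hnorm H (\<alpha> x)) * (SUP y\<in>carrier G. hnorm H (\<beta> y)) |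
          (H :: ('a + 'a \<Rightarrow> complex) hilbert) \<alpha> \<beta>. herz_schur_rep G H \<alpha> \<beta> \<phi>}"

definition transport_hilbert :: "'h hilbert \<Rightarrow> 'h set \<Rightarrow> ('h \<Rightarrow> 'k) \<Rightarrow> 'k hilbert" where
  "transport_hilbert H M f =
     \<lparr>hcarrier = f ` M, hzero = f (hzero H),
      hadd = (\<lambda>u v. f (hadd H (inv_into M f u) (inv_into M f v))),
      hscale = (\<lambda>a u. f (hscale H a (inv_into M f u))),
      hinner = (\<lambda>u v. hinner H (inv_into M f u) (inv_into M f v))\<rparr>"

lemma complex_hilbert_transport:
  assumes H: "complex_hilbert H" and sub: "M \<subseteq> hcarrier H" and inj: "inj_on f M"
    and z: "hzero H \<in> M"
    and a: "\<And>u v. u \<in> M \<Longrightarrow> v \<in> M \<Longrightarrow> hadd H u v \<in> M"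
    and s: "\<And>c u. u \<in> M \<Longrightarrow> hscale H c u \<in> M"
    and cl: "\<And>X v. (\<And>n::nat. X n \<in> M) \<Longrightarrow> v \<in> hcarrier H
               \<Longrightarrow> (\<lambda>n. hdist H (X n) v) \<longlonglongrightarrow> 0 \<Longrightarrow> v \<in> M"
  shows "complex_hilbert (transport_hilbert H M f)"
proof -
  interpret complex_hilbert H by (rule H)
  have inv: "inv_into M f (f u) = u" if "u \<in> M" for u
    using inj that by (rule inv_into_f_f)
  have inM: "u \<in> M \<Longrightarrow> u \<in> hcarrier H" for u using sub by auto
  have dist: "hdist (transport_hilbert H M f) (f u) (f v) = hdist H u v"
    if "u \<in> M" "v \<in> M" for u v
    using that by (simp add: hdist_def hnorm_def transport_hilbert_def inv a s)
  show ?thesis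
  proof (unfold_locales, goal_cases)
    case (17 X)
    define Y where "Y n = inv_into M f (X n)" for n
    have Y: "Y n \<in> M" and fY: "f (Y n) = X n" for n
      using 17(1)[of n] by (auto simp: Y_def transport_hilbert_def inv)
    have "\<exists>N. \<forall>m\<ge>N. \<forall>n\<ge>N. hdist H (Y m) (Y n) < e" if "e > 0" for e
      using 17(2)[OF that] dist[OF Y Y] by (simp add: fY)
    then obtain v where v: "v \<in> hcarrier H" "(\<lambda>n. hdist H (Y n) v) \<longlonglongrightarrow> 0"
      using complete[of Y] Y inM by blast
    then have vM: "v \<in> M" using cl[of Y v] Y by blast
    have "(\<lambda>n. hdist (transport_hilbert H M f) (X n) (f v)) \<longlonglongrightarrow> 0"
      using v(2) dist[OF Y vM] by (simp add: fY)
    then show ?case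
      using vM by (auto simp: transport_hilbert_def)
  next
    case (5 u v)
    then show ?case by (auto simp: transport_hilbert_def inv inM add_commute)
  next
    case (14 u v)
    then show ?case by (auto simp: transport_hilbert_def inv inM intro: inner_commute)
  next
    case (16 u)
    then show ?case by (auto simp: transport_hilbert_def inv inM dest: inner_eq_zero[OF inM])
  qed (auto simp: transport_hilbert_def inv z a s inM add_assoc add_zero add_minus
        scale_add_right scale_add_left scale_scale scale_one inner_add_left inner_scale_left
        inner_nonneg)
qed

context complex_hilbert
begin

lemma inner_add_right:
  assumes "u \<in> hcarrier H" "v \<in> hcarrier H" "w \<in> hcarrier H"
  shows "hinner H w (hadd H u v) = hinner H w u + hinner H w v"
  using assms inner_commute[of w "hadd H u v"] inner_commute[of w u] inner_commute[of w v]
  by (simp add: inner_add_left add_closed)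

lemma inner_scale_right:
  assumes "u \<in> hcarrier H" "v \<in> hcarrier H"
  shows "hinner H v (hscale H a u) = cnj a * hinner H v u"
  using assms inner_commute[of v "hscale H a u"] inner_commute[of v u]
  by (simp add: inner_scale_left scale_closed)

lemma hinner_zero_left: "v \<in> hcarrier H \<Longrightarrow> hinner H (hzero H) v = 0"
  using inner_add_left[of "hzero H" "hzero H" v] by (simp add: zero_closed add_zero)

lemma hinner_self_real:
  assumes "v \<in> hcarrier H"
  shows "hinner H v v = of_real (Re (hinner H v v))"
  using inner_commute[OF assms assms] by (simp add: complex_eq_iff)

lemma cauchy_schwarz:
  assumes u: "u \<in> hcarrier H" and v: "v \<in> hcarrier H"
  shows "cmod (hinner H u v) \<le> hnorm H u * hnorm H v"
proof (cases "hinner H v v = 0")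
  case True
  then have "v = hzero H" using v by (rule inner_eq_zero[rotated])
  then have "hinner H u v = 0"
    using inner_commute[OF u v] by (simp add: hinner_zero_left u)
  then show ?thesis by (simp add: hnorm_def inner_nonneg u v)
next
  case False
  define p where "p = hinner H u v"
  define q where "q = Re (hinner H v v)"
  have vv: "hinner H v v = of_real q" using hinner_self_real[OF v] by (simp add: q_def)
  have "q \<noteq> 0" using False unfolding vv by simp
  then have q: "q > 0" using inner_nonneg[OF v] unfolding q_def by linarith
  have vu: "hinner H v u = cnj p" using inner_commute[OF v u] by (simp add: p_def)
  define w where "w = hadd H u (hscale H (- p / of_real q) v)"
  have w: "w \<in> hcarrier H" by (simp add: w_def add_closed scale_closed u v)
  have "hinner H w w = hinner H u u - p * cnj p / of_real q"
    using q by (simp add: w_def inner_add_left inner_add_right inner_scale_left inner_scale_right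
        add_closed scale_closed u v vv vu p_def[symmetric] field_simps)
  also have "p * cnj p = of_real ((cmod p)\<^sup>2)"
    by (simp add: complex_norm_square[symmetric])
  finally have "Re (hinner H w w) = Re (hinner H u u) - (cmod p)\<^sup>2 / q"
    by (simp add: of_real_divide[symmetric] del: of_real_divide)
  then have "(cmod p)\<^sup>2 / q \<le> Re (hinner H u u)"
    using inner_nonneg[OF w] by linarith
  then have "(cmod p)\<^sup>2 \<le> Re (hinner H u u) * q"
    using q by (simp add: pos_divide_le_eq)
  then have "cmod p \<le> sqrt (Re (hinner H u u) * q)"
    by (rule real_le_rsqrt)
  then show ?thesis by (simp add: hnorm_def p_def q_def real_sqrt_mult)
qed

end

theorem herz_schur_rep_any_type:
  fixes H :: "'h hilbert" and G :: "('a, 'b) monoid_scheme"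
  assumes rep: "herz_schur_rep G H \<alpha> \<beta> \<phi>"
  obtains H' :: "('a + 'a \<Rightarrow> complex) hilbert" and \<alpha>' \<beta>'
  where "herz_schur_rep G H' \<alpha>' \<beta>' \<phi>"
    and "\<And>x. x \<in> carrier G \<Longrightarrow> hnorm H' (\<alpha>' x) = hnorm H (\<alpha> x)"
    and "\<And>x. x \<in> carrier G \<Longrightarrow> hnorm H' (\<beta>' x) = hnorm H (\<beta> x)"
proof -
  interpret complex_hilbert H using rep by (simp add: herz_schur_rep_def)
  have \<alpha>: "\<And>x. x \<in> carrier G \<Longrightarrow> \<alpha> x \<in> hcarrier H"
    and \<beta>: "\<And>x. x \<in> carrier G \<Longrightarrow> \<beta> x \<in> hcarrier H"
    using rep by (auto simp: herz_schur_rep_def)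
  define E where "E = \<alpha> ` carrier G \<union> \<beta> ` carrier G"
  have E: "E \<subseteq> hcarrier H" using \<alpha> \<beta> by (auto simp: E_def)
  define N where "N = {w \<in> hcarrier H. \<forall>e\<in>E. hinner H w e = 0}"
  define M where "M = {v \<in> hcarrier H. \<forall>w\<in>N. hinner H v w = 0}"
  have NH: "\<And>w. w \<in> N \<Longrightarrow> w \<in> hcarrier H" by (auto simp: N_def)
  have MH: "M \<subseteq> hcarrier H" by (auto simp: M_def)
  have EM: "E \<subseteq> M"
  proof
    fix e assume e: "e \<in> E"
    have "hinner H e w = 0" if "w \<in> N" for w
      using that e E inner_commute[of e w] by (auto simp: N_def)
    then show "e \<in> M" using e E by (auto simp: M_def)
  qed
  define f where "f v = (\<lambda>z. case z of
      Inl x \<Rightarrow> if x \<in> carrier G then hinner H v (\<alpha> x) else 0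
    | Inr x \<Rightarrow> if x \<in> carrier G then hinner H v (\<beta> x) else 0)" for v
  have zM: "hzero H \<in> M" using NH by (auto simp: M_def zero_closed hinner_zero_left)
  have aM: "hadd H u v \<in> M" if "u \<in> M" "v \<in> M" for u v
    using that NH by (auto simp: M_def add_closed inner_add_left)
  have sM: "hscale H c u \<in> M" if "u \<in> M" for c u
    using that NH by (auto simp: M_def scale_closed inner_scale_left)
  have inj: "inj_on f M"
  proof (rule inj_onI)
    fix u v assume u: "u \<in> M" and v: "v \<in> M" and eq: "f u = f v"
    have uH: "u \<in> hcarrier H" and vH: "v \<in> hcarrier H" using u v MH by auto
    define w where "w = hadd H u (hscale H (-1) v)"
    have wM: "w \<in> M" by (simp add: w_def aM sM u v)
    have wH: "w \<in> hcarrier H" using wM MH by auto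
    have "hinner H u e = hinner H v e" if eE: "e \<in> E" for e
    proof -
      consider x where "x \<in> carrier G" "e = \<alpha> x" | x where "x \<in> carrier G" "e = \<beta> x"
        using eE unfolding E_def by blast
      then show ?thesis
      proof cases
        case 1 then show ?thesis using fun_cong[OF eq, of "Inl x"] by (simp add: f_def)
      next
        case 2 then show ?thesis using fun_cong[OF eq, of "Inr x"] by (simp add: f_def)
      qed
    qed
    then have "hinner H w e = 0" if "e \<in> E" for e
      using that E uH vH
      by (auto simp: w_def inner_add_left inner_scale_left scale_closed subset_iff)
    then have "w \<in> N" using wH by (auto simp: N_def)
    then have "hinner H w w = 0" using wM by (auto simp: M_def)
    then have w0: "w = hzero H" by (rule inner_eq_zero[OF wH])
    have "u = hadd H u (hadd H (hscale H (-1) v) v)"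
      using add_minus[OF vH] add_commute[OF vH scale_closed[OF vH, of "-1"]]
      by (simp add: add_zero uH)
    also have "\<dots> = hadd H w v"
      by (simp add: w_def add_assoc uH vH scale_closed)
    also have "\<dots> = v"
      using add_commute[OF zero_closed vH] by (simp add: w0 add_zero vH)
    finally show "u = v" .
  qed
  have clM: "v \<in> M" if X: "\<And>n::nat. X n \<in> M" and v: "v \<in> hcarrier H"
    and lim: "(\<lambda>n. hdist H (X n) v) \<longlonglongrightarrow> 0" for X v
  proof -
    have "hinner H v w = 0" if w: "w \<in> N" for w
    proof -
      have wH: "w \<in> hcarrier H" using w NH by auto
      have bnd: "cmod (hinner H v w) \<le> hdist H (X n) v * hnorm H w" for n
      proof -
        have Xn: "X n \<in> hcarrier H" "hinner H (X n) w = 0"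
          using X[of n] w by (auto simp: M_def)
        have "hinner H (hadd H (X n) (hscale H (-1) v)) w = - hinner H v w"
          by (simp add: inner_add_left inner_scale_left scale_closed Xn v wH)
        moreover have "hadd H (X n) (hscale H (-1) v) \<in> hcarrier H"
          by (simp add: add_closed scale_closed Xn v)
        ultimately show ?thesis
          using cauchy_schwarz[of "hadd H (X n) (hscale H (-1) v)" w] wH
          by (simp add: hdist_def)
      qed
      have "(\<lambda>n. hdist H (X n) v * hnorm H w) \<longlonglongrightarrow> 0"
        using tendsto_mult_right[OF lim, of "hnorm H w"] by simp
      then have "cmod (hinner H v w) \<le> 0"
        by (rule LIMSEQ_le_const) (use bnd in auto)
      then show ?thesis by simp
    qed
    then show ?thesis using v by (auto simp: M_def)
  qed
  define H' where "H' = transport_hilbert H M f"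
  have hil: "complex_hilbert H'"
    unfolding H'_def
    by (rule complex_hilbert_transport[OF complex_hilbert_axioms MH inj zM aM sM clM])
  have inner: "hinner H' (f u) (f v) = hinner H u v" if "u \<in> M" "v \<in> M" for u v
    using that by (simp add: H'_def transport_hilbert_def inv_into_f_f[OF inj])
  have norm: "hnorm H' (f u) = hnorm H u" if "u \<in> M" for u
    using that by (simp add: hnorm_def inner)
  have \<alpha>M: "\<alpha> x \<in> M" and \<beta>M: "\<beta> x \<in> M" if "x \<in> carrier G" for x
    using EM that by (auto simp: E_def)
  have im: "(\<lambda>x. hnorm H' (f (\<alpha> x))) ` carrier G = (\<lambda>x. hnorm H (\<alpha> x)) ` carrier G"
    "(\<lambda>x. hnorm H' (f (\<beta> x))) ` carrier G = (\<lambda>x. hnorm H (\<beta> x)) ` carrier G"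
    by (auto intro!: image_cong simp: norm \<alpha>M \<beta>M)
  have car: "f u \<in> hcarrier H'" if "u \<in> M" for u
    using that by (simp add: H'_def transport_hilbert_def)
  have "herz_schur_rep G H' (\<lambda>x. f (\<alpha> x)) (\<lambda>x. f (\<beta> x)) \<phi>"
    unfolding herz_schur_rep_def im
    using rep hil by (simp add: herz_schur_rep_def Pi_iff car \<alpha>M \<beta>M inner)
  then show thesis
    by (rule that) (simp_all add: norm \<alpha>M \<beta>M)
qed


section \<open>Trace class matrices on \<open>\<ell>\<^sup>2\<close>\<close>

definition ell2 :: "(nat \<Rightarrow> complex) set" where
  "ell2 = {x. summable (\<lambda>n. (cmod (x n))\<^sup>2)}"

definition ell2_norm :: "(nat \<Rightarrow> complex) \<Rightarrow> real" where
  "ell2_norm x = sqrt (\<Sum>n. (cmod (x n))\<^sup>2)"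

definition ell2_inner :: "(nat \<Rightarrow> complex) \<Rightarrow> (nat \<Rightarrow> complex) \<Rightarrow> complex" where
  "ell2_inner x y = (\<Sum>n. x n * cnj (y n))"

type_synonym cmatrix = "nat \<Rightarrow> nat \<Rightarrow> complex"

definition mat_apply :: "cmatrix \<Rightarrow> (nat \<Rightarrow> complex) \<Rightarrow> (nat \<Rightarrow> complex)" where
  "mat_apply A x = (\<lambda>i. \<Sum>j. A i j * x j)"

definition mat_adjoint :: "cmatrix \<Rightarrow> cmatrix" where
  "mat_adjoint A = (\<lambda>i j. cnj (A j i))"

definition bounded_matrix :: "cmatrix \<Rightarrow> bool" where
  "bounded_matrix A \<longleftrightarrow>
     (\<exists>K. \<forall>x\<in>ell2. (\<forall>i. summable (\<lambda>j. A i j * x j)) \<and>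
        mat_apply A x \<in> ell2 \<and> ell2_norm (mat_apply A x) \<le> K * ell2_norm x)"

definition positive_matrix :: "cmatrix \<Rightarrow> bool" where
  "positive_matrix A \<longleftrightarrow> bounded_matrix A \<and>
     (\<forall>x\<in>ell2. Im (ell2_inner (mat_apply A x) x) = 0 \<and> 0 \<le> Re (ell2_inner (mat_apply A x) x))"

text \<open>\<open>B\<close> is the absolute value \<open>|A| = (A\<^sup>* A)\<^bsup>1/2\<^esup>\<close>: the unique positive square root.\<close>

definition is_abs_matrix :: "cmatrix \<Rightarrow> cmatrix \<Rightarrow> bool" where
  "is_abs_matrix A B \<longleftrightarrow> positive_matrix B \<and>
     (\<forall>x\<in>ell2. mat_apply B (mat_apply B x) = mat_apply (mat_adjoint A) (mat_apply A x))"

text \<open>The trace norm is \<open>Tr |A| = (\<Sum>n. \<langle>|A| e\<^sub>n, e\<^sub>n\<rangle>)\<close>. As \<open>|A|\<close> is unique, so is \<open>t\<close>.\<close>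

definition has_trace_norm :: "cmatrix \<Rightarrow> real \<Rightarrow> bool" where
  "has_trace_norm A t \<longleftrightarrow> bounded_matrix A \<and>
     (\<exists>B. is_abs_matrix A B \<and> (\<lambda>n. B n n) sums complex_of_real t)"

definition trace_class :: "cmatrix \<Rightarrow> bool" where
  "trace_class A \<longleftrightarrow> (\<exists>t. has_trace_norm A t)"

definition trace_norm :: "cmatrix \<Rightarrow> real" where
  "trace_norm A = (SOME t. has_trace_norm A t)"


section \<open>The space of functions with trace class Hankel difference matrix\<close>

definition hankel_diff :: "(nat \<Rightarrow> complex) \<Rightarrow> nat \<Rightarrow> cmatrix" where
  "hankel_diff \<phi> m = (\<lambda>i j. \<phi> (i + j + m) - \<phi> (i + j + m + 1))"

definition hankel_space :: "(nat \<Rightarrow> complex) set" where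
  "hankel_space = {\<phi>. trace_class (hankel_diff \<phi> 0)}"

text \<open>
  Only meaningful on \<^term>\<open>hankel_space\<close>, where the second matrix is trace class and the limit
  exists.
\<close>

definition hankel_space_norm :: "(nat \<Rightarrow> complex) \<Rightarrow> real" where
  "hankel_space_norm \<phi> =
     trace_norm (hankel_diff \<phi> 0) + trace_norm (hankel_diff \<phi> 1) + cmod (lim \<phi>)"

end

theory Submission
  imports Defs "HOL-Complex_Analysis.Great_Picard"
begin

text \<open>
  Write \<open>a m = \<phi> m - \<phi> (m + 1)\<close>, so that \<open>h = (a (i + j))\<close>, \<open>k = (a (i + j + 1))\<close> and
  \<open>\<phi> n - c = (\<Sum>m\<ge>n. a m)\<close>. The theorem comes from an integral representation
  \<open>\<phi> n - c = \<integral> s\<^sup>n d\<nu>(s)\<close> over the unit disc with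
  \<open>\<integral> |1 - s| / (1 - |s|) d|\<nu>|(s) \<le> 8/\<pi> (\<parallel>h\<parallel>\<^sub>1 + \<parallel>k\<parallel>\<^sub>1)\<close>: integrating the bounds on the multipliers
  \<open>s\<^bsup>d(x, e)\<^esup>\<close> against \<open>\<nu>\<close> gives the estimate for \<open>\<phi> - c\<close>, and a constant function has multiplier norm
  at most its modulus, while \<open>C \<ge> 1\<close> because \<open>s = 0\<close> gives the indicator function of the unit.

  The measure. Put \<open>G(z) = (\<Sum>m. (2 m + 1) (2 m + 2) a m z\<^bsup>2m\<^esup>)\<close>. Integration in polar coordinates
  gives \<open>a m = \<pi>\<^sup>-\<^sup>1 \<integral> G(z) cnj z\<^bsup>2m\<^esup> (1 - |z|\<^sup>2) dA(z)\<close>, and summing over \<open>m \<ge> n\<close> represents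
  \<open>\<phi> n - c\<close> with \<open>s = cnj z\<^sup>2\<close> and density \<open>G(z) (1 - |s|) / (1 - s)\<close>, so only
  \<open>\<pi>\<^sup>-\<^sup>1 \<integral> |G| dA \<le> 8/\<pi> (\<parallel>h\<parallel>\<^sub>1 + \<parallel>k\<parallel>\<^sub>1)\<close> is left to show. Let \<open>\<gamma> l\<close> be the coefficients of
  \<open>(1 - z)\<^bsup>-3/2\<^esup>\<close>. As \<open>(\<Sum>l\<le>2m. \<gamma> l \<gamma> (2 m - l)) = (2 m + 1) (2 m + 2) / 2\<close>, splitting this sum into
  even and odd \<open>l\<close> gives \<open>G(z) = 2 u\<^sup>T h u + 2 v\<^sup>T k v\<close> with \<open>u i = \<gamma> (2 i) z\<^bsup>2i\<^esup>\<close> and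
  \<open>v i = \<gamma> (2 i + 1) z\<^bsup>2i+1\<^esup>\<close>. For a symmetric matrix \<open>|u\<^sup>T h u| \<le> u\<^sup>* |h| u\<close> holds
  (\<open>has_trace_norm_form\<close>), and the mean of \<open>u\<^sup>* |h| u\<close> over the disc is a weighted trace of \<open>|h|\<close> with
  weights \<open>\<gamma> (2 i)\<^sup>2 / (2 i + 1) \<le> 4/\<pi>\<close> (\<open>berg_square_le\<close>).

  To stay with finite sums, \<open>G\<close> is replaced by polynomials (the vectors \<open>u\<close>, \<open>v\<close> are cut off at
  length \<open>L\<close>) and the integral by means over polar grids. Two limits remain, and they are taken on
  the side of the multipliers: by \<open>schur_ball_limit\<close> closed balls of the multiplier space are closed
  under pointwise limits. For this multipliers are described by positive definite kernels, which
  converge along subsequences on a countable group and yield vectors in the sequence space by a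
  Cholesky decomposition.

  That \<open>k\<close> is of trace class has to be derived from the same property of \<open>h\<close>: \<open>|k|\<close> exists as the
  square root of a positive operator, and \<open>|k| \<le> |h|\<close> since \<open>k\<close> is \<open>h\<close> followed by a shift. Both this
  comparison and \<open>|u\<^sup>T h u| \<le> u\<^sup>* |h| u\<close> are instances of \<open>self_adjoint_le_of_norm_le\<close>.
\<close>

section \<open>Positive operators on a real Hilbert space\<close>

definition self_adjoint :: "('a::real_inner \<Rightarrow> 'a) \<Rightarrow> bool" where
  "self_adjoint Q \<longleftrightarrow> bounded_linear Q \<and> (\<forall>x y. Q x \<bullet> y = x \<bullet> Q y)"

definition positive_op :: "('a::real_inner \<Rightarrow> 'a) \<Rightarrow> bool" where
  "positive_op Q \<longleftrightarrow> self_adjoint Q \<and> (\<forall>x. 0 \<le> Q x \<bullet> x)"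

lemma self_adjointD: "self_adjoint Q \<Longrightarrow> Q x \<bullet> y = x \<bullet> Q y"
  by (simp add: self_adjoint_def)

lemma positive_op_cauchy_schwarz:
  assumes "positive_op Q"
  shows "(Q x \<bullet> y)\<^sup>2 \<le> (Q x \<bullet> x) * (Q y \<bullet> y)"
proof -
  have sa: "Q u \<bullet> v = Q v \<bullet> u" for u v
    using assms self_adjointD[of Q u v] by (simp add: positive_op_def inner_commute)
  interpret bounded_linear Q using assms by (simp add: positive_op_def self_adjoint_def)
  have q: "0 \<le> (Q x \<bullet> x) + 2 * t * (Q x \<bullet> y) + t\<^sup>2 * (Q y \<bullet> y)" for t
  proof -
    have "0 \<le> Q (x + t *\<^sub>R y) \<bullet> (x + t *\<^sub>R y)" using assms by (simp add: positive_op_def)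
    then show ?thesis
      by (simp add: add scaleR inner_add_left inner_add_right sa[of y x] power2_eq_square algebra_simps)
  qed
  show ?thesis
  proof (cases "Q y \<bullet> y = 0")
    case True
    have "Q x \<bullet> y = 0"
    proof (rule ccontr)
      assume "Q x \<bullet> y \<noteq> 0"
      then show False using q[of "- (Q x \<bullet> x + 1) / (2 * (Q x \<bullet> y))"] True by (simp add: field_simps)
    qed
    then show ?thesis using True by simp
  next
    case False
    then have p: "Q y \<bullet> y > 0" using assms by (simp add: positive_op_def less_le)
    then show ?thesis
      using q[of "- (Q x \<bullet> y) / (Q y \<bullet> y)"] by (simp add: field_simps power2_eq_square)
  qed
qed

lemma positive_op_norm_sq_le:
  assumes Q: "positive_op Q" and K: "\<And>x. norm (Q x) \<le> K * norm x"
  shows "(norm (Q x))\<^sup>2 \<le> K * (Q x \<bullet> x)"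
proof (cases "Q x = 0")
  case False
  have "((norm (Q x))\<^sup>2)\<^sup>2 \<le> (Q x \<bullet> x) * (Q (Q x) \<bullet> Q x)"
    using positive_op_cauchy_schwarz[OF Q, of x "Q x"] by (simp add: dot_square_norm)
  also have "\<dots> \<le> (Q x \<bullet> x) * (K * (norm (Q x))\<^sup>2)"
  proof (rule mult_left_mono)
    have "Q (Q x) \<bullet> Q x \<le> norm (Q (Q x)) * norm (Q x)" by (rule norm_cauchy_schwarz)
    also have "\<dots> \<le> K * norm (Q x) * norm (Q x)" by (intro mult_right_mono K) simp
    finally show "Q (Q x) \<bullet> Q x \<le> K * (norm (Q x))\<^sup>2" by (simp add: power2_eq_square mult.assoc)
  qed (use Q in \<open>simp add: positive_op_def\<close>)
  finally have "(norm (Q x))\<^sup>2 * (norm (Q x))\<^sup>2 \<le> (K * (Q x \<bullet> x)) * (norm (Q x))\<^sup>2"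
    by (simp add: power2_eq_square mult_ac)
  moreover have "0 < (norm (Q x))\<^sup>2" using False by simp
  ultimately show ?thesis by (simp only: mult_le_cancel_right_pos)
qed (use Q in \<open>simp add: positive_op_def\<close>)

text \<open>
  Monotonicity of the square root, in the form \<open>T\<^sup>2 \<le> D\<^sup>2\<close> implies \<open>T \<le> D\<close> for \<open>D \<ge> 0\<close>. If the
  bottom \<open>\<lambda>\<close> of the spectrum of \<open>D - T\<close> were negative, an approximate eigenvector \<open>x\<close> would give
  \<open>\<parallel>D x\<parallel>\<^sup>2 - \<parallel>T x\<parallel>\<^sup>2 = (D + T) x \<bullet> (D - T) x \<approx> \<lambda> (2 (D x \<bullet> x) - \<lambda>) < 0\<close>.
\<close>

lemma self_adjoint_le_of_norm_le:
  assumes D: "positive_op D" and T: "self_adjoint T" and le: "\<And>x. norm (T x) \<le> norm (D x)"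
  shows "T x \<bullet> x \<le> D x \<bullet> x"
proof (rule ccontr)
  assume neg: "\<not> T x \<bullet> x \<le> D x \<bullet> x"
  interpret D: bounded_linear D using D by (simp add: positive_op_def self_adjoint_def)
  interpret T: bounded_linear T using T by (simp add: self_adjoint_def)
  obtain KD where KD: "\<And>x. norm (D x) \<le> norm x * KD" "KD > 0" using D.pos_bounded by blast
  define K where "K = 2 * KD"
  have K0: "K > 0" using KD by (simp add: K_def)
  have bD: "norm (D x) \<le> KD * norm x" and bT: "norm (T x) \<le> KD * norm x" for x
    using KD(1)[of x] le[of x] by (auto simp: mult.commute)
  define Q where "Q x = D x - T x" for x
  have Qle: "norm (Q x) \<le> K * norm x" for x
    using norm_triangle_ineq4[of "D x" "T x"] bD[of x] bT[of x] by (simp add: Q_def K_def)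
  define S where "S = {Q x \<bullet> x | x. norm x = 1}"
  have lb: "- K \<le> Q x \<bullet> x" if "norm x = 1" for x
    using Cauchy_Schwarz_ineq2[of "Q x" x] Qle[of x] that by simp
  have bdd: "bdd_below S" unfolding bdd_below_def S_def using lb by blast
  define l where "l = Inf S"
  have x0: "x \<noteq> 0" using neg by (auto simp: D.zero T.zero)
  have QR: "Q (c *\<^sub>R x) = c *\<^sub>R Q x" for c x by (simp add: Q_def D.scaleR T.scaleR scaleR_diff_right)
  have unit: "Q x \<bullet> x = (norm x)\<^sup>2 * (Q (inverse (norm x) *\<^sub>R x) \<bullet> (inverse (norm x) *\<^sub>R x))"
    if "x \<noteq> 0" for x
    using that by (simp add: QR power2_eq_square field_simps)
  have inS: "Q (inverse (norm x) *\<^sub>R x) \<bullet> (inverse (norm x) *\<^sub>R x) \<in> S" if "x \<noteq> 0" for x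
    unfolding S_def using that by (intro CollectI exI[of _ "inverse (norm x) *\<^sub>R x"]) auto
  have Sne: "S \<noteq> {}" using inS[OF x0] by auto
  have "Q x \<bullet> x < 0" using neg by (simp add: Q_def inner_diff_left)
  then have "Q (inverse (norm x) *\<^sub>R x) \<bullet> (inverse (norm x) *\<^sub>R x) < 0"
    using unit[OF x0] x0 by (simp add: mult_less_0_iff)
  then have l0: "l < 0" using cInf_lower[OF inS[OF x0] bdd] unfolding l_def by linarith
  have lge: "- K \<le> l" unfolding l_def by (rule cInf_greatest[OF Sne]) (use lb in \<open>auto simp: S_def\<close>)
  define R where "R x = Q x - l *\<^sub>R x" for x
  have R: "positive_op R"
    unfolding positive_op_def self_adjoint_def
  proof (intro conjI allI)
    show "bounded_linear R" unfolding R_def Q_def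
      by (intro bounded_linear_sub D.bounded_linear_axioms T.bounded_linear_axioms
          bounded_linear_scaleR_right)
    show "R x \<bullet> y = x \<bullet> R y" for x y
      using D T by (simp add: R_def Q_def inner_diff_left inner_diff_right self_adjoint_def
          positive_op_def)
    show "0 \<le> R x \<bullet> x" for x
    proof (cases "x = 0")
      case False
      have "l \<le> Q (inverse (norm x) *\<^sub>R x) \<bullet> (inverse (norm x) *\<^sub>R x)"
        unfolding l_def by (rule cInf_lower[OF inS[OF False] bdd])
      then have "(norm x)\<^sup>2 * l \<le> Q x \<bullet> x" unfolding unit[OF False] by (rule mult_left_mono) simp
      then show ?thesis by (simp add: R_def inner_diff_left dot_square_norm mult.commute)
    qed simp
  qed
  have Rle: "norm (R x) \<le> (2 * K) * norm x" for x
  proof -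
    have "norm (R x) \<le> norm (Q x) + \<bar>l\<bar> * norm x"
      unfolding R_def using norm_triangle_ineq4[of "Q x" "l *\<^sub>R x"] by simp
    also have "\<bar>l\<bar> * norm x \<le> K * norm x" using l0 lge by (intro mult_right_mono) auto
    finally show ?thesis using Qle[of x] by simp
  qed
  \<comment> \<open>small enough that the error term \<open>K \<parallel>R y\<parallel>\<close> below stays under \<open>l\<^sup>2 / 2\<close>\<close>
  define e where "e = min (- l / 2) (l ^ 4 / (16 * K ^ 3))"
  have e0: "e > 0" using l0 K0 by (simp add: e_def)
  obtain y where y: "norm y = 1" "Q y \<bullet> y < l + e"
    using cInf_lessD[OF Sne, of "l + e"] e0 by (auto simp: S_def l_def)
  have Ry: "R y \<bullet> y < e" using y by (simp add: R_def inner_diff_left dot_square_norm)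
  have "(norm (R y))\<^sup>2 \<le> (2 * K) * (R y \<bullet> y)" by (rule positive_op_norm_sq_le[OF R Rle])
  also have "\<dots> < (2 * K) * e" using Ry K0 by simp
  also have "\<dots> \<le> (2 * K) * (l ^ 4 / (16 * K ^ 3))"
    using K0 by (intro mult_left_mono) (simp_all add: e_def)
  also have "\<dots> < (l\<^sup>2 / (2 * K))\<^sup>2"
    using K0 l0 by (simp add: field_simps power2_eq_square power3_eq_cube eval_nat_numeral)
  finally have Ry2: "norm (R y) < l\<^sup>2 / (2 * K)"
    using K0 by (simp add: power2_less_imp_less)
  have "0 \<le> (norm (D y))\<^sup>2 - (norm (T y))\<^sup>2" using le[of y] by (simp add: power_mono)
  also have "\<dots> = (D y + T y) \<bullet> Q y"
    by (simp add: Q_def power2_norm_eq_inner inner_add_left inner_diff_right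
        inner_commute[of "T y" "D y"])
  also have "\<dots> = (D y + T y) \<bullet> R y + l * (2 * (D y \<bullet> y) - Q y \<bullet> y)"
    by (simp add: R_def Q_def inner_add_left inner_diff_right inner_diff_left algebra_simps)
  also have "(D y + T y) \<bullet> R y < l\<^sup>2 / 2"
  proof -
    have "(D y + T y) \<bullet> R y \<le> norm (D y + T y) * norm (R y)" by (rule norm_cauchy_schwarz)
    also have "\<dots> \<le> K * norm (R y)"
      using norm_triangle_ineq[of "D y" "T y"] bD[of y] bT[of y] y
      by (intro mult_right_mono) (auto simp: K_def)
    also have "\<dots> < K * (l\<^sup>2 / (2 * K))" using Ry2 K0 by (rule mult_strict_left_mono)
    finally show ?thesis using K0 by simp
  qed
  also have "l * (2 * (D y \<bullet> y) - Q y \<bullet> y) \<le> l * (- l / 2)"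
  proof (rule mult_left_mono_neg)
    have "0 \<le> D y \<bullet> y" using D by (simp add: positive_op_def)
    moreover have "e \<le> - l / 2" by (simp add: e_def)
    ultimately show "- l / 2 \<le> 2 * (D y \<bullet> y) - Q y \<bullet> y" using y(2) by linarith
  qed (use l0 in simp)
  finally show False by (simp add: power2_eq_square)
qed

text \<open>The coefficients of the power series of \<open>sqrt (1 - x)\<close>.\<close>

definition sqrt_coeff :: "nat \<Rightarrow> real" where
  "sqrt_coeff k = (- 1) ^ k * (1 / 2 gchoose k)"

lemma sqrt_coeff_0: "sqrt_coeff 0 = 1" by (simp add: sqrt_coeff_def)

lemma gbinomial_Suc_eq:
  "(a :: real) gchoose Suc k = (a gchoose k) * ((a - real k) / real (Suc k))"
proof -
  have "(a gchoose Suc k) * real (Suc k) = (a gchoose k) * (a - real k)"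
    using gbinomial_mult_1[of a k] by (simp add: algebra_simps)
  then show ?thesis by (simp add: field_simps)
qed

lemma sqrt_coeff_Suc: "sqrt_coeff (Suc k) = sqrt_coeff k * ((real k - 1 / 2) / real (Suc k))"
  by (simp add: sqrt_coeff_def gbinomial_Suc_eq field_simps)

lemma sqrt_coeff_nonpos: "sqrt_coeff (Suc k) \<le> 0"
proof (induction k)
  case 0 then show ?case by (simp add: sqrt_coeff_Suc sqrt_coeff_0)
next
  case (Suc k)
  have "0 \<le> (real (Suc k) - 1 / 2) / real (Suc (Suc k))" by simp
  with Suc show ?case unfolding sqrt_coeff_Suc[of "Suc k"] by (rule mult_nonpos_nonneg)
qed

text \<open>
  Summation divides the generating function by \<open>1 - x\<close>, so the partial sums are the coefficients of
  \<open>(1 - x)\<^bsup>-1/2\<^esup>\<close>. As all summands but the first are negative, this gives absolute summability.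
\<close>

lemma sum_sqrt_coeff_nonneg: "0 \<le> (\<Sum>k\<le>n. sqrt_coeff k)"
proof -
  define p where "p n = (- 1) ^ n * ((- 1 / 2 :: real) gchoose n)" for n
  have p: "p (Suc k) = p k * ((real k + 1 / 2) / real (Suc k))" for k
    by (simp add: p_def gbinomial_Suc_eq field_simps)
  have "0 \<le> p n" by (induction n) (simp_all add: p p_def[of 0])
  moreover have "(\<Sum>k\<le>n. sqrt_coeff k) = p n"
    using gbinomial_sum_lower_neg[of "1/2 :: real" n] by (simp add: sqrt_coeff_def p_def mult.commute)
  ultimately show ?thesis by simp
qed

lemma sqrt_coeff_abs: "\<bar>sqrt_coeff k\<bar> = 2 * of_bool (k = 0) - sqrt_coeff k"
  using sqrt_coeff_nonpos[of "k - 1"] by (cases k) (simp_all add: sqrt_coeff_0)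

lemma summable_abs_sqrt_coeff: "summable (\<lambda>k. \<bar>sqrt_coeff k\<bar>)"
proof (rule summableI_nonneg_bounded[where x = 2])
  fix n
  have "(\<Sum>k<n. \<bar>sqrt_coeff k\<bar>) \<le> (\<Sum>k\<le>n. \<bar>sqrt_coeff k\<bar>)" by (rule sum_mono2) auto
  also have "\<dots> = 2 - (\<Sum>k\<le>n. sqrt_coeff k)"
    by (simp add: sqrt_coeff_abs sum_subtractf sum_distrib_left[symmetric])
  finally show "(\<Sum>k<n. \<bar>sqrt_coeff k\<bar>) \<le> 2" using sum_sqrt_coeff_nonneg[of n] by linarith
qed simp

lemma sqrt_coeff_convolution:
  "(\<Sum>k\<le>n. sqrt_coeff k * sqrt_coeff (n - k)) = (if n = 0 then 1 else if n = 1 then - 1 else 0)"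
proof -
  have "(\<Sum>k\<le>n. sqrt_coeff k * sqrt_coeff (n - k))
      = (\<Sum>k\<le>n. (- 1) ^ n * ((1 / 2 gchoose k) * (1 / 2 gchoose (n - k))))"
    by (rule sum.cong) (auto simp: sqrt_coeff_def power_add[symmetric])
  also have "\<dots> = (- 1) ^ n * (1 gchoose n)"
    using gbinomial_Vandermonde[of "1/2::real" "1/2" n]
    by (simp add: sum_distrib_left[symmetric] atMost_atLeast0)
  also have "(1 gchoose n :: real) = real (1 choose n)" by (simp add: binomial_gbinomial)
  finally show ?thesis by (cases n) (auto simp: binomial_eq_0)
qed

text \<open>
  With \<open>b n = X\<^sup>n x \<bullet> y\<close> this is \<open>sqrt (1 - X)\<^sup>2 = 1 - X\<close>; a scalar statement lets the double series be
  rearranged as a Cauchy product.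
\<close>

lemma sqrt_series_square:
  assumes b: "\<And>n. \<bar>b n\<bar> \<le> (M :: real)"
  shows "(\<lambda>j. sqrt_coeff j * (\<Sum>k. sqrt_coeff k * b (j + k))) sums (b 0 - b 1)"
proof -
  let ?a = sqrt_coeff
  have M0: "0 \<le> M" using b[of 0] by linarith
  have ab: "(\<lambda>k. \<bar>?a k\<bar>) summable_on UNIV"
    by (rule norm_summable_imp_summable_on) (simp add: summable_abs_sqrt_coeff)
  define A where "A = (\<Sum>k. \<bar>?a k\<bar>)"
  have A: "((\<lambda>k. \<bar>?a k\<bar>) has_sum A) UNIV"
    unfolding A_def using summable_abs_sqrt_coeff
    by (intro norm_summable_imp_has_sum) (auto simp: summable_sums)
  have 1: "(\<lambda>(j, k). \<bar>?a j\<bar> * \<bar>?a k\<bar> * M) summable_on (UNIV \<times> UNIV)"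
  proof (rule summable_on_SigmaI)
    show "((\<lambda>k. case (j, k) of (j, k) \<Rightarrow> \<bar>?a j\<bar> * \<bar>?a k\<bar> * M) has_sum (\<bar>?a j\<bar> * A * M)) UNIV" for j
      using A by (auto intro!: has_sum_cmult_left has_sum_cmult_right)
    show "(\<lambda>j. \<bar>?a j\<bar> * A * M) summable_on UNIV"
      by (intro summable_on_cmult_left ab)
  qed (use M0 in auto)
  define g where "g = (\<lambda>(j, k). ?a j * ?a k * b (j + k))"
  have "g summable_on (UNIV \<times> UNIV)"
  proof (rule abs_summable_summable, rule summable_on_comparison_test[OF 1])
    show "norm (g z) \<le> (case z of (j, k) \<Rightarrow> \<bar>?a j\<bar> * \<bar>?a k\<bar> * M)" for z
      using b by (auto simp: g_def abs_mult intro!: mult_left_mono split: prod.split)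
  qed auto
  then obtain S where S: "(g has_sum S) (UNIV \<times> UNIV)" by (auto simp: summable_on_def)
  have sb: "summable (\<lambda>k. norm (?a k * b (j + k)))" for j
  proof (rule summable_comparison_test')
    show "summable (\<lambda>k. \<bar>?a k\<bar> * M)" by (intro summable_mult2 summable_abs_sqrt_coeff)
    show "norm (norm (?a k * b (j + k))) \<le> \<bar>?a k\<bar> * M" for k
      using b[of "j + k"] by (auto simp: abs_mult intro!: mult_left_mono)
  qed
  have "((\<lambda>j. ?a j * (\<Sum>k. ?a k * b (j + k))) has_sum S) UNIV"
  proof (rule has_sum_SigmaD[OF S])
    fix j
    have "((\<lambda>k. ?a k * b (j + k)) has_sum (\<Sum>k. ?a k * b (j + k))) UNIV"
      using sb[of j] summable_norm_cancel[OF sb[of j]]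
      by (intro norm_summable_imp_has_sum) (auto simp: summable_sums)
    then have "((\<lambda>k. ?a j * (?a k * b (j + k))) has_sum (?a j * (\<Sum>k. ?a k * b (j + k)))) UNIV"
      by (rule has_sum_cmult_right)
    then show "((\<lambda>k. g (j, k)) has_sum (?a j * (\<Sum>k. ?a k * b (j + k)))) UNIV"
      by (simp add: g_def mult.assoc)
  qed
  then have sums: "(\<lambda>j. ?a j * (\<Sum>k. ?a k * b (j + k))) sums S" by (rule has_sum_imp_sums)
  have bij: "bij_betw (\<lambda>(n, k). (k, n - k)) (Sigma UNIV (\<lambda>n. {..n})) (UNIV \<times> (UNIV :: nat set))"
    by (rule bij_betw_byWitness[where f' = "\<lambda>(i, j). (i + j, i)"]) auto
  have "((\<lambda>z. g (case z of (n, k) \<Rightarrow> (k, n - k))) has_sum S) (Sigma UNIV (\<lambda>n. {..n}))"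
    using S by (simp only: has_sum_reindex_bij_betw[OF bij])
  then have "((\<lambda>n. \<Sum>k\<le>n. g (k, n - k)) has_sum S) UNIV"
    by (rule has_sum_SigmaD) (auto intro: has_sum_finite)
  moreover have "(\<Sum>k\<le>n. g (k, n - k)) = b n * (if n = 0 then 1 else if n = 1 then - 1 else 0)" for n
    by (subst sqrt_coeff_convolution[symmetric], subst sum_distrib_left)
      (auto simp: g_def intro!: sum.cong)
  ultimately have "((\<lambda>n. b n * (if n = 0 then 1 else if n = 1 then - 1 else 0)) has_sum S) UNIV"
    by simp
  moreover have "((\<lambda>n. b n * (if n = 0 then 1 else if n = 1 then - 1 else 0)) has_sum (b 0 - b 1)) UNIV"
    by (rule has_sum_finite_neutralI[where B = "{0, 1}"]) auto
  ultimately show ?thesis using sums has_sum_unique by blast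
qed

text \<open>
  The binomial series of \<open>sqrt (1 - X)\<close> at \<open>X = 1 - P\<close> converges in norm, since \<open>0 \<le> P \<le> 1\<close> gives
  \<open>\<parallel>X\<parallel> \<le> 1\<close>. Commutation with the operators that commute with \<open>P\<close> is what later makes the
  square root complex-linear.
\<close>

lemma positive_contraction_sqrt:
  fixes P :: "'a::{real_inner,banach} \<Rightarrow> 'a"
  assumes P: "positive_op P" and le: "\<And>x. norm (P x) \<le> norm x"
  obtains R where "positive_op R" "\<And>x. R (R x) = P x"
    "\<And>J x. bounded_linear J \<Longrightarrow> (\<And>x. J (P x) = P (J x)) \<Longrightarrow> J (R x) = R (J x)"
proof -
  let ?a = sqrt_coeff
  interpret P: bounded_linear P using P by (simp add: positive_op_def self_adjoint_def)
  define X where "X x = x - P x" for x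
  have saP: "P x \<bullet> y = x \<bullet> P y" for x y using P by (simp add: positive_op_def self_adjoint_def)
  have P0: "0 \<le> P x \<bullet> x" for x using P by (simp add: positive_op_def)
  have bX: "bounded_linear X" unfolding X_def
    by (intro bounded_linear_sub P.bounded_linear_axioms bounded_linear_ident)
  have X0: "0 \<le> X x \<bullet> x" for x
  proof -
    have "P x \<bullet> x \<le> norm (P x) * norm x" by (rule norm_cauchy_schwarz)
    also have "\<dots> \<le> norm x * norm x" by (rule mult_right_mono[OF le]) simp
    finally show ?thesis by (simp add: X_def inner_diff_left dot_square_norm power2_eq_square)
  qed
  have X: "positive_op X"
    unfolding positive_op_def self_adjoint_def using bX X0
    by (auto simp: X_def inner_diff_left inner_diff_right saP)
  have X1: "X x \<bullet> x \<le> (norm x)\<^sup>2" for x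
    using P0[of x] by (simp add: X_def inner_diff_left dot_square_norm)
  have nX: "norm (X x) \<le> norm x" for x
  proof (cases "X x = 0")
    case False
    have "((norm (X x))\<^sup>2)\<^sup>2 \<le> (X x \<bullet> x) * (X (X x) \<bullet> X x)"
      using positive_op_cauchy_schwarz[OF X, of x "X x"] by (simp add: dot_square_norm)
    also have "\<dots> \<le> (norm x)\<^sup>2 * (norm (X x))\<^sup>2"
      by (intro mult_mono X1 X0) auto
    finally have "(norm (X x))\<^sup>2 * (norm (X x))\<^sup>2 \<le> (norm x)\<^sup>2 * (norm (X x))\<^sup>2"
      by (simp add: power2_eq_square)
    moreover have "0 < (norm (X x))\<^sup>2" using False by simp
    ultimately have "(norm (X x))\<^sup>2 \<le> (norm x)\<^sup>2" by (simp only: mult_le_cancel_right_pos)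
    then show ?thesis by simp
  qed simp
  define Y where "Y k = X ^^ k" for k
  have Y0: "Y 0 x = x" and YS: "Y (Suc k) x = X (Y k x)" for k x by (simp_all add: Y_def)
  have nY: "norm (Y k x) \<le> norm x" for k x
    by (induction k) (auto simp: Y0 YS intro: order_trans[OF nX])
  have bY: "bounded_linear (Y k)" for k
  proof (induction k)
    case 0 then show ?case by (simp add: Y_def bounded_linear_ident id_def)
  next
    case (Suc k)
    have "Y (Suc k) = (\<lambda>x. X (Y k x))" by (simp add: Y_def fun_eq_iff)
    then show ?case using bounded_linear_compose[OF bX Suc] by simp
  qed
  have saY: "Y k x \<bullet> y = x \<bullet> Y k y" for k x y
  proof (induction k arbitrary: x y)
    case (Suc k)
    have "Y (Suc k) x \<bullet> y = Y k x \<bullet> X y"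
      using X by (simp add: YS positive_op_def self_adjoint_def)
    also have "\<dots> = x \<bullet> Y k (X y)" by (rule Suc)
    also have "\<dots> = x \<bullet> Y (Suc k) y" by (simp add: Y_def funpow_swap1)
    finally show ?case .
  qed (simp add: Y0)
  have Yadd: "Y (j + k) x = Y k (Y j x)" for j k x by (simp add: Y_def funpow_add add.commute[of j])
  have sR': "summable (\<lambda>k. norm (?a k *\<^sub>R Y k x))" for x
  proof (rule summable_comparison_test')
    show "summable (\<lambda>k. \<bar>?a k\<bar> * norm x)" by (intro summable_mult2 summable_abs_sqrt_coeff)
    show "norm (norm (?a k *\<^sub>R Y k x)) \<le> \<bar>?a k\<bar> * norm x" for k
      using nY[of k x] by (auto intro!: mult_left_mono)
  qed
  have sR: "summable (\<lambda>k. ?a k *\<^sub>R Y k x)" for x by (rule summable_norm_cancel[OF sR'])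
  define R where "R x = (\<Sum>k. ?a k *\<^sub>R Y k x)" for x
  have nR: "norm (R x) \<le> norm x * (\<Sum>k. \<bar>?a k\<bar>)" for x
  proof -
    have "norm (R x) \<le> (\<Sum>k. norm (?a k *\<^sub>R Y k x))" unfolding R_def by (rule summable_norm[OF sR'])
    also have "\<dots> \<le> (\<Sum>k. norm x * \<bar>?a k\<bar>)"
      by (intro suminf_le sR' summable_mult summable_abs_sqrt_coeff)
        (auto simp: mult.commute[of "norm x"] intro!: mult_left_mono nY)
    also have "\<dots> = norm x * (\<Sum>k. \<bar>?a k\<bar>)" by (rule suminf_mult[OF summable_abs_sqrt_coeff])
    finally show ?thesis .
  qed
  have bR: "bounded_linear R"
  proof (rule bounded_linear_intro[OF _ _ nR])
    show "R (x + y) = R x + R y" for x y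
      unfolding R_def by (simp add: suminf_add[OF sR sR] linear_add[OF bounded_linear.linear[OF bY]] scaleR_add_right)
    show "R (c *\<^sub>R x) = c *\<^sub>R R x" for c x
      unfolding R_def
      by (simp add: suminf_scaleR_right[OF sR] linear_scale[OF bounded_linear.linear[OF bY]] mult.commute)
  qed
  have Rin: "(\<lambda>k. ?a k * (Y k x \<bullet> y)) sums (R x \<bullet> y)" for x y
    using bounded_linear.sums[OF bounded_linear_inner_left summable_sums[OF sR[of x]], of y]
    by (simp add: R_def)
  have saR: "R x \<bullet> y = x \<bullet> R y" for x y
  proof -
    have "Y k y \<bullet> x = Y k x \<bullet> y" for k using saY[of k y x] by (simp add: inner_commute)
    then have "(\<lambda>k. ?a k * (Y k x \<bullet> y)) sums (R y \<bullet> x)" using Rin[of y x] by simp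
    then have "R x \<bullet> y = R y \<bullet> x" using Rin[of x y] sums_unique2 by blast
    then show ?thesis by (simp add: inner_commute)
  qed
  have R0: "0 \<le> R x \<bullet> x" for x
  proof -
    have "(\<lambda>n. \<Sum>k\<le>n. ?a k) \<longlonglongrightarrow> (\<Sum>k. ?a k)"
      by (rule summable_LIMSEQ', rule summable_rabs_cancel[OF summable_abs_sqrt_coeff])
    then have "0 \<le> (\<Sum>k. ?a k)"
      by (rule LIMSEQ_le_const) (use sum_sqrt_coeff_nonneg in auto)
    then have "0 \<le> (\<Sum>k. ?a k) * (norm x)\<^sup>2" by simp
    also have "\<dots> \<le> R x \<bullet> x"
    proof (rule sums_le[OF _ sums_mult2[OF summable_sums] Rin])
      show "summable ?a" by (rule summable_rabs_cancel[OF summable_abs_sqrt_coeff])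
      show "?a k * (norm x)\<^sup>2 \<le> ?a k * (Y k x \<bullet> x)" for k
      proof (cases k)
        case 0 then show ?thesis by (simp add: Y0 dot_square_norm)
      next
        case (Suc l)
        have "Y k x \<bullet> x \<le> norm (Y k x) * norm x" by (rule norm_cauchy_schwarz)
        also have "\<dots> \<le> norm x * norm x" by (rule mult_right_mono[OF nY]) simp
        finally show ?thesis using sqrt_coeff_nonpos[of l] Suc
          by (auto simp: power2_eq_square intro!: mult_left_mono_neg)
      qed
    qed
    finally show ?thesis .
  qed
  have sq: "R (R x) = P x" for x
  proof (rule vector_eq_rdot[THEN iffD1], rule allI)
    fix y
    define b where "b n = Y n x \<bullet> y" for n
    have "\<bar>b n\<bar> \<le> norm x * norm y" for n
      using Cauchy_Schwarz_ineq2[of "Y n x" y] mult_right_mono[OF nY[of n x], of "norm y"]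
      by (simp add: b_def)
    from sqrt_series_square[OF this]
    have "(\<lambda>j. ?a j * (\<Sum>k. ?a k * b (j + k))) sums (b 0 - b 1)" .
    moreover have "(\<Sum>k. ?a k * b (j + k)) = Y j (R x) \<bullet> y" for j
    proof -
      have "b (j + k) = Y k x \<bullet> Y j y" for k
        unfolding b_def by (subst add.commute, subst Yadd, rule saY)
      then show ?thesis using sums_unique[OF Rin[of x "Y j y"]] saY[of j "R x" y] by simp
    qed
    ultimately have "(\<lambda>j. ?a j * (Y j (R x) \<bullet> y)) sums (b 0 - b 1)" by simp
    from sums_unique2[OF Rin[of "R x" y] this] have "R (R x) \<bullet> y = b 0 - b 1" .
    also have "\<dots> = P x \<bullet> y" by (simp add: b_def Y_def X_def inner_diff_left)
    finally show "R (R x) \<bullet> y = P x \<bullet> y" .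
  qed
  show thesis
  proof (rule that[of R])
    show "positive_op R" using bR saR R0 by (simp add: positive_op_def self_adjoint_def)
    show "R (R x) = P x" for x by (rule sq)
    fix J :: "'a \<Rightarrow> 'a" and x assume J: "bounded_linear J" and c: "\<And>x. J (P x) = P (J x)"
    interpret J: bounded_linear J by (rule J)
    have JY: "J (Y k x) = Y k (J x)" for k
      by (induction k) (simp_all add: Y0 YS X_def J.diff c)
    show "J (R x) = R (J x)"
      using J.suminf[OF sR[of x]] by (simp add: R_def J.scaleR JY)
  qed
qed

theorem positive_op_sqrt:
  fixes P :: "'a::{real_inner,banach} \<Rightarrow> 'a"
  assumes P: "positive_op P"
  obtains R where "positive_op R" "\<And>x. R (R x) = P x"
    "\<And>J x. bounded_linear J \<Longrightarrow> (\<And>x. J (P x) = P (J x)) \<Longrightarrow> J (R x) = R (J x)"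
proof -
  interpret P: bounded_linear P using P by (simp add: positive_op_def self_adjoint_def)
  obtain K where K: "\<And>x. norm (P x) \<le> norm x * K" "K > 0" using P.pos_bounded by blast
  define P' where "P' x = inverse K *\<^sub>R P x" for x
  have "positive_op P'"
    using P K(2) unfolding positive_op_def self_adjoint_def P'_def
    by (auto intro: bounded_linear_scaleR_right bounded_linear_compose)
  moreover have "norm (P' x) \<le> norm x" for x
    using K by (simp add: P'_def field_simps)
  ultimately obtain R where R: "positive_op R" "\<And>x. R (R x) = P' x"
    "\<And>J x. bounded_linear J \<Longrightarrow> (\<And>x. J (P' x) = P' (J x)) \<Longrightarrow> J (R x) = R (J x)"
    using positive_contraction_sqrt[of P'] by blast
  interpret R: bounded_linear R using R by (simp add: positive_op_def self_adjoint_def)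
  define R' where "R' x = sqrt K *\<^sub>R R x" for x
  show thesis
  proof (rule that[of R'])
    show "positive_op R'" using R(1) K(2) unfolding positive_op_def self_adjoint_def R'_def
      by (auto intro: bounded_linear_scaleR_right bounded_linear_compose)
    have "sqrt K * (sqrt K * inverse K) = 1" using K(2) by (simp add: mult.assoc[symmetric])
    then show "R' (R' x) = P x" for x by (simp add: R'_def R.scaleR R(2) P'_def)
    fix J :: "'a \<Rightarrow> 'a" and x assume J: "bounded_linear J" and c: "\<And>x. J (P x) = P (J x)"
    interpret J: bounded_linear J by (rule J)
    show "J (R' x) = R' (J x)"
      using R(3)[OF J, of x] by (simp add: R'_def P'_def J.scaleR c)
  qed
qed

section \<open>The Hilbert space of square summable complex sequences\<close>

typedef l2 = ell2
  by (rule exI[of _ "\<lambda>_. 0"]) (simp add: ell2_def)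

setup_lifting type_definition_l2

lemma ell2_inner: "x \<in> ell2 \<longleftrightarrow> summable (\<lambda>n. x n \<bullet> x n)"
  by (simp add: ell2_def dot_square_norm)

lemma ell2_summable_inner:
  assumes "x \<in> ell2" "y \<in> ell2"
  shows "summable (\<lambda>n. x n \<bullet> y n)"
proof (rule summable_comparison_test')
  show "summable (\<lambda>n. (cmod (x n))\<^sup>2 + (cmod (y n))\<^sup>2)"
    using assms by (simp add: ell2_def summable_add)
  show "norm (x n \<bullet> y n) \<le> (cmod (x n))\<^sup>2 + (cmod (y n))\<^sup>2" for n
  proof -
    have "norm (x n \<bullet> y n) \<le> cmod (x n) * cmod (y n)" by (simp add: Cauchy_Schwarz_ineq2)
    moreover have "2 * (cmod (x n) * cmod (y n)) \<le> (cmod (x n))\<^sup>2 + (cmod (y n))\<^sup>2"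
      using sum_squares_bound[of "cmod (x n)" "cmod (y n)"] by simp
    moreover have "0 \<le> cmod (x n) * cmod (y n)" by simp
    ultimately show ?thesis by linarith
  qed
qed

lemma ell2_0 [simp]: "(\<lambda>_. 0) \<in> ell2"
  by (simp add: ell2_def)

lemma ell2_add: "x \<in> ell2 \<Longrightarrow> y \<in> ell2 \<Longrightarrow> (\<lambda>n. x n + y n) \<in> ell2"
  unfolding ell2_inner
  by (simp add: inner_add_left inner_add_right)
    (intro summable_add; simp add: ell2_inner[symmetric] ell2_summable_inner)

lemma ell2_cmult: "x \<in> ell2 \<Longrightarrow> (\<lambda>n. c * x n) \<in> ell2"
  unfolding ell2_def by (simp add: norm_mult power_mult_distrib summable_mult)

instantiation l2 :: real_vector
begin

lift_definition zero_l2 :: l2 is "\<lambda>_. 0" by simp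
lift_definition plus_l2 :: "l2 \<Rightarrow> l2 \<Rightarrow> l2" is "\<lambda>x y n. x n + y n" by (rule ell2_add)
lift_definition uminus_l2 :: "l2 \<Rightarrow> l2" is "\<lambda>x n. - x n" by (simp add: ell2_def)
lift_definition minus_l2 :: "l2 \<Rightarrow> l2 \<Rightarrow> l2" is "\<lambda>x y n. x n - y n"
  using ell2_add[of _ "\<lambda>n. - _ n"] by (simp add: ell2_def)
lift_definition scaleR_l2 :: "real \<Rightarrow> l2 \<Rightarrow> l2" is "\<lambda>r x n. r *\<^sub>R x n"
  by (simp add: scaleR_conv_of_real ell2_cmult)

instance
  by standard (transfer; simp add: fun_eq_iff algebra_simps)+

end

instantiation l2 :: real_inner
begin

definition inner_l2 :: "l2 \<Rightarrow> l2 \<Rightarrow> real" where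
  "inner_l2 x y = (\<Sum>n. Rep_l2 x n \<bullet> Rep_l2 y n)"
definition norm_l2 :: "l2 \<Rightarrow> real" where "norm_l2 x = sqrt (x \<bullet> x)"
definition dist_l2 :: "l2 \<Rightarrow> l2 \<Rightarrow> real" where "dist_l2 x y = norm (x - y)"
definition sgn_l2 :: "l2 \<Rightarrow> l2" where "sgn_l2 x = x /\<^sub>R norm x"
definition uniformity_l2 :: "(l2 \<times> l2) filter" where
  "uniformity_l2 = (INF e\<in>{0<..}. principal {(x, y). dist x y < e})"
definition open_l2 :: "l2 set \<Rightarrow> bool" where
  "open_l2 U \<longleftrightarrow> (\<forall>x\<in>U. eventually (\<lambda>(x', y). x' = x \<longrightarrow> y \<in> U) uniformity)"

instance
proof
  fix x y z :: l2 and r s :: real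
  have s: "summable (\<lambda>n. Rep_l2 u n \<bullet> Rep_l2 v n)" for u v
    using Rep_l2[of u] Rep_l2[of v] by (rule ell2_summable_inner)

  show "dist x y = norm (x - y)" by (rule dist_l2_def)
  show "sgn x = x /\<^sub>R norm x" by (rule sgn_l2_def)
  show "(uniformity :: (l2 \<times> l2) filter) = (INF e\<in>{0<..}. principal {(x, y). dist x y < e})"
    by (rule uniformity_l2_def)
  show "open U \<longleftrightarrow> (\<forall>x\<in>U. eventually (\<lambda>(x', y). x' = x \<longrightarrow> y \<in> U) uniformity)" for U :: "l2 set"
    by (rule open_l2_def)
  show "x \<bullet> y = y \<bullet> x" by (simp add: inner_l2_def inner_commute)
  show "(x + y) \<bullet> z = x \<bullet> z + y \<bullet> z"
    by (simp add: inner_l2_def plus_l2.rep_eq inner_add_left suminf_add s)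
  show "(r *\<^sub>R x) \<bullet> y = r * (x \<bullet> y)"
    by (simp add: inner_l2_def scaleR_l2.rep_eq suminf_mult s)
  show "0 \<le> x \<bullet> x" unfolding inner_l2_def by (rule suminf_nonneg[OF s]) simp
  show "x \<bullet> x = 0 \<longleftrightarrow> x = 0"
  proof
    assume "x \<bullet> x = 0"
    then have "\<forall>n. Rep_l2 x n \<bullet> Rep_l2 x n = 0"
      unfolding inner_l2_def by (subst (asm) suminf_eq_zero_iff[OF s]) auto
    then show "x = 0" by (simp add: Rep_l2_inject[symmetric] zero_l2.rep_eq fun_eq_iff)
  qed (simp add: inner_l2_def zero_l2.rep_eq)
  show "norm x = sqrt (x \<bullet> x)" by (rule norm_l2_def)
qed

end

lemma summable_inner_l2: "summable (\<lambda>n. Rep_l2 x n \<bullet> Rep_l2 y n)"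
  using Rep_l2[of x] Rep_l2[of y] by (rule ell2_summable_inner)

lemma summable_norm_l2: "summable (\<lambda>n. (cmod (Rep_l2 x n))\<^sup>2)"
  using Rep_l2[of x] by (simp add: ell2_def)

lemma norm_l2_eq: "norm x = ell2_norm (Rep_l2 x)"
  by (simp add: norm_l2_def inner_l2_def ell2_norm_def dot_square_norm)

lemma norm_l2_square: "(norm x)\<^sup>2 = (\<Sum>n. (cmod (Rep_l2 x n))\<^sup>2)"
  by (simp add: norm_l2_def inner_l2_def dot_square_norm suminf_nonneg summable_norm_l2)

lemma norm_Rep_l2_le: "cmod (Rep_l2 x n) \<le> norm x"
proof -
  have "(cmod (Rep_l2 x n))\<^sup>2 = (\<Sum>i\<in>{n}. (cmod (Rep_l2 x i))\<^sup>2)" by simp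
  also have "\<dots> \<le> (norm x)\<^sup>2"
    unfolding norm_l2_square by (rule sum_le_suminf[OF summable_norm_l2]) auto
  finally show ?thesis by (simp add: power2_le_iff_abs_le)
qed

instance l2 :: complete_space
proof
  fix X :: "nat \<Rightarrow> l2" assume X: "Cauchy X"
  have "Cauchy (\<lambda>n. Rep_l2 (X n) i)" for i
  proof (rule metric_CauchyI)
    fix e :: real assume "e > 0"
    then obtain M where M: "\<And>m n. m \<ge> M \<Longrightarrow> n \<ge> M \<Longrightarrow> dist (X m) (X n) < e"
      using metric_CauchyD[OF X] by blast
    have "dist (Rep_l2 (X m) i) (Rep_l2 (X n) i) \<le> dist (X m) (X n)" for m n
      using norm_Rep_l2_le[of "X m - X n" i] by (simp add: dist_norm minus_l2.rep_eq)
    then show "\<exists>M. \<forall>m\<ge>M. \<forall>n\<ge>M. dist (Rep_l2 (X m) i) (Rep_l2 (X n) i) < e"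
      using M by (meson le_less_trans)
  qed
  then have "\<forall>i. \<exists>l. (\<lambda>n. Rep_l2 (X n) i) \<longlonglongrightarrow> l"
    by (auto simp: Cauchy_convergent_iff convergent_def)
  then obtain L where L: "\<And>i. (\<lambda>n. Rep_l2 (X n) i) \<longlonglongrightarrow> L i" by metis
  have close: "\<exists>M. \<forall>n\<ge>M. \<forall>K. (\<Sum>i<K. (cmod (Rep_l2 (X n) i - L i))\<^sup>2) \<le> e\<^sup>2" if e: "e > 0" for e
  proof -
    obtain M where M: "\<And>m n. m \<ge> M \<Longrightarrow> n \<ge> M \<Longrightarrow> dist (X m) (X n) < e"
      using metric_CauchyD[OF X e] by blast
    have "(\<Sum>i<K. (cmod (Rep_l2 (X n) i - L i))\<^sup>2) \<le> e\<^sup>2" if n: "n \<ge> M" for n K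
    proof (rule LIMSEQ_le_const2)
      show "(\<lambda>m. \<Sum>i<K. (cmod (Rep_l2 (X n) i - Rep_l2 (X m) i))\<^sup>2)
          \<longlonglongrightarrow> (\<Sum>i<K. (cmod (Rep_l2 (X n) i - L i))\<^sup>2)"
        by (intro tendsto_intros L)
      show "\<exists>N. \<forall>m\<ge>N. (\<Sum>i<K. (cmod (Rep_l2 (X n) i - Rep_l2 (X m) i))\<^sup>2) \<le> e\<^sup>2"
      proof (intro exI[of _ M] allI impI)
        fix m assume m: "m \<ge> M"
        have "(\<Sum>i<K. (cmod (Rep_l2 (X n) i - Rep_l2 (X m) i))\<^sup>2) \<le> (norm (X n - X m))\<^sup>2"
          unfolding norm_l2_square
          using sum_le_suminf[OF summable_norm_l2[of "X n - X m"], of "{..<K}"]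
          by (simp add: minus_l2.rep_eq)
        also have "\<dots> \<le> e\<^sup>2"
          using M[OF n m] by (intro power_mono) (auto simp: dist_norm)
        finally show "(\<Sum>i<K. (cmod (Rep_l2 (X n) i - Rep_l2 (X m) i))\<^sup>2) \<le> e\<^sup>2" .
      qed
    qed
    then show ?thesis by blast
  qed
  obtain M where M: "\<And>K. (\<Sum>i<K. (cmod (Rep_l2 (X M) i - L i))\<^sup>2) \<le> 1"
    using close[of 1] by auto
  have "summable (\<lambda>i. (cmod (Rep_l2 (X M) i - L i))\<^sup>2)"
    by (rule summableI_nonneg_bounded[OF _ M]) simp
  then have "(\<lambda>i. Rep_l2 (X M) i - L i) \<in> ell2" by (simp add: ell2_def)
  from ell2_add[OF Rep_l2[of "X M"] ell2_cmult[OF this, of "-1"]] have L2: "L \<in> ell2" by simp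
  define v where "v = Abs_l2 L"
  have v: "Rep_l2 v = L" by (simp add: v_def Abs_l2_inverse L2)
  have "X \<longlonglongrightarrow> v"
  proof (rule metric_LIMSEQ_I)
    fix e :: real assume e: "e > 0"
    then obtain M where M: "\<And>n K. n \<ge> M \<Longrightarrow> (\<Sum>i<K. (cmod (Rep_l2 (X n) i - L i))\<^sup>2) \<le> (e / 2)\<^sup>2"
      using close[of "e / 2"] by auto
    have "dist (X n) v < e" if "n \<ge> M" for n
    proof -
      have "(norm (X n - v))\<^sup>2 \<le> (e / 2)\<^sup>2"
        unfolding norm_l2_square using M[OF that]
        by (intro suminf_le_const summable_norm_l2) (simp add: minus_l2.rep_eq v)
      then have "norm (X n - v) \<le> e / 2" using e by (simp add: power_mono_iff)
      then show ?thesis using e by (simp add: dist_norm)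
    qed
    then show "\<exists>M. \<forall>n\<ge>M. dist (X n) v < e" by blast
  qed
  then show "convergent X" by (auto simp: convergent_def)
qed

instance l2 :: banach ..

text \<open>
  The complex structure is kept as an operator on the real Hilbert space: conjugate-linear
  operators, which are needed below, are then covered by the results on real Hilbert spaces.
\<close>

lift_definition cscale :: "complex \<Rightarrow> l2 \<Rightarrow> l2" is "\<lambda>c x n. c * x n" by (rule ell2_cmult)

lemma summable_ell2_inner: "summable (\<lambda>n. Rep_l2 x n * cnj (Rep_l2 y n))"
proof -
  have "summable (\<lambda>n. Rep_l2 x n \<bullet> Rep_l2 y n)" and
    "summable (\<lambda>n. Rep_l2 x n \<bullet> Rep_l2 (cscale \<i> y) n)"
    by (rule summable_inner_l2)+
  then show ?thesis
    unfolding summable_complex_iff by (simp add: inner_complex_def cscale.rep_eq algebra_simps)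
qed

lemma Re_ell2_inner: "Re (ell2_inner (Rep_l2 x) (Rep_l2 y)) = x \<bullet> y"
  by (simp add: ell2_inner_def inner_l2_def inner_complex_def
      bounded_linear.suminf[OF bounded_linear_Re summable_ell2_inner])

lemma Im_ell2_inner: "Im (ell2_inner (Rep_l2 x) (Rep_l2 y)) = x \<bullet> cscale \<i> y"
  by (simp add: ell2_inner_def inner_l2_def inner_complex_def cscale.rep_eq algebra_simps
      bounded_linear.suminf[OF bounded_linear_Im summable_ell2_inner])

lemma cscale_of_real: "cscale (of_real r) x = r *\<^sub>R x"
  by transfer (simp add: scaleR_conv_of_real)

lemma cscale_add_right: "cscale c (x + y) = cscale c x + cscale c y"
  and cscale_add_left: "cscale (c + d) x = cscale c x + cscale d x"
  and cscale_cscale: "cscale c (cscale d x) = cscale (c * d) x"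
  and cscale_one: "cscale 1 x = x"
  and cscale_minus1: "cscale (-1) x = - x"
  by (transfer; simp add: algebra_simps)+

lemma norm_cscale: "norm (cscale c x) = cmod c * norm x"
proof (rule power2_eq_imp_eq)
  show "(norm (cscale c x))\<^sup>2 = (cmod c * norm x)\<^sup>2"
    by (simp add: norm_l2_square cscale.rep_eq norm_mult power_mult_distrib
        suminf_mult[OF summable_norm_l2])
qed simp_all

lemma bounded_linear_cscale: "bounded_linear (cscale c)"
proof (rule bounded_linear_intro)
  show "cscale c (r *\<^sub>R x) = r *\<^sub>R cscale c x" for r x
    by (simp add: cscale_of_real[symmetric] cscale_cscale mult.commute)
  show "norm (cscale c x) \<le> norm x * cmod c" for x by (simp add: norm_cscale)
qed (rule cscale_add_right)

lift_definition unit_l2 :: "nat \<Rightarrow> l2" is "\<lambda>j i. of_bool (i = j)"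
proof -
  fix j
  have "(\<lambda>n. (cmod (of_bool (n = j)))\<^sup>2) sums (\<Sum>n\<in>{j}. (cmod (of_bool (n = j)))\<^sup>2)"
    by (rule sums_finite) auto
  then show "(\<lambda>i. of_bool (i = j)) \<in> ell2" by (simp add: ell2_def sums_iff)
qed

lemma Rep_sum: "Rep_l2 (sum f A) n = (\<Sum>i\<in>A. Rep_l2 (f i) n)"
  by (induction A rule: infinite_finite_induct) (simp_all add: zero_l2.rep_eq plus_l2.rep_eq)

lemma unit_l2_expansion: "(\<lambda>j. cscale (Rep_l2 x j) (unit_l2 j)) sums x"
  unfolding sums_def tendsto_iff
proof (intro allI impI)
  fix e :: real assume e: "e > 0"
  let ?s = "\<lambda>n. \<Sum>j<n. cscale (Rep_l2 x j) (unit_l2 j)"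
  have "(\<lambda>n. \<Sum>i<n. (cmod (Rep_l2 x i))\<^sup>2) \<longlonglongrightarrow> (norm x)\<^sup>2"
    unfolding norm_l2_square by (rule summable_LIMSEQ[OF summable_norm_l2])
  then have "\<forall>\<^sub>F n in sequentially. dist (\<Sum>i<n. (cmod (Rep_l2 x i))\<^sup>2) ((norm x)\<^sup>2) < e\<^sup>2"
    using e by (auto simp: tendsto_iff)
  then show "\<forall>\<^sub>F n in sequentially. dist (?s n) x < e"
  proof eventually_elim
    case (elim n)
    have c: "Rep_l2 (?s n) i = (if i < n then Rep_l2 x i else 0)" for i
      by (simp add: Rep_sum cscale.rep_eq unit_l2.rep_eq of_bool_def if_distrib[of "(*) _"] cong: if_cong)
    have "(norm (x - ?s n))\<^sup>2 = (\<Sum>i. (cmod (Rep_l2 (x - ?s n) i))\<^sup>2)" by (rule norm_l2_square)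
    also have "\<dots> = (\<Sum>i. (cmod (Rep_l2 (x - ?s n) (i + n)))\<^sup>2) + (\<Sum>i<n. (cmod (Rep_l2 (x - ?s n) i))\<^sup>2)"
      by (rule suminf_split_initial_segment[OF summable_norm_l2])
    also have "\<dots> = (\<Sum>i. (cmod (Rep_l2 x (i + n)))\<^sup>2)"
      by (simp add: minus_l2.rep_eq c)
    also have "\<dots> = (norm x)\<^sup>2 - (\<Sum>i<n. (cmod (Rep_l2 x i))\<^sup>2)"
      unfolding norm_l2_square by (rule suminf_minus_initial_segment[OF summable_norm_l2])
    also have "\<dots> < e\<^sup>2" using elim by (simp add: dist_real_def)
    finally show ?case using e by (simp add: dist_norm norm_minus_commute power2_less_imp_less)
  qed
qed

lemma Rep_unit_l2: "Rep_l2 (unit_l2 j) i = (if i = j then 1 else 0)"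
  by (simp add: unit_l2.rep_eq)

lemma inner_cscale_unit: "x \<bullet> cscale c (unit_l2 i) = Rep_l2 x i \<bullet> c"
proof -
  have "(\<lambda>n. Rep_l2 x n \<bullet> Rep_l2 (cscale c (unit_l2 i)) n) sums
      (\<Sum>n\<in>{i}. Rep_l2 x n \<bullet> Rep_l2 (cscale c (unit_l2 i)) n)"
    by (rule sums_finite) (auto simp: cscale.rep_eq Rep_unit_l2)
  then show ?thesis by (simp add: inner_l2_def sums_iff cscale.rep_eq Rep_unit_l2)
qed

lemma self_adjoint_if_units:
  assumes T: "bounded_linear T"
    and u: "\<And>i j c d. T (cscale c (unit_l2 j)) \<bullet> cscale d (unit_l2 i)
              = cscale c (unit_l2 j) \<bullet> T (cscale d (unit_l2 i))"
  shows "self_adjoint T"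
proof -
  have T_sums: "(\<lambda>i. y \<bullet> T (cscale (Rep_l2 x i) (unit_l2 i))) sums (y \<bullet> T x)" for x y
    by (rule bounded_linear.sums[OF bounded_linear_compose[OF bounded_linear_inner_right T] unit_l2_expansion])
  have I_sums: "(\<lambda>i. y \<bullet> cscale (Rep_l2 x i) (unit_l2 i)) sums (y \<bullet> x)" for x y
    by (rule bounded_linear.sums[OF bounded_linear_inner_right unit_l2_expansion])
  have 1: "T (cscale c (unit_l2 j)) \<bullet> y = cscale c (unit_l2 j) \<bullet> T y" for c j y
    using I_sums[of "T (cscale c (unit_l2 j))" y] T_sums[of "cscale c (unit_l2 j)" y]
    by (simp only: u) (rule sums_unique2)
  have "T x \<bullet> y = x \<bullet> T y" for x y
  proof -
    have "(\<lambda>i. y \<bullet> T (cscale (Rep_l2 x i) (unit_l2 i))) sums (T y \<bullet> x)"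
      using I_sums[of "T y" x] 1[of _ _ y] by (simp add: inner_commute)
    from sums_unique2[OF T_sums[of y x] this] show ?thesis by (simp add: inner_commute)
  qed
  then show ?thesis using T by (simp add: self_adjoint_def)
qed

lift_definition conj_l2 :: "l2 \<Rightarrow> l2" is "\<lambda>x n. cnj (x n)" by (simp add: ell2_def)

lemma norm_conj_l2: "norm (conj_l2 x) = norm x"
  by (simp add: norm_l2_eq ell2_norm_def conj_l2.rep_eq)

lemma conj_l2_add: "conj_l2 (x + y) = conj_l2 x + conj_l2 y"
  and conj_l2_cscale: "conj_l2 (cscale c x) = cscale (cnj c) (conj_l2 x)"
  by (transfer; simp)+

lemma bounded_linear_conj_l2: "bounded_linear conj_l2"
proof (rule bounded_linear_intro)
  show "conj_l2 (r *\<^sub>R x) = r *\<^sub>R conj_l2 x" for r x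
    by (simp add: cscale_of_real[symmetric] conj_l2_cscale)
  show "norm (conj_l2 x) \<le> norm x * 1" for x by (simp add: norm_conj_l2)
qed (rule conj_l2_add)


section \<open>Trace norms of symmetric matrices\<close>

definition mat_op :: "cmatrix \<Rightarrow> l2 \<Rightarrow> l2" where
  "mat_op A x = Abs_l2 (mat_apply A (Rep_l2 x))"

lemma
  assumes "bounded_matrix A"
  shows Rep_mat_op: "Rep_l2 (mat_op A x) = mat_apply A (Rep_l2 x)"
    and summable_mat_op: "summable (\<lambda>j. A i j * Rep_l2 x j)"
    and bounded_linear_mat_op: "bounded_linear (mat_op A)"
    and mat_op_cscale: "mat_op A (cscale c x) = cscale c (mat_op A x)"
proof -
  from assms obtain K where K: "\<And>x. x \<in> ell2 \<Longrightarrow> (\<forall>i. summable (\<lambda>j. A i j * x j)) \<and>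
        mat_apply A x \<in> ell2 \<and> ell2_norm (mat_apply A x) \<le> K * ell2_norm x"
    by (auto simp: bounded_matrix_def)
  have R: "Rep_l2 (mat_op A x) = mat_apply A (Rep_l2 x)" for x
    using K[OF Rep_l2[of x]] by (simp add: mat_op_def Abs_l2_inverse)
  have s: "summable (\<lambda>j. A i j * Rep_l2 x j)" for x i using K[OF Rep_l2[of x]] by blast
  have c: "mat_op A (cscale c x) = cscale c (mat_op A x)" for c x
    by (simp add: Rep_l2_inject[symmetric] R cscale.rep_eq fun_eq_iff mat_apply_def
        mult.left_commute[of _ c] suminf_mult[OF s])
  show "Rep_l2 (mat_op A x) = mat_apply A (Rep_l2 x)" by (rule R)
  show "summable (\<lambda>j. A i j * Rep_l2 x j)" by (rule s)
  show "mat_op A (cscale c x) = cscale c (mat_op A x)" by (rule c)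
  show "bounded_linear (mat_op A)"
  proof (rule bounded_linear_intro)
    show "mat_op A (x + y) = mat_op A x + mat_op A y" for x y
      by (simp add: Rep_l2_inject[symmetric] R plus_l2.rep_eq fun_eq_iff mat_apply_def
          distrib_left suminf_add[OF s s])
    show "mat_op A (r *\<^sub>R x) = r *\<^sub>R mat_op A x" for r x
      by (simp add: cscale_of_real[symmetric] c)
    show "norm (mat_op A x) \<le> norm x * K" for x
      using K[OF Rep_l2[of x]] by (simp add: norm_l2_eq R mult.commute)
  qed
qed

lemma Rep_mat_op_unit:
  assumes "bounded_matrix A"
  shows "Rep_l2 (mat_op A (unit_l2 j)) i = A i j"
proof -
  have "(\<lambda>n. A i n * Rep_l2 (unit_l2 j) n) sums (\<Sum>n\<in>{j}. A i n * Rep_l2 (unit_l2 j) n)"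
    by (rule sums_finite) (auto simp: Rep_unit_l2)
  then show ?thesis by (simp add: Rep_mat_op[OF assms] mat_apply_def sums_iff Rep_unit_l2)
qed

lemma positive_matrix_op:
  assumes B: "positive_matrix B"
  shows "mat_op B x \<bullet> cscale \<i> x = 0" "0 \<le> mat_op B x \<bullet> x"
proof -
  have "mat_apply B (Rep_l2 x) = Rep_l2 (mat_op B x)"
    using B by (simp add: positive_matrix_def Rep_mat_op)
  then show "mat_op B x \<bullet> cscale \<i> x = 0" "0 \<le> mat_op B x \<bullet> x"
    using B Rep_l2[of x] unfolding positive_matrix_def
    by (metis Im_ell2_inner, metis Re_ell2_inner)
qed

text \<open>
  A complex quadratic form with real values is hermitian: polarise \<open>B x \<bullet> \<i> x = 0\<close>, which says
  that the form is real, at \<open>x + \<i> y\<close>.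
\<close>

lemma positive_op_mat_op:
  assumes B: "positive_matrix B"
  shows "positive_op (mat_op B)"
proof -
  have b: "bounded_matrix B" using B by (simp add: positive_matrix_def)
  interpret bounded_linear "mat_op B" by (rule bounded_linear_mat_op[OF b])
  let ?J = "cscale \<i>"
  have J: "?J (?J x) = - x" for x by (simp add: cscale_cscale cscale_minus1)
  note J0 = positive_matrix_op(1)[OF B] and p = positive_matrix_op(2)[OF B]
  have pol: "mat_op B x \<bullet> ?J y + mat_op B y \<bullet> ?J x = 0" for x y
    using J0[of "x + y"] J0[of x] J0[of y]
    by (simp add: add cscale_add_right inner_add_left inner_add_right)
  have iso: "?J x \<bullet> ?J y = x \<bullet> y" for x y
    by (simp add: inner_l2_def cscale.rep_eq inner_complex_def algebra_simps)
  have "mat_op B x \<bullet> y = x \<bullet> mat_op B y" for x y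
    using pol[of x "?J y"] by (simp add: J mat_op_cscale[OF b] iso inner_commute)
  then show ?thesis using p bounded_linear_axioms by (simp add: positive_op_def self_adjoint_def)
qed

lemma matrix_of_operator:
  fixes R :: "l2 \<Rightarrow> l2"
  assumes R: "positive_op R" and J: "\<And>x. R (cscale \<i> x) = cscale \<i> (R x)"
  defines "B \<equiv> \<lambda>i j. Rep_l2 (R (unit_l2 j)) i"
  shows "positive_matrix B" and "mat_op B = R"
proof -
  have sa: "R x \<bullet> y = x \<bullet> R y" for x y using R by (simp add: positive_op_def self_adjoint_def)
  interpret R: bounded_linear R using R by (simp add: positive_op_def self_adjoint_def)
  have cR: "R (cscale c x) = cscale c (R x)" for c x
  proof -
    have c: "cscale c y = Re c *\<^sub>R y + Im c *\<^sub>R cscale \<i> y" for y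
      by (simp add: cscale_of_real[symmetric] cscale_cscale cscale_add_left[symmetric]
          complex_eq[symmetric] mult.commute[of _ \<i>])
    show ?thesis unfolding c[of x] c[of "R x"] by (simp add: R.add R.scaleR J)
  qed
  have bl: "bounded_linear (\<lambda>x. Rep_l2 x i)" for i
    by (rule bounded_linear_intro[where K = 1])
      (simp_all add: plus_l2.rep_eq scaleR_l2.rep_eq norm_Rep_l2_le)
  have s: "(\<lambda>j. B i j * Rep_l2 x j) sums Rep_l2 (R x) i" for x i
  proof -
    have "bounded_linear (\<lambda>y. Rep_l2 (R y) i)"
      by (rule bounded_linear_compose[OF bl[of i] R.bounded_linear_axioms])
    from bounded_linear.sums[OF this unit_l2_expansion[of x]] show ?thesis
      by (simp add: cR cscale.rep_eq B_def mult.commute)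
  qed
  then have app: "mat_apply B (Rep_l2 x) = Rep_l2 (R x)" for x
    by (auto simp: mat_apply_def sums_iff)
  obtain K where K: "\<And>x. norm (R x) \<le> norm x * K" using R.bounded by blast
  have b: "bounded_matrix B"
    unfolding bounded_matrix_def
  proof (intro exI[of _ K] ballI)
    fix x assume "x \<in> ell2"
    then obtain y where "x = Rep_l2 y" by (metis Rep_l2_cases)
    then show "(\<forall>i. summable (\<lambda>j. B i j * x j)) \<and> mat_apply B x \<in> ell2
        \<and> ell2_norm (mat_apply B x) \<le> K * ell2_norm x"
      using s[of _ y] K[of y] Rep_l2[of "R y"]
      by (auto simp: app norm_l2_eq sums_iff mult.commute)
  qed
  show m: "mat_op B = R"
    by (rule ext) (simp add: mat_op_def app Rep_l2_inverse)
  have "R x \<bullet> cscale \<i> x = 0" for x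
  proof -
    have iso: "cscale \<i> x \<bullet> cscale \<i> y = x \<bullet> y" for x y
      by (simp add: inner_l2_def cscale.rep_eq inner_complex_def algebra_simps)
    have "R x \<bullet> cscale \<i> x = cscale \<i> (R x) \<bullet> (- x)"
      using iso[of "R x" "cscale \<i> x"] by (simp add: cscale_cscale cscale_minus1)
    also have "\<dots> = - (R x \<bullet> cscale \<i> x)"
      using sa[of "cscale \<i> x" x] by (simp add: J inner_commute)
    finally show ?thesis by simp
  qed
  then have "Im (ell2_inner (mat_apply B (Rep_l2 x)) (Rep_l2 x)) = 0 \<and>
      0 \<le> Re (ell2_inner (mat_apply B (Rep_l2 x)) (Rep_l2 x))" for x
    using R by (simp add: app Im_ell2_inner Re_ell2_inner positive_op_def)
  then show "positive_matrix B"
    using b unfolding positive_matrix_def by (metis Rep_l2_cases)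
qed

text \<open>
  For a symmetric matrix \<open>A\<close> the conjugate-linear operator \<open>T x = conj (A x)\<close> is self-adjoint on the
  underlying real Hilbert space, and \<open>T\<^sup>2 = A\<^sup>* A\<close>. This turns statements on \<open>|A|\<close> into statements on
  square roots of \<open>T\<^sup>2\<close>, with no polar decomposition.
\<close>

definition conj_op :: "cmatrix \<Rightarrow> l2 \<Rightarrow> l2" where
  "conj_op A x = conj_l2 (mat_op A x)"

lemma norm_conj_op: "norm (conj_op A x) = norm (mat_op A x)"
  by (simp add: conj_op_def norm_conj_l2)

lemma self_adjoint_conj_op:
  assumes A: "bounded_matrix A" and sym: "\<And>i j. A i j = A j i"
  shows "self_adjoint (conj_op A)"
proof (rule self_adjoint_if_units)
  show "bounded_linear (conj_op A)"
    using bounded_linear_compose[OF bounded_linear_conj_l2 bounded_linear_mat_op[OF A]]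
    by (simp add: conj_op_def[abs_def])
  show "conj_op A (cscale c (unit_l2 j)) \<bullet> cscale d (unit_l2 i)
      = cscale c (unit_l2 j) \<bullet> conj_op A (cscale d (unit_l2 i))" for c d i j
    using sym[of i j]
    by (simp add: inner_commute[of "cscale c (unit_l2 j)"] inner_cscale_unit conj_op_def
        mat_op_cscale[OF A] conj_l2_cscale cscale.rep_eq conj_l2.rep_eq Rep_mat_op_unit[OF A])
      (simp add: inner_complex_def algebra_simps)
qed

lemma conj_op_conj_op:
  assumes A: "bounded_matrix A" and sym: "\<And>i j. A i j = A j i"
  shows "Rep_l2 (conj_op A (conj_op A x)) = mat_apply (mat_adjoint A) (mat_apply A (Rep_l2 x))"
proof
  fix i
  have "Rep_l2 (conj_op A (conj_op A x)) i = cnj (\<Sum>j. A i j * Rep_l2 (conj_op A x) j)"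
    by (simp add: conj_op_def conj_l2.rep_eq Rep_mat_op[OF A] mat_apply_def)
  also have "\<dots> = (\<Sum>j. cnj (A i j * Rep_l2 (conj_op A x) j))"
    by (rule bounded_linear.suminf[OF bounded_linear_cnj summable_mat_op[OF A]])
  also have "\<dots> = mat_apply (mat_adjoint A) (mat_apply A (Rep_l2 x)) i"
    by (simp add: conj_op_def conj_l2.rep_eq Rep_mat_op[OF A] sym[of i] mat_apply_def mat_adjoint_def)
  finally show "Rep_l2 (conj_op A (conj_op A x)) i = mat_apply (mat_adjoint A) (mat_apply A (Rep_l2 x)) i" .
qed

lemma abs_matrix_norm:
  assumes A: "bounded_matrix A" and sym: "\<And>i j. A i j = A j i" and B: "is_abs_matrix A B"
  shows "norm (mat_op B x) = norm (mat_op A x)"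
proof -
  have p: "positive_matrix B" and b: "bounded_matrix B" using B by (auto simp: is_abs_matrix_def positive_matrix_def)
  have "mat_op B (mat_op B x) = conj_op A (conj_op A x)"
    using B Rep_l2[of x]
    by (simp add: Rep_l2_inject[symmetric] conj_op_conj_op[OF A sym] Rep_mat_op[OF b] is_abs_matrix_def)
  then have "mat_op B x \<bullet> mat_op B x = conj_op A x \<bullet> conj_op A x"
    using positive_op_mat_op[OF p] self_adjoint_conj_op[OF A sym]
    by (simp add: positive_op_def self_adjoint_def)
  then have "norm (mat_op B x) = norm (conj_op A x)" by (simp only: norm_eq_sqrt_inner)
  then show ?thesis by (simp add: norm_conj_op)
qed

text \<open>
  The square root of \<open>T\<^sup>2\<close> is complex-linear, hence a matrix, because \<open>T\<^sup>2\<close> commutes with the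
  multiplication by \<open>\<i>\<close> (while \<open>T\<close> anticommutes with it).
\<close>

lemma exists_abs_matrix:
  assumes A: "bounded_matrix A" and sym: "\<And>i j. A i j = A j i"
  shows "\<exists>B. is_abs_matrix A B"
proof -
  let ?T = "conj_op A"
  have T: "self_adjoint ?T" by (rule self_adjoint_conj_op[OF A sym])
  have TT: "?T (?T x) \<bullet> y = ?T x \<bullet> ?T y" for x y using T by (simp add: self_adjoint_def)
  have "positive_op (\<lambda>x. ?T (?T x))"
    unfolding positive_op_def self_adjoint_def
  proof (intro conjI allI)
    show "bounded_linear (\<lambda>x. ?T (?T x))"
      using T by (intro bounded_linear_compose[of ?T ?T]) (simp_all add: self_adjoint_def)
    show "?T (?T x) \<bullet> y = x \<bullet> ?T (?T y)" for x y
      using T TT[of x y] by (simp add: self_adjoint_def)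
  qed (simp add: TT)
  from positive_op_sqrt[OF this] obtain R where R: "positive_op R" "\<And>x. R (R x) = ?T (?T x)"
    "\<And>J x. bounded_linear J \<Longrightarrow> (\<And>x. J (?T (?T x)) = ?T (?T (J x))) \<Longrightarrow> J (R x) = R (J x)"
    by blast
  have "cscale \<i> (R x) = R (cscale \<i> x)" for x
    by (rule R(3)[OF bounded_linear_cscale])
      (simp add: conj_op_def mat_op_cscale[OF A] conj_l2_cscale)
  then have J: "R (cscale \<i> x) = cscale \<i> (R x)" for x by simp
  define B where "B i j = Rep_l2 (R (unit_l2 j)) i" for i j
  have B: "positive_matrix B" and BR: "mat_op B = R"
    using matrix_of_operator[OF R(1) J] by (simp_all add: B_def[abs_def])
  have b: "bounded_matrix B" using B by (simp add: positive_matrix_def)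
  have "mat_apply B (mat_apply B x) = mat_apply (mat_adjoint A) (mat_apply A x)" if x: "x \<in> ell2" for x
  proof -
    obtain y where y: "x = Rep_l2 y" using x by (metis Rep_l2_cases)
    have "mat_apply B (mat_apply B x) = Rep_l2 (R (R y))"
      by (simp add: y Rep_mat_op[OF b, symmetric] BR)
    then show ?thesis by (simp add: y R(2) conj_op_conj_op[OF A sym])
  qed
  then show ?thesis using B by (auto simp: is_abs_matrix_def)
qed

lemma diag_abs_matrix:
  assumes B: "positive_matrix B"
  shows "B n n = of_real (mat_op B (unit_l2 n) \<bullet> unit_l2 n)"
proof -
  have b: "bounded_matrix B" using B by (simp add: positive_matrix_def)
  have "mat_op B (unit_l2 n) \<bullet> cscale \<i> (unit_l2 n) = 0" by (rule positive_matrix_op(1)[OF B])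
  moreover have "mat_op B (unit_l2 n) \<bullet> unit_l2 n = B n n \<bullet> 1"
    using inner_cscale_unit[of "mat_op B (unit_l2 n)" 1 n] by (simp add: cscale_one Rep_mat_op_unit[OF b])
  ultimately show ?thesis
    by (simp add: inner_cscale_unit Rep_mat_op_unit[OF b] inner_complex_def complex_eq_iff)
qed

text \<open>
  The hypothesis on the norms says \<open>|A'|\<^sup>2 \<le> |A|\<^sup>2\<close>, so \<open>|A'| \<le> |A|\<close> by monotonicity of the square root,
  and the diagonal entries can be compared.
\<close>

lemma trace_class_mono:
  assumes A: "trace_class A" and symA: "\<And>i j. A i j = A j i"
    and A': "bounded_matrix A'" and symA': "\<And>i j. A' i j = A' j i"
    and le: "\<And>x. norm (mat_op A' x) \<le> norm (mat_op A x)"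
  shows "trace_class A'"
proof -
  from A obtain t B where bA: "bounded_matrix A" and B: "is_abs_matrix A B"
    and t: "(\<lambda>n. B n n) sums of_real t"
    by (auto simp: trace_class_def has_trace_norm_def)
  obtain B' where B': "is_abs_matrix A' B'" using exists_abs_matrix[OF A' symA'] by blast
  have p: "positive_matrix B" "positive_matrix B'" using B B' by (auto simp: is_abs_matrix_def)
  define f where "f M n = mat_op M (unit_l2 n) \<bullet> unit_l2 n" for M n
  have "(\<lambda>n. of_real (f B n) :: complex) sums of_real t"
    using t unfolding f_def diag_abs_matrix[OF p(1), symmetric] .
  then have "summable (f B)" by (simp add: sums_of_real_iff sums_iff)
  moreover have "f B' n \<le> f B n" for n
    unfolding f_def
    by (rule self_adjoint_le_of_norm_le)
      (use positive_op_mat_op[OF p(1)] positive_op_mat_op[OF p(2)] le in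
        \<open>simp_all add: positive_op_def abs_matrix_norm[OF bA symA B] abs_matrix_norm[OF A' symA' B']\<close>)
  moreover have "0 \<le> f B' n" for n
    using positive_op_mat_op[OF p(2)] by (simp add: positive_op_def f_def)
  ultimately have "summable (f B')"
    using summable_comparison_test'[of "f B" 0 "f B'"] by simp
  then have "(\<lambda>n. B' n n) sums of_real (suminf (f B'))"
    unfolding diag_abs_matrix[OF p(2)] f_def[symmetric] by (simp add: sums_of_real_iff summable_sums)
  then show ?thesis using A' B' by (auto simp: trace_class_def has_trace_norm_def)
qed

text \<open>
  For symmetric \<open>A\<close> the bound \<open>|u\<^sup>T A u| \<le> u\<^sup>* |A| u\<close> is the comparison \<open>T \<le> |A|\<close> of the operator
  \<open>T x = conj (A x)\<close> with its absolute value; a phase factor on \<open>u\<close> replaces the real part by the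
  modulus.
\<close>

theorem has_trace_norm_form:
  assumes tr: "has_trace_norm A t" and sym: "\<And>i j. A i j = A j i"
  obtains B :: cmatrix where "(\<lambda>n. Re (B n n)) sums t"
    "\<And>u L. cmod (\<Sum>i<L. \<Sum>j<L. A i j * u j * u i) \<le> Re (\<Sum>i<L. \<Sum>j<L. B i j * u j * cnj (u i))"
proof -
  from tr obtain B where A: "bounded_matrix A" and B: "is_abs_matrix A B"
    and t: "(\<lambda>n. B n n) sums of_real t"
    by (auto simp: has_trace_norm_def)
  have p: "positive_matrix B" and b: "bounded_matrix B" using B by (auto simp: is_abs_matrix_def positive_matrix_def)
  define v where "v L u = (\<Sum>j<L. cscale (u j) (unit_l2 j))" for L :: nat and u
  have inner_v: "x \<bullet> v L u = (\<Sum>i<L. Rep_l2 x i \<bullet> u i)" for x L u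
    by (simp add: v_def inner_sum_right inner_cscale_unit)
  have Rep_v: "Rep_l2 (mat_op M (v L u)) i = (\<Sum>j<L. M i j * u j)" if "bounded_matrix M" for M L u i
    by (simp add: v_def linear_sum[OF bounded_linear.linear[OF bounded_linear_mat_op[OF that]]]
        Rep_sum mat_op_cscale[OF that] cscale.rep_eq Rep_mat_op_unit[OF that] mult.commute)
  have re: "Re (\<Sum>i<L. \<Sum>j<L. A i j * u j * u i) \<le> Re (\<Sum>i<L. \<Sum>j<L. B i j * u j * cnj (u i))" for u L
  proof -
    have "conj_op A (v L u) \<bullet> v L u \<le> mat_op B (v L u) \<bullet> v L u"
      by (rule self_adjoint_le_of_norm_le[OF positive_op_mat_op[OF p] self_adjoint_conj_op[OF A sym]])
        (simp add: norm_conj_op abs_matrix_norm[OF A sym B])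
    moreover have ca: "cnj a \<bullet> c = Re (a * c)" and cb: "a \<bullet> c = Re (a * cnj c)" for a c
      by (simp_all add: inner_complex_def)
    have "conj_op A (v L u) \<bullet> v L u = Re (\<Sum>i<L. (\<Sum>j<L. A i j * u j) * u i)"
      by (simp only: inner_v conj_op_def conj_l2.rep_eq Rep_v[OF A] ca Re_sum)
    moreover have "mat_op B (v L u) \<bullet> v L u = Re (\<Sum>i<L. (\<Sum>j<L. B i j * u j) * cnj (u i))"
      by (simp only: inner_v Rep_v[OF b] cb Re_sum)
    ultimately show ?thesis by (simp only: sum_distrib_right)
  qed
  have "cmod (\<Sum>i<L. \<Sum>j<L. A i j * u j * u i) \<le> Re (\<Sum>i<L. \<Sum>j<L. B i j * u j * cnj (u i))" for u L
  proof -
    define z where "z = (\<Sum>i<L. \<Sum>j<L. A i j * u j * u i)"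
    obtain c where c: "c\<^sup>2 * z = of_real (cmod z)" "cmod c = 1"
    proof (cases "z = 0")
      case False
      define w where "w = of_real (cmod z) / z"
      have "cmod (csqrt w) = 1" using False by (simp add: w_def norm_divide norm_csqrt)
      then show thesis using False by (intro that[of "csqrt w"]) (simp_all add: w_def)
    qed (use that[of 1] in simp)
    have cc: "c * cnj c = 1" using c(2) by (metis complex_norm_square of_real_1 one_power2)
    have "cmod z = Re (c\<^sup>2 * z)" by (simp add: c(1))
    also have "c\<^sup>2 * z = (\<Sum>i<L. \<Sum>j<L. A i j * (c * u j) * (c * u i))"
      by (simp add: z_def sum_distrib_left power2_eq_square mult_ac)
    also have "Re \<dots> \<le> Re (\<Sum>i<L. \<Sum>j<L. B i j * (c * u j) * cnj (c * u i))" by (rule re)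
    also have "(\<Sum>i<L. \<Sum>j<L. B i j * (c * u j) * cnj (c * u i))
        = (\<Sum>i<L. \<Sum>j<L. (c * cnj c) * (B i j * u j * cnj (u i)))"
      by (simp add: mult_ac)
    finally show ?thesis by (simp add: cc z_def)
  qed
  moreover have "(\<lambda>n. Re (B n n)) sums t"
    using sums_Re[OF t] by simp
  ultimately show thesis using that by blast
qed

section \<open>Positive definite kernels\<close>

definition pd_kernel :: "'p set \<Rightarrow> ('p \<Rightarrow> 'p \<Rightarrow> complex) \<Rightarrow> bool" where
  "pd_kernel X K \<longleftrightarrow>
     (\<forall>p\<in>X. \<forall>q\<in>X. K q p = cnj (K p q)) \<and>
     (\<forall>F c. finite F \<longrightarrow> F \<subseteq> X \<longrightarrow> 0 \<le> Re (\<Sum>p\<in>F. \<Sum>q\<in>F. c p * cnj (c q) * K p q))"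

lemma pd_kernelD:
  assumes "pd_kernel X K"
  shows "\<And>p q. p \<in> X \<Longrightarrow> q \<in> X \<Longrightarrow> K q p = cnj (K p q)"
    and "\<And>F c. finite F \<Longrightarrow> F \<subseteq> X \<Longrightarrow> 0 \<le> Re (\<Sum>p\<in>F. \<Sum>q\<in>F. c p * cnj (c q) * K p q)"
  using assms unfolding pd_kernel_def by blast+

lemma pd_kernel_diag:
  assumes K: "pd_kernel X K" and p: "p \<in> X"
  shows "0 \<le> Re (K p p)" "K p p = of_real (Re (K p p))"
proof -
  show "0 \<le> Re (K p p)" using pd_kernelD(2)[OF K, of "{p}" "\<lambda>_. 1"] p by simp
  show "K p p = of_real (Re (K p p))" using pd_kernelD(1)[OF K p p] by (simp add: complex_eq_iff)
qed

lemma pd_kernel_cauchy_schwarz: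
  assumes K: "pd_kernel X K" and p: "p \<in> X" and q: "q \<in> X"
  shows "(cmod (K p q))\<^sup>2 \<le> Re (K p p) * Re (K q q)"
proof (cases "p = q")
  case True
  have "cmod (K q q) = Re (K q q)"
    using pd_kernel_diag[OF K q] by (metis abs_of_nonneg norm_of_real)
  then show ?thesis using True by (simp add: power2_eq_square)
next
  case False
  define z where "z = K p q"
  have qp: "K q p = cnj z" using pd_kernelD(1)[OF K p q] by (simp add: z_def)
  note diag = pd_kernel_diag[OF K]
  have ineq: "0 \<le> Re (K p p) + r\<^sup>2 * (cmod z)\<^sup>2 * Re (K q q) - 2 * r * (cmod z)\<^sup>2" for r :: real
  proof -
    define c where "c s = (if s = p then 1 else - of_real r * z)" for s
    have "0 \<le> Re (\<Sum>s\<in>{p, q}. \<Sum>t\<in>{p, q}. c s * cnj (c t) * K s t)"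
      by (rule pd_kernelD(2)[OF K]) (use p q in auto)
    also have "(\<Sum>s\<in>{p, q}. \<Sum>t\<in>{p, q}. c s * cnj (c t) * K s t)
        = K p p + of_real (r\<^sup>2) * (z * cnj z) * K q q - 2 * of_real r * (z * cnj z)"
      using False by (simp add: c_def qp z_def[symmetric] algebra_simps power2_eq_square)
    also have "z * cnj z = of_real ((cmod z)\<^sup>2)" by (rule complex_norm_square[symmetric])
    finally show ?thesis by simp
  qed
  show ?thesis
  proof (cases "Re (K q q) = 0")
    case True
    have "(cmod z)\<^sup>2 = 0"
    proof (rule ccontr)
      assume "(cmod z)\<^sup>2 \<noteq> 0"
      then show False using ineq[of "(Re (K p p) + 1) / (2 * (cmod z)\<^sup>2)"] True by (simp add: field_simps)
    qed
    then show ?thesis using True by (simp add: z_def)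
  next
    case False
    then have "Re (K q q) > 0" using diag(1)[OF q] by linarith
    then show ?thesis using ineq[of "1 / Re (K q q)"]
      by (simp add: field_simps power2_eq_square z_def)
  qed
qed

lemma pd_kernel_norm_le:
  assumes K: "pd_kernel X K" and p: "p \<in> X" and q: "q \<in> X"
    and M: "\<And>p. p \<in> X \<Longrightarrow> Re (K p p) \<le> M"
  shows "cmod (K p q) \<le> M"
proof -
  have M0: "0 \<le> M" using pd_kernel_diag(1)[OF K p] M[OF p] by linarith
  have "(cmod (K p q))\<^sup>2 \<le> Re (K p p) * Re (K q q)" by (rule pd_kernel_cauchy_schwarz[OF K p q])
  also have "\<dots> \<le> M * M" by (intro mult_mono M p q M0 pd_kernel_diag(1)[OF K])
  finally show ?thesis using M0 by (simp add: power2_eq_square abs_le_square_iff[symmetric] flip: power2_eq_square)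
qed

lemma pd_kernel_add:
  assumes K: "pd_kernel X K" and L: "pd_kernel X L"
  shows "pd_kernel X (\<lambda>p q. K p q + L p q)"
  unfolding pd_kernel_def
proof (intro conjI ballI allI impI)
  show "K q p + L q p = cnj (K p q + L p q)" if "p \<in> X" "q \<in> X" for p q
    using pd_kernelD(1)[OF K that] pd_kernelD(1)[OF L that] by simp
  show "0 \<le> Re (\<Sum>p\<in>F. \<Sum>q\<in>F. c p * cnj (c q) * (K p q + L p q))" if "finite F" "F \<subseteq> X" for F c
    using pd_kernelD(2)[OF K that, of c] pd_kernelD(2)[OF L that, of c]
    by (simp add: distrib_left sum.distrib del: Re_sum)
qed

lemma pd_kernel_rescale:
  assumes K: "pd_kernel X K" and r: "0 \<le> r"
  shows "pd_kernel X (\<lambda>p q. of_real r * (s p * cnj (s q) * K p q))"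
  unfolding pd_kernel_def
proof (intro conjI ballI allI impI)
  show "of_real r * (s q * cnj (s p) * K q p) = cnj (of_real r * (s p * cnj (s q) * K p q))"
    if "p \<in> X" "q \<in> X" for p q
    using pd_kernelD(1)[OF K that] by (simp add: mult_ac)
  fix F :: "'a set" and c :: "'a \<Rightarrow> complex" assume F: "finite F" "F \<subseteq> X"
  have "(\<Sum>p\<in>F. \<Sum>q\<in>F. c p * cnj (c q) * (of_real r * (s p * cnj (s q) * K p q)))
      = of_real r * (\<Sum>p\<in>F. \<Sum>q\<in>F. (c p * s p) * cnj (c q * s q) * K p q)"
    by (simp add: sum_distrib_left mult_ac)
  then show "0 \<le> Re (\<Sum>p\<in>F. \<Sum>q\<in>F. c p * cnj (c q) * (of_real r * (s p * cnj (s q) * K p q)))"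
    using pd_kernelD(2)[OF K F, of "\<lambda>p. c p * s p"] r by (simp del: Re_sum)
qed

lemma pd_kernel_limit:
  assumes K: "\<And>n :: nat. pd_kernel X (K n)"
    and lim: "\<And>p q. p \<in> X \<Longrightarrow> q \<in> X \<Longrightarrow> (\<lambda>n. K n p q) \<longlonglongrightarrow> L p q"
  shows "pd_kernel X L"
  unfolding pd_kernel_def
proof (intro conjI ballI allI impI)
  fix p q assume p: "p \<in> X" and q: "q \<in> X"
  have "(\<lambda>n. K n q p) \<longlonglongrightarrow> cnj (L p q)"
    using tendsto_cnj[OF lim[OF p q]] by (simp add: pd_kernelD(1)[OF K p q])
  then show "L q p = cnj (L p q)" using lim[OF q p] LIMSEQ_unique by blast
next
  fix F :: "'a set" and c :: "'a \<Rightarrow> complex" assume F: "finite F" "F \<subseteq> X"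
  have "(\<lambda>n. Re (\<Sum>p\<in>F. \<Sum>q\<in>F. c p * cnj (c q) * K n p q))
      \<longlonglongrightarrow> Re (\<Sum>p\<in>F. \<Sum>q\<in>F. c p * cnj (c q) * L p q)"
    using F by (intro tendsto_intros lim) auto
  then show "0 \<le> Re (\<Sum>p\<in>F. \<Sum>q\<in>F. c p * cnj (c q) * L p q)"
    by (rule LIMSEQ_le_const) (use pd_kernelD(2)[OF K F] in auto)
qed

definition schur_complement :: "'p \<Rightarrow> ('p \<Rightarrow> 'p \<Rightarrow> complex) \<Rightarrow> 'p \<Rightarrow> 'p \<Rightarrow> complex" where
  "schur_complement j K p q = K p q - K p j * K j q / K j j"

text \<open>
  Changing the coefficient at \<open>j\<close> to the minimiser of the quadratic form turns the form of \<open>K\<close> into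
  that of the Schur complement.
\<close>

lemma pd_schur_complement:
  assumes K: "pd_kernel X K" and j: "j \<in> X"
  shows "pd_kernel X (schur_complement j K)"
proof (cases "K j j = 0")
  case True
  then show ?thesis using K by (simp add: schur_complement_def[abs_def])
next
  case False
  define k where "k = Re (K j j)"
  have kj: "K j j = of_real k" using pd_kernel_diag(2)[OF K j] by (simp add: k_def)
  have k0: "k \<noteq> 0" using False kj by auto
  show ?thesis
    unfolding pd_kernel_def
  proof (intro conjI ballI allI impI)
    show "schur_complement j K q p = cnj (schur_complement j K p q)" if "p \<in> X" "q \<in> X" for p q
      using pd_kernelD(1)[OF K that] pd_kernelD(1)[OF K that(1) j] pd_kernelD(1)[OF K j that(2)] j
      by (simp add: schur_complement_def kj)
    fix F :: "'a set" and c :: "'a \<Rightarrow> complex" assume F: "finite F" "F \<subseteq> X"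
    define F' where "F' = insert j F"
    have F': "finite F'" "F' \<subseteq> X" "j \<in> F'" using F j by (auto simp: F'_def)
    define c0 where "c0 p = (if p \<in> F then c p else 0)" for p
    define s where "s = (\<Sum>q\<in>F'. cnj (c0 q) * K j q)"
    have cs: "(\<Sum>p\<in>F'. c0 p * K p j) = cnj s"
      unfolding s_def cnj_sum
    proof (rule sum.cong)
      fix p assume "p \<in> F'"
      then have "p \<in> X" using F' by auto
      then show "c0 p * K p j = cnj (cnj (c0 p) * K j p)" using pd_kernelD(1)[OF K j, of p] by simp
    qed simp
    define t where "t = - cnj s / of_real k"
    define d where "d p = c0 p + (if p = j then t else 0)" for p
    have "(\<Sum>p\<in>F'. \<Sum>q\<in>F'. d p * cnj (d q) * K p q)
        = (\<Sum>p\<in>F'. \<Sum>q\<in>F'. c0 p * cnj (c0 q) * K p q)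
          + (cnj t * (\<Sum>p\<in>F'. c0 p * K p j) + t * s + t * cnj t * K j j)"
    proof -
      have i: "(\<Sum>q\<in>F'. d p * cnj (d q) * K p q) = d p * ((\<Sum>q\<in>F'. cnj (c0 q) * K p q) + cnj t * K p j)" for p
      proof -
        have "(\<Sum>q\<in>F'. cnj (d q) * K p q)
            = (\<Sum>q\<in>F'. cnj (c0 q) * K p q + (if q = j then cnj t * K p q else 0))"
          by (rule sum.cong) (auto simp: d_def algebra_simps)
        also have "\<dots> = (\<Sum>q\<in>F'. cnj (c0 q) * K p q) + cnj t * K p j"
          using F' by (simp add: sum.distrib)
        finally show ?thesis by (simp only: mult.assoc sum_distrib_left[symmetric])
      qed
      have "(\<Sum>p\<in>F'. d p * ((\<Sum>q\<in>F'. cnj (c0 q) * K p q) + cnj t * K p j))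
          = (\<Sum>p\<in>F'. c0 p * ((\<Sum>q\<in>F'. cnj (c0 q) * K p q) + cnj t * K p j)
              + (if p = j then t * ((\<Sum>q\<in>F'. cnj (c0 q) * K p q) + cnj t * K p j) else 0))"
        by (rule sum.cong) (auto simp: d_def algebra_simps)
      also have "\<dots> = (\<Sum>p\<in>F'. c0 p * ((\<Sum>q\<in>F'. cnj (c0 q) * K p q) + cnj t * K p j))
          + t * (s + cnj t * K j j)"
        using F' by (simp add: sum.distrib s_def)
      finally show ?thesis unfolding i
        by (simp add: distrib_left sum.distrib sum_distrib_left mult_ac)
    qed
    also have "cnj t * (\<Sum>p\<in>F'. c0 p * K p j) + t * s + t * cnj t * K j j = - (cnj s * s / of_real k)"
      using k0 by (simp add: cs t_def kj field_simps)
    finally have e1: "(\<Sum>p\<in>F'. \<Sum>q\<in>F'. d p * cnj (d q) * K p q)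
        = (\<Sum>p\<in>F'. \<Sum>q\<in>F'. c0 p * cnj (c0 q) * K p q) - cnj s * s / of_real k"
      by simp
    have "(\<Sum>p\<in>F. \<Sum>q\<in>F. c p * cnj (c q) * schur_complement j K p q)
        = (\<Sum>p\<in>F'. \<Sum>q\<in>F'. c0 p * cnj (c0 q) * schur_complement j K p q)"
    proof -
      have "(\<Sum>q\<in>F. c p * cnj (c q) * f q) = (\<Sum>q\<in>F'. c p * cnj (c0 q) * f q)" for p f
        by (rule sum.mono_neutral_cong_left) (use F F' in \<open>auto simp: F'_def c0_def\<close>)
      then have "(\<Sum>p\<in>F. \<Sum>q\<in>F. c p * cnj (c q) * schur_complement j K p q)
        = (\<Sum>p\<in>F. \<Sum>q\<in>F'. c p * cnj (c0 q) * schur_complement j K p q)" by simp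
      also have "\<dots> = (\<Sum>p\<in>F'. \<Sum>q\<in>F'. c0 p * cnj (c0 q) * schur_complement j K p q)"
        by (rule sum.mono_neutral_cong_left) (use F F' in \<open>auto simp: F'_def c0_def\<close>)
      finally show ?thesis .
    qed
    also have "\<dots> = (\<Sum>p\<in>F'. \<Sum>q\<in>F'. c0 p * cnj (c0 q) * K p q)
        - (\<Sum>p\<in>F'. c0 p * K p j) * (\<Sum>q\<in>F'. cnj (c0 q) * K j q) / of_real k"
      by (simp add: schur_complement_def kj right_diff_distrib sum_subtractf sum_product
          sum_divide_distrib mult_ac)
    also have "\<dots> = (\<Sum>p\<in>F'. \<Sum>q\<in>F'. d p * cnj (d q) * K p q)"
      by (simp add: e1 cs s_def)
    finally show "0 \<le> Re (\<Sum>p\<in>F. \<Sum>q\<in>F. c p * cnj (c q) * schur_complement j K p q)"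
      using pd_kernelD(2)[OF K F'(1,2), of d] by simp
  qed
qed

primrec schur_seq :: "(nat \<Rightarrow> 'p) \<Rightarrow> ('p \<Rightarrow> 'p \<Rightarrow> complex) \<Rightarrow> nat \<Rightarrow> 'p \<Rightarrow> 'p \<Rightarrow> complex" where
  "schur_seq e K 0 = K"
| "schur_seq e K (Suc j) = schur_complement (e j) (schur_seq e K j)"

text \<open>
  A Cholesky decomposition: eliminating the points of a countable set one after the other writes
  the kernel as a sum of rank one kernels, and only finitely many of them see a given point.
\<close>

lemma pd_kernel_l2_vectors:
  assumes K: "pd_kernel X K" and X: "countable X"
  obtains v :: "'p \<Rightarrow> l2"
  where "\<And>p q. p \<in> X \<Longrightarrow> q \<in> X \<Longrightarrow> ell2_inner (Rep_l2 (v p)) (Rep_l2 (v q)) = K p q"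
proof (cases "X = {}")
  case True then show thesis using that by blast
next
  case False
  define e where "e = from_nat_into X"
  have e: "e j \<in> X" for j using False by (simp add: e_def from_nat_into)
  define S where "S = schur_seq e K"
  have S0: "S 0 = K" and SS: "S (Suc j) = schur_complement (e j) (S j)" for j by (simp_all add: S_def)
  have S: "pd_kernel X (S j)" for j
    by (induction j) (simp_all add: S0 SS K pd_schur_complement e)
  have real: "S j (e j) (e j) = of_real (Re (S j (e j) (e j)))" for j
    by (rule pd_kernel_diag(2)[OF S e])
  have herm: "S j q p = cnj (S j p q)" if "p \<in> X" "q \<in> X" for j p q
    by (rule pd_kernelD(1)[OF S that])
  have zero: "S j p q = 0" if "p \<in> X" "q \<in> X" "S j q q = 0" for j p q
    using pd_kernel_cauchy_schwarz[OF S that(1,2), of j] that(3) by simp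
  have elim: "S (Suc j) p (e j) = 0" if "p \<in> X" for p j
    using zero[OF that e, of j j] by (cases "S j (e j) (e j) = 0") (auto simp: SS schur_complement_def)
  have elim': "S (Suc j + m) p (e j) = 0" if p: "p \<in> X" for p j m
    using p
  proof (induction m arbitrary: p)
    case 0 then show ?case using elim by simp
  next
    case (Suc m)
    have "S (Suc (Suc j + m)) p (e j) = schur_complement (e (Suc j + m)) (S (Suc j + m)) p (e j)"
      by (simp only: SS)
    also have "\<dots> = 0" unfolding schur_complement_def Suc.IH[OF Suc.prems] Suc.IH[OF e] by simp
    finally show ?case by simp
  qed
  define idx where "idx = to_nat_on X"
  have idx: "e (idx p) = p" if "p \<in> X" for p
    using that X by (simp add: e_def idx_def)
  have vanish: "S j p q = 0" if "p \<in> X" "q \<in> X" "idx q < j" for j p q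
  proof -
    obtain m where "j = Suc (idx q) + m" using \<open>idx q < j\<close> by (metis less_iff_Suc_add add_Suc)
    then show ?thesis using elim'[OF that(1), of "idx q" m] idx[OF that(2)] by simp
  qed
  define r where "r j = sqrt (Re (S j (e j) (e j)))" for j
  have r: "of_real (r j) * of_real (r j) = S j (e j) (e j)" for j
    using pd_kernel_diag(1)[OF S e, of j j] by (subst real) (simp add: r_def flip: of_real_mult)
  define w where "w p j = S j p (e j) / of_real (r j)" for p j
  have tele: "K p q = (\<Sum>j<N. w p j * cnj (w q j)) + S N p q" if p: "p \<in> X" and q: "q \<in> X" for p q N
  proof (induction N)
    case (Suc N)
    have "w p N * cnj (w q N) = S N p (e N) * S N (e N) q / S N (e N) (e N)"
      by (simp add: w_def r[symmetric] herm[OF q e])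
    then show ?case using Suc by (simp add: SS schur_complement_def)
  qed (simp add: S0)
  have w0: "w p j = 0" if "p \<in> X" "idx p < j" for p j
    using vanish[OF e that, of j] herm[OF e that(1), of j j] by (simp add: w_def)
  define v where "v p = Abs_l2 (w p)" for p
  have v: "Rep_l2 (v p) = w p" if p: "p \<in> X" for p
  proof -
    have "summable (\<lambda>n. (cmod (w p n))\<^sup>2)"
      by (rule summable_finite[of "{..idx p}"]) (use w0[OF p] in auto)
    then show ?thesis by (simp add: v_def Abs_l2_inverse ell2_def)
  qed
  show thesis
  proof (rule that)
    fix p q assume p: "p \<in> X" and q: "q \<in> X"
    have "ell2_inner (w p) (w q) = (\<Sum>j<Suc (idx q). w p j * cnj (w q j))"
      unfolding ell2_inner_def by (rule suminf_finite) (use w0[OF q] in auto)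
    also have "\<dots> = K p q"
      using tele[OF p q, of "Suc (idx q)"] vanish[OF p q, of "Suc (idx q)"] by simp
    finally show "ell2_inner (Rep_l2 (v p)) (Rep_l2 (v q)) = K p q" by (simp only: v[OF p] v[OF q])
  qed
qed


section \<open>Herz--Schur multipliers and kernels\<close>

text \<open>
  The closed ball of radius \<open>M\<close> of the multiplier space, in terms of the Gram matrix of the vectors
  \<open>\<alpha> x\<close>, \<open>\<beta> y\<close>. In this form sums and pointwise limits need no constructions on Hilbert spaces.
\<close>

definition schur_ball :: "('a, 'b) monoid_scheme \<Rightarrow> real \<Rightarrow> ('a \<Rightarrow> complex) \<Rightarrow> bool" where
  "schur_ball G M \<phi> \<longleftrightarrow> (\<exists>K. pd_kernel (carrier G <+> carrier G) K \<and>
     (\<forall>p\<in>carrier G <+> carrier G. Re (K p p) \<le> M) \<and>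
     (\<forall>x\<in>carrier G. \<forall>y\<in>carrier G. K (Inl x) (Inr y) = \<phi> (inv\<^bsub>G\<^esub> y \<otimes>\<^bsub>G\<^esub> x)))"

lemma schur_ball_zero: "schur_ball G 0 (\<lambda>_. 0)"
  unfolding schur_ball_def by (rule exI[of _ "\<lambda>_ _. 0"]) (simp add: pd_kernel_def)

lemma schur_ball_add:
  assumes "schur_ball G M \<phi>" "schur_ball G N \<psi>"
  shows "schur_ball G (M + N) (\<lambda>g. \<phi> g + \<psi> g)"
proof -
  from assms obtain K L where
    "pd_kernel (carrier G <+> carrier G) K" "\<forall>p\<in>carrier G <+> carrier G. Re (K p p) \<le> M"
    "\<forall>x\<in>carrier G. \<forall>y\<in>carrier G. K (Inl x) (Inr y) = \<phi> (inv\<^bsub>G\<^esub> y \<otimes>\<^bsub>G\<^esub> x)"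
    "pd_kernel (carrier G <+> carrier G) L" "\<forall>p\<in>carrier G <+> carrier G. Re (L p p) \<le> N"
    "\<forall>x\<in>carrier G. \<forall>y\<in>carrier G. L (Inl x) (Inr y) = \<psi> (inv\<^bsub>G\<^esub> y \<otimes>\<^bsub>G\<^esub> x)"
    unfolding schur_ball_def by blast
  then show ?thesis
    unfolding schur_ball_def
    by (intro exI[of _ "\<lambda>p q. K p q + L p q"]) (simp add: pd_kernel_add add_mono)
qed

lemma schur_ball_cmult:
  assumes "schur_ball G M \<phi>"
  shows "schur_ball G (cmod c * M) (\<lambda>g. c * \<phi> g)"
proof -
  from assms obtain K where K: "pd_kernel (carrier G <+> carrier G) K"
    "\<And>p. p \<in> carrier G <+> carrier G \<Longrightarrow> Re (K p p) \<le> M"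
    "\<And>x y. x \<in> carrier G \<Longrightarrow> y \<in> carrier G \<Longrightarrow> K (Inl x) (Inr y) = \<phi> (inv\<^bsub>G\<^esub> y \<otimes>\<^bsub>G\<^esub> x)"
    unfolding schur_ball_def by blast
  define w where "w = (if c = 0 then 1 else sgn c)"
  have w: "of_real (cmod c) * w = c" "cmod w = 1"
    by (auto simp: w_def sgn_eq) (simp add: norm_divide)
  have ww: "w * cnj w = 1" using w(2) by (metis complex_norm_square of_real_1 one_power2)
  define s where "s p = (case p of Inl _ \<Rightarrow> w | Inr _ \<Rightarrow> 1)" for p :: "'a + 'a"
  have ss: "s p * cnj (s p) = 1" for p by (simp add: s_def ww split: sum.split)
  show ?thesis
    unfolding schur_ball_def
  proof (intro exI[of _ "\<lambda>p q. of_real (cmod c) * (s p * cnj (s q) * K p q)"] conjI ballI)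
    show "pd_kernel (carrier G <+> carrier G) (\<lambda>p q. of_real (cmod c) * (s p * cnj (s q) * K p q))"
      by (rule pd_kernel_rescale[OF K(1)]) simp
    show "Re (of_real (cmod c) * (s p * cnj (s p) * K p p)) \<le> cmod c * M"
      if "p \<in> carrier G <+> carrier G" for p
      using K(2)[OF that] by (simp only: ss) (simp add: mult_left_mono)
    show "of_real (cmod c) * (s (Inl x) * cnj (s (Inr y)) * K (Inl x) (Inr y))
        = c * \<phi> (inv\<^bsub>G\<^esub> y \<otimes>\<^bsub>G\<^esub> x)" if "x \<in> carrier G" "y \<in> carrier G" for x y
      using w(1) by (simp add: s_def K(3)[OF that] mult.assoc[symmetric])
  qed
qed

lemma schur_ball_sum:
  assumes "finite I" "\<And>i. i \<in> I \<Longrightarrow> schur_ball G (M i) (\<phi> i)"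
  shows "schur_ball G (\<Sum>i\<in>I. M i) (\<lambda>g. \<Sum>i\<in>I. \<phi> i g)"
  using assms by (induction I) (simp_all add: schur_ball_zero schur_ball_add)

lemma schur_ball_one: "schur_ball G 1 (\<lambda>_. 1)"
proof -
  have "(\<Sum>p\<in>F. \<Sum>q\<in>F. c p * cnj (c q)) = of_real ((cmod (\<Sum>p\<in>F. c p))\<^sup>2)" for F :: "('a + 'a) set" and c
    by (simp only: complex_norm_square cnj_sum sum_product)
  then have "pd_kernel X (\<lambda>_ _. 1)" for X :: "('a + 'a) set"
    unfolding pd_kernel_def by (simp del: Re_sum)
  then show ?thesis unfolding schur_ball_def by (intro exI[of _ "\<lambda>_ _. 1"]) simp
qed

lemma schur_ball_norm_le:
  assumes "schur_ball G M \<phi>" "x \<in> carrier G" "y \<in> carrier G"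
  shows "cmod (\<phi> (inv\<^bsub>G\<^esub> y \<otimes>\<^bsub>G\<^esub> x)) \<le> M"
proof -
  from assms(1) obtain K where K: "pd_kernel (carrier G <+> carrier G) K"
    "\<And>p. p \<in> carrier G <+> carrier G \<Longrightarrow> Re (K p p) \<le> M"
    "\<And>x y. x \<in> carrier G \<Longrightarrow> y \<in> carrier G \<Longrightarrow> K (Inl x) (Inr y) = \<phi> (inv\<^bsub>G\<^esub> y \<otimes>\<^bsub>G\<^esub> x)"
    unfolding schur_ball_def by blast
  show ?thesis
    using pd_kernel_norm_le[OF K(1) _ _ K(2), of "Inl x" "Inr y"] assms(2,3) by (simp add: K(3) InlI InrI)
qed

text \<open>
  Kernels with bounded diagonal are bounded, so over a countable group a diagonal subsequence of the
  kernels converges pointwise.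
\<close>

lemma schur_ball_limit:
  assumes count: "countable (carrier G)"
    and ball: "\<And>n :: nat. schur_ball G (M n) (\<phi> n)"
    and lim: "\<And>g. g \<in> carrier G \<Longrightarrow> (\<lambda>n. \<phi> n g) \<longlonglongrightarrow> \<psi> g" and M: "M \<longlonglongrightarrow> m"
    and G: "group G"
  shows "schur_ball G m \<psi>"
proof -
  interpret group G by (rule G)
  let ?X = "carrier G <+> carrier G"
  have "\<forall>n. \<exists>K. pd_kernel ?X K \<and> (\<forall>p\<in>?X. Re (K p p) \<le> M n) \<and>
     (\<forall>x\<in>carrier G. \<forall>y\<in>carrier G. K (Inl x) (Inr y) = \<phi> n (inv\<^bsub>G\<^esub> y \<otimes>\<^bsub>G\<^esub> x))"
    using ball unfolding schur_ball_def by blast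
  then obtain K where K: "\<And>n. pd_kernel ?X (K n)" "\<And>n p. p \<in> ?X \<Longrightarrow> Re (K n p p) \<le> M n"
    "\<And>n x y. x \<in> carrier G \<Longrightarrow> y \<in> carrier G \<Longrightarrow> K n (Inl x) (Inr y) = \<phi> n (inv\<^bsub>G\<^esub> y \<otimes>\<^bsub>G\<^esub> x)"
    by metis
  obtain b where b: "\<And>n. M n \<le> b"
    using convergent_imp_Bseq[of M] M by (auto simp: convergent_def Bseq_def real_norm_def abs_le_iff)
  have cX: "countable (?X \<times> ?X)" by (intro countable_SIGMA countable_Plus count)
  have bound: "norm (case z of (p, q) \<Rightarrow> K n p q) \<le> b" if "z \<in> ?X \<times> ?X" for n z
    using that pd_kernel_norm_le[OF K(1)[of n], where M = b] order_trans[OF K(2) b]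
    by (auto split: prod.split)
  obtain k where k: "strict_mono k"
    "\<And>z. z \<in> ?X \<times> ?X \<Longrightarrow> \<exists>l. (\<lambda>n. case z of (p, q) \<Rightarrow> K (k n) p q) \<longlonglongrightarrow> l"
    using function_convergent_subsequence[OF cX, of "\<lambda>n z. case z of (p, q) \<Rightarrow> K n p q" b] bound
    by blast
  define L where "L p q = lim (\<lambda>n. K (k n) p q)" for p q
  have L: "(\<lambda>n. K (k n) p q) \<longlonglongrightarrow> L p q" if "p \<in> ?X" "q \<in> ?X" for p q
    using k(2)[of "(p, q)"] that unfolding L_def by (auto simp: convergent_LIMSEQ_iff[symmetric] convergent_def)
  show ?thesis
    unfolding schur_ball_def
  proof (intro exI[of _ L] conjI ballI)
    show "pd_kernel ?X L" by (rule pd_kernel_limit[OF K(1) L])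
    show "Re (L p p) \<le> m" if "p \<in> ?X" for p
    proof (rule LIMSEQ_le[OF tendsto_Re[OF L[OF that that]] LIMSEQ_subseq_LIMSEQ[OF M k(1)]])
      show "\<exists>N. \<forall>n\<ge>N. Re (K (k n) p p) \<le> (M \<circ> k) n" using K(2)[OF that] by auto
    qed
    show "L (Inl x) (Inr y) = \<psi> (inv\<^bsub>G\<^esub> y \<otimes>\<^bsub>G\<^esub> x)" if "x \<in> carrier G" "y \<in> carrier G" for x y
    proof (rule LIMSEQ_unique[OF L])
      show "(\<lambda>n. K (k n) (Inl x) (Inr y)) \<longlonglongrightarrow> \<psi> (inv\<^bsub>G\<^esub> y \<otimes>\<^bsub>G\<^esub> x)"
        using LIMSEQ_subseq_LIMSEQ[OF lim k(1), of "inv\<^bsub>G\<^esub> y \<otimes>\<^bsub>G\<^esub> x"] that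
        by (simp add: K(3) o_def)
    qed (use that in auto)
  qed
qed

definition l2_hilbert :: "l2 hilbert" where
  "l2_hilbert = \<lparr>hcarrier = UNIV, hzero = 0, hadd = (+), hscale = cscale,
     hinner = (\<lambda>x y. ell2_inner (Rep_l2 x) (Rep_l2 y))\<rparr>"

lemma ell2_inner_eq: "ell2_inner (Rep_l2 x) (Rep_l2 y) = Complex (x \<bullet> y) (x \<bullet> cscale \<i> y)"
  by (simp add: complex_eq_iff Re_ell2_inner Im_ell2_inner)

lemma hnorm_l2_hilbert: "hnorm l2_hilbert x = norm x"
  by (simp add: hnorm_def l2_hilbert_def Re_ell2_inner norm_eq_sqrt_inner)

lemma hdist_l2_hilbert: "hdist l2_hilbert x y = dist x y"
  by (simp add: hdist_def hnorm_l2_hilbert dist_norm) (simp add: l2_hilbert_def cscale_minus1)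

lemma complex_hilbert_l2: "complex_hilbert l2_hilbert"
proof (unfold_locales, goal_cases)
  case (12 u v w)
  then show ?case by (simp add: l2_hilbert_def ell2_inner_eq inner_add_left complex_eq_iff)
next
  case (13 u v a)
  then show ?case
    by (simp add: l2_hilbert_def ell2_inner_def cscale.rep_eq mult.assoc suminf_mult[OF summable_ell2_inner])
next
  case (14 u v)
  have "Complex (u \<bullet> v) (u \<bullet> cscale \<i> v) = cnj (Complex (v \<bullet> u) (v \<bullet> cscale \<i> u))"
  proof -
    have "u \<bullet> cscale \<i> v = - (v \<bullet> cscale \<i> u)"
    proof -
      have s: "summable (\<lambda>n. Rep_l2 v n \<bullet> (\<i> * Rep_l2 u n))"
        using summable_inner_l2[of v "cscale \<i> u"] by (simp add: cscale.rep_eq)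
      have "Rep_l2 u n \<bullet> (\<i> * Rep_l2 v n) = - (Rep_l2 v n \<bullet> (\<i> * Rep_l2 u n))" for n
        by (simp add: inner_complex_def)
      then show ?thesis by (simp add: inner_l2_def cscale.rep_eq suminf_minus[OF s])
    qed
    then show ?thesis by (simp add: complex_eq_iff inner_commute)
  qed
  then show ?case by (simp add: l2_hilbert_def ell2_inner_eq)
next
  case (17 X)
  have "Cauchy X" using 17(2) by (simp add: hdist_l2_hilbert Cauchy_def)
  then obtain v where "X \<longlonglongrightarrow> v" by (auto simp: Cauchy_convergent_iff convergent_def)
  then show ?case
    unfolding hdist_l2_hilbert tendsto_dist_iff[of X] by (auto simp: l2_hilbert_def)
qed (simp_all add: l2_hilbert_def add_ac cscale_add_right cscale_add_left cscale_cscale cscale_one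
    cscale_minus1 ell2_inner_eq complex_eq_iff)

lemma M0A_if_schur_ball:
  fixes G :: "('a, 'b) monoid_scheme"
  assumes G: "group G" and count: "countable (carrier G)" and ball: "schur_ball G M \<phi>"
  shows "\<phi> \<in> M0A G" and "M0A_norm G \<phi> \<le> M"
proof -
  interpret group G by (rule G)
  let ?X = "carrier G <+> carrier G"
  from ball obtain K where K: "pd_kernel ?X K" "\<And>p. p \<in> ?X \<Longrightarrow> Re (K p p) \<le> M"
    "\<And>x y. x \<in> carrier G \<Longrightarrow> y \<in> carrier G \<Longrightarrow> K (Inl x) (Inr y) = \<phi> (inv\<^bsub>G\<^esub> y \<otimes>\<^bsub>G\<^esub> x)"
    unfolding schur_ball_def by blast
  have "countable ?X" by (intro countable_Plus count)
  from pd_kernel_l2_vectors[OF K(1) this] obtain v :: "'a + 'a \<Rightarrow> l2"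
    where v: "\<And>p q. p \<in> ?X \<Longrightarrow> q \<in> ?X \<Longrightarrow> ell2_inner (Rep_l2 (v p)) (Rep_l2 (v q)) = K p q"
    by blast
  have n: "hnorm l2_hilbert (v p) \<le> sqrt M" if "p \<in> ?X" for p
    using K(2)[OF that] by (simp add: hnorm_def l2_hilbert_def v that)
  have X: "x \<in> carrier G \<Longrightarrow> Inl x \<in> ?X" "x \<in> carrier G \<Longrightarrow> Inr x \<in> ?X" for x by auto
  have "herz_schur_rep G l2_hilbert (\<lambda>x. v (Inl x)) (\<lambda>x. v (Inr x)) \<phi>"
    unfolding herz_schur_rep_def
  proof (intro conjI ballI complex_hilbert_l2)
    show "bdd_above ((\<lambda>x. hnorm l2_hilbert (v (Inl x))) ` carrier G)"
      "bdd_above ((\<lambda>y. hnorm l2_hilbert (v (Inr y))) ` carrier G)"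
      using n X by (auto intro!: bdd_aboveI[of _ "sqrt M"])
  qed (auto simp: l2_hilbert_def v K(3) X)
  then obtain H' :: "('a + 'a \<Rightarrow> complex) hilbert" and \<alpha>' \<beta>' where
    rep: "herz_schur_rep G H' \<alpha>' \<beta>' \<phi>"
    and na: "\<And>x. x \<in> carrier G \<Longrightarrow> hnorm H' (\<alpha>' x) = hnorm l2_hilbert (v (Inl x))"
    and nb: "\<And>x. x \<in> carrier G \<Longrightarrow> hnorm H' (\<beta>' x) = hnorm l2_hilbert (v (Inr x))"
    by (rule herz_schur_rep_any_type) blast
  then show "\<phi> \<in> M0A G" unfolding M0A_def by blast
  let ?N = "{(SUP x\<in>carrier G. hnorm H (\<alpha> x)) * (SUP y\<in>carrier G. hnorm H (\<beta> y)) |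
          (H :: ('a + 'a \<Rightarrow> complex) hilbert) \<alpha> \<beta>. herz_schur_rep G H \<alpha> \<beta> \<phi>}"
  have nonneg: "0 \<le> (SUP x\<in>carrier G. hnorm H (\<gamma> x))"
    if "complex_hilbert H" "\<gamma> \<in> carrier G \<rightarrow> hcarrier H" "bdd_above ((\<lambda>x. hnorm H (\<gamma> x)) ` carrier G)"
    for H :: "('a + 'a \<Rightarrow> complex) hilbert" and \<gamma>
  proof -
    have "0 \<le> hnorm H (\<gamma> \<one>\<^bsub>G\<^esub>)"
      using complex_hilbert.inner_nonneg[OF that(1), of "\<gamma> \<one>\<^bsub>G\<^esub>"] that(2) by (auto simp: hnorm_def)
    also have "\<dots> \<le> (SUP x\<in>carrier G. hnorm H (\<gamma> x))" by (rule cSUP_upper[OF one_closed that(3)])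
    finally show ?thesis .
  qed
  have "bdd_below ?N"
    by (rule bdd_belowI[of _ 0]) (auto simp: herz_schur_rep_def intro!: mult_nonneg_nonneg nonneg)
  moreover have "(SUP x\<in>carrier G. hnorm H' (\<alpha>' x)) * (SUP y\<in>carrier G. hnorm H' (\<beta>' y)) \<in> ?N"
    using rep by blast
  ultimately have "M0A_norm G \<phi> \<le> (SUP x\<in>carrier G. hnorm H' (\<alpha>' x)) * (SUP y\<in>carrier G. hnorm H' (\<beta>' y))"
    unfolding M0A_norm_def by (rule cInf_lower[rotated])
  also have "\<dots> \<le> sqrt M * sqrt M"
  proof (rule mult_mono)
    show "(SUP x\<in>carrier G. hnorm H' (\<alpha>' x)) \<le> sqrt M" "(SUP y\<in>carrier G. hnorm H' (\<beta>' y)) \<le> sqrt M"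
      using one_closed by (auto intro!: cSUP_least n simp: na nb)
    show "0 \<le> (SUP y\<in>carrier G. hnorm H' (\<beta>' y))" using rep by (intro nonneg) (auto simp: herz_schur_rep_def)
    have "0 \<le> M" using pd_kernel_diag(1)[OF K(1) X(1)[OF one_closed]] K(2)[OF X(1)[OF one_closed]] by linarith
    then show "0 \<le> sqrt M" by simp
  qed
  also have "\<dots> = M"
    using pd_kernel_diag(1)[OF K(1) X(1)[OF one_closed]] K(2)[OF X(1)[OF one_closed]] by simp
  finally show "M0A_norm G \<phi> \<le> M" .
qed

lemma (in complex_hilbert) pd_kernel_gram:
  assumes v: "\<And>p. p \<in> X \<Longrightarrow> v p \<in> hcarrier H"
  shows "pd_kernel X (\<lambda>p q. hinner H (v p) (v q))"
  unfolding pd_kernel_def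
proof (intro conjI ballI allI impI)
  show "hinner H (v q) (v p) = cnj (hinner H (v p) (v q))" if "p \<in> X" "q \<in> X" for p q
    using inner_commute[of "v q" "v p"] v that by simp
  fix F c assume F: "finite F" "F \<subseteq> X"
  have "\<exists>w\<in>hcarrier H. \<forall>u\<in>hcarrier H. hinner H w u = (\<Sum>p\<in>F. c p * hinner H (v p) u)"
    using F
  proof (induction F)
    case empty
    then show ?case by (intro bexI[of _ "hzero H"]) (simp_all add: zero_closed hinner_zero_left)
  next
    case (insert p F)
    then obtain w where w: "w \<in> hcarrier H" "\<forall>u\<in>hcarrier H. hinner H w u = (\<Sum>p\<in>F. c p * hinner H (v p) u)"
      by auto
    have "v p \<in> hcarrier H" using v insert by auto
    then show ?case using w insert
      by (intro bexI[of _ "hadd H (hscale H (c p) (v p)) w"])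
        (simp_all add: add_closed scale_closed inner_add_left inner_scale_left)
  qed
  then obtain w where w: "w \<in> hcarrier H" "\<And>u. u \<in> hcarrier H \<Longrightarrow> hinner H w u = (\<Sum>p\<in>F. c p * hinner H (v p) u)"
    by blast
  have "(\<Sum>p\<in>F. \<Sum>q\<in>F. c p * cnj (c q) * hinner H (v p) (v q))
      = (\<Sum>q\<in>F. cnj (c q) * (\<Sum>p\<in>F. c p * hinner H (v p) (v q)))"
    by (subst sum.swap) (simp add: sum_distrib_left mult_ac)
  also have "\<dots> = (\<Sum>q\<in>F. cnj (c q * hinner H (v q) w))"
  proof (rule sum.cong)
    fix q assume "q \<in> F"
    then have "v q \<in> hcarrier H" using v F by auto
    then show "cnj (c q) * (\<Sum>p\<in>F. c p * hinner H (v p) (v q)) = cnj (c q * hinner H (v q) w)"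
      using inner_commute[OF w(1), of "v q"] by (simp add: w(2)[symmetric])
  qed simp
  also have "\<dots> = cnj (hinner H w w)" by (simp add: w)
  finally show "0 \<le> Re (\<Sum>p\<in>F. \<Sum>q\<in>F. c p * cnj (c q) * hinner H (v p) (v q))"
    using inner_nonneg[OF w(1)] by simp
qed

lemma schur_ball_if_rep:
  assumes G: "group G" and rep: "herz_schur_rep G H \<alpha> \<beta> \<phi>"
    and lt: "(SUP x\<in>carrier G. hnorm H (\<alpha> x)) * (SUP y\<in>carrier G. hnorm H (\<beta> y)) < M"
  shows "schur_ball G M \<phi>"
proof -
  interpret group G by (rule G)
  interpret complex_hilbert H using rep by (simp add: herz_schur_rep_def)
  define A where "A = (SUP x\<in>carrier G. hnorm H (\<alpha> x))"
  define B where "B = (SUP y\<in>carrier G. hnorm H (\<beta> y))"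
  have \<alpha>: "\<alpha> x \<in> hcarrier H" and \<beta>: "\<beta> x \<in> hcarrier H" if "x \<in> carrier G" for x
    using rep that by (auto simp: herz_schur_rep_def)
  have A: "hnorm H (\<alpha> x) \<le> A" and B: "hnorm H (\<beta> x) \<le> B" if "x \<in> carrier G" for x
    using rep that unfolding A_def B_def by (auto simp: herz_schur_rep_def intro!: cSUP_upper)
  have hn: "0 \<le> hnorm H u" if "u \<in> hcarrier H" for u using inner_nonneg[OF that] by (simp add: hnorm_def)
  have A0: "0 \<le> A" and B0: "0 \<le> B"
    using order_trans[OF hn[OF \<alpha>] A] order_trans[OF hn[OF \<beta>] B] one_closed by blast+
  have AB: "A * B < M" using lt by (simp add: A_def B_def)
  then have M0: "0 < M" using mult_nonneg_nonneg[OF A0 B0] by linarith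
  \<comment> \<open>only the product of the two suprema is bounded, so the two families of vectors are balanced\<close>
  obtain t where t: "t > 0" "(t * A)\<^sup>2 \<le> M" "(B / t)\<^sup>2 \<le> M"
  proof (cases "A = 0")
    case True
    have "(B / ((B + 1) / sqrt M))\<^sup>2 = M * (B / (B + 1))\<^sup>2"
      using M0 by (simp add: power_divide power_mult_distrib)
    also have "\<dots> \<le> M * 1\<^sup>2" using M0 B0 by (intro mult_left_mono power_mono) auto
    finally show thesis using True M0 B0 by (intro that[of "(B + 1) / sqrt M"]) auto
  next
    case False
    then have "A > 0" using A0 by simp
    have "(B / (sqrt M / A))\<^sup>2 = (A * B)\<^sup>2 / M"
      using M0 by (simp add: power_divide power_mult_distrib mult.commute)
    also have "\<dots> \<le> M\<^sup>2 / M"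
      using AB A0 B0 M0 by (intro divide_right_mono power_mono) auto
    finally show thesis
      using \<open>A > 0\<close> M0 by (intro that[of "sqrt M / A"]) (auto simp: power2_eq_square)
  qed
  define v where "v p = (case p of Inl x \<Rightarrow> hscale H (of_real t) (\<alpha> x)
      | Inr y \<Rightarrow> hscale H (of_real (1 / t)) (\<beta> y))" for p
  have v: "v p \<in> hcarrier H" if "p \<in> carrier G <+> carrier G" for p
    using that by (auto simp: v_def scale_closed \<alpha> \<beta>)
  have sc: "Re (hinner H (hscale H (of_real r) u) (hscale H (of_real r) u)) = (r * hnorm H u)\<^sup>2"
    if "u \<in> hcarrier H" for r u
    using that inner_nonneg[OF that]
    by (simp add: inner_scale_left inner_scale_right scale_closed hnorm_def power_mult_distrib power2_eq_square
        mult.assoc)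
  show ?thesis
    unfolding schur_ball_def
  proof (intro exI[of _ "\<lambda>p q. hinner H (v p) (v q)"] conjI ballI)
    show "pd_kernel (carrier G <+> carrier G) (\<lambda>p q. hinner H (v p) (v q))"
      by (rule pd_kernel_gram[OF v])
    fix p assume "p \<in> carrier G <+> carrier G"
    then consider x where "p = Inl x" "x \<in> carrier G" | y where "p = Inr y" "y \<in> carrier G" by auto
    then show "Re (hinner H (v p) (v p)) \<le> M"
    proof cases
      case 1
      have "(t * hnorm H (\<alpha> x))\<^sup>2 \<le> (t * A)\<^sup>2"
        using t(1) 1(2) by (intro power_mono mult_left_mono A mult_nonneg_nonneg hn \<alpha>) auto
      then show ?thesis using t(2) 1 sc[OF \<alpha>, of x t] by (simp add: v_def)
    next
      case 2
      have "(1 / t * hnorm H (\<beta> y))\<^sup>2 \<le> (B / t)\<^sup>2"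
        using t(1) 2(2) B[of y] by (intro power_mono) (auto simp: field_simps hn \<beta>)
      then show ?thesis using t(3) 2 sc[OF \<beta>, of y "1 / t"] by (simp add: v_def)
    qed
  next
    fix x y assume "x \<in> carrier G" "y \<in> carrier G"
    then show "hinner H (v (Inl x)) (v (Inr y)) = \<phi> (inv\<^bsub>G\<^esub> y \<otimes>\<^bsub>G\<^esub> x)"
      using rep t(1) by (simp add: v_def inner_scale_left inner_scale_right scale_closed \<alpha> \<beta> herz_schur_rep_def)
  qed
qed

text \<open>
  Every larger radius is attained by definition of the infimum; the radius itself follows by passing
  to the limit.
\<close>

lemma schur_ball_if_M0A:
  fixes G :: "('a, 'b) monoid_scheme"
  assumes G: "group G" and count: "countable (carrier G)"
    and \<phi>: "\<phi> \<in> M0A G" and le: "M0A_norm G \<phi> \<le> M"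
  shows "schur_ball G M \<phi>"
proof (rule schur_ball_limit[OF count _ _ _ G, where \<phi> = "\<lambda>_. \<phi>"])
  let ?N = "{(SUP x\<in>carrier G. hnorm H (\<alpha> x)) * (SUP y\<in>carrier G. hnorm H (\<beta> y)) |
          (H :: ('a + 'a \<Rightarrow> complex) hilbert) \<alpha> \<beta>. herz_schur_rep G H \<alpha> \<beta> \<phi>}"
  have "?N \<noteq> {}" using \<phi> unfolding M0A_def by blast
  then show "schur_ball G (M + 1 / real (Suc n)) \<phi>" for n
    using cInf_lessD[of ?N "M + 1 / real (Suc n)"] le schur_ball_if_rep[OF G]
    unfolding M0A_norm_def by (fastforce intro: le_less_trans)
  show "(\<lambda>n. M + 1 / real (Suc n)) \<longlonglongrightarrow> M"
    using tendsto_add[OF tendsto_const[of M] LIMSEQ_inverse_real_of_nat] by (simp add: inverse_eq_divide)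
qed simp

lemma countable_carrier:
  assumes G: "group G" and S: "finite_symmetric_generating_set G S"
  shows "countable (carrier G)"
proof -
  interpret group G by (rule G)
  have SG: "finite S" "S \<subseteq> carrier G" "\<And>s. s \<in> S \<Longrightarrow> inv\<^bsub>G\<^esub> s \<in> S" "generate G S = carrier G"
    using S by (auto simp: finite_symmetric_generating_set_def)
  define f where "f ws = foldr (\<lambda>g h. g \<otimes>\<^bsub>G\<^esub> h) ws \<one>\<^bsub>G\<^esub>" for ws
  have fc: "f ws \<in> carrier G" if "set ws \<subseteq> S" for ws
    using that SG(2) by (induction ws) (auto simp: f_def)
  have app: "f (us @ ws) = f us \<otimes>\<^bsub>G\<^esub> f ws" if "set us \<subseteq> S" "set ws \<subseteq> S" for us ws
    using that SG(2)
  proof (induction us)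
    case (Cons u us)
    then have "f us \<in> carrier G" "f ws \<in> carrier G" "u \<in> carrier G" using fc by auto
    then show ?case using Cons by (simp add: f_def m_assoc)
  qed (use fc in \<open>simp add: f_def\<close>)
  have "x \<in> f ` lists S" if "x \<in> generate G S" for x
    using that
  proof induction
    case one show ?case by (rule image_eqI[of _ _ "[]"]) (auto simp: f_def)
  next
    case (incl h) then show ?case using SG(2) by (intro image_eqI[of _ _ "[h]"]) (auto simp: f_def)
  next
    case (inv h) then show ?case using SG by (intro image_eqI[of _ _ "[inv\<^bsub>G\<^esub> h]"]) (auto simp: f_def)
  next
    case (eng h1 h2)
    then obtain us ws where "us \<in> lists S" "ws \<in> lists S" "h1 = f us" "h2 = f ws" by auto
    then show ?case by (intro image_eqI[of _ _ "us @ ws"]) (auto simp: app lists_eq_set)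
  qed
  then have "carrier G \<subseteq> f ` lists S" using SG(4) by auto
  moreover have "countable (f ` lists S)" using SG(1) by (intro countable_image countable_lists countable_finite)
  ultimately show ?thesis using countable_subset by blast
qed

section \<open>The coefficients of \<open>(1 - z)\<^bsup>-3/2\<^esup>\<close>\<close>

text \<open>
  These numbers serve as weights: their convolution square is a quadratic polynomial, and
  \<open>x \<mapsto> (\<Sum>i. berg i x\<^sub>i z\<^sup>i)\<close> maps square summable sequences to square integrable functions on the disc
  with norm at most \<open>2\<close>, because \<open>z\<^sup>i\<close> has squared norm \<open>\<pi> / (i + 1)\<close>.
\<close>

definition berg :: "nat \<Rightarrow> real" where
  "berg i = (- 1) ^ i * (- 3 / 2 gchoose i)"

lemma berg_0: "berg 0 = 1" by (simp add: berg_def)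

lemma berg_Suc: "berg (Suc i) = berg i * ((real i + 3 / 2) / real (Suc i))"
  by (simp add: berg_def gbinomial_Suc_eq field_simps)

lemma berg_pos: "0 < berg i"
  by (induction i) (simp_all add: berg_0 berg_Suc)

lemma berg_nonneg: "0 \<le> berg i"
  by (rule less_imp_le[OF berg_pos])

lemma berg_convolution: "(\<Sum>i\<le>n. berg i * berg (n - i)) = real ((n + 1) * (n + 2)) / 2"
proof -
  have "(\<Sum>i\<le>n. berg i * berg (n - i))
      = (\<Sum>k\<le>n. (- 1) ^ n * ((- 3 / 2 gchoose k) * (- 3 / 2 gchoose (n - k))))"
    by (rule sum.cong) (auto simp: berg_def power_add[symmetric])
  also have "\<dots> = (- 1) ^ n * (- 3 gchoose n)"
    using gbinomial_Vandermonde[of "- 3/2::real" "- 3/2" n]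
    by (simp add: sum_distrib_left[symmetric] atMost_atLeast0)
  also have "\<dots> = real ((n + 1) * (n + 2)) / 2"
    by (induction n) (simp_all add: gbinomial_Suc_eq field_simps)
  finally show ?thesis .
qed

text \<open>
  The coefficient is \<open>\<Gamma>(i + 3/2) / (\<Gamma>(3/2) i!)\<close>, and log-convexity puts \<open>\<Gamma>(i + 3/2)\<close> below the
  geometric mean of \<open>\<Gamma>(i + 1)\<close> and \<open>\<Gamma>(i + 2)\<close>. The factor \<open>4 / pi\<close> is \<open>\<Gamma>(3/2)\<^sup>-\<^sup>2\<close>.
\<close>

lemma berg_square_le: "(berg i)\<^sup>2 \<le> 4 / pi * real (Suc i)"
proof -
  have gp: "Gamma (y + 1) = y * Gamma y" if "y > 0" for y :: real
    using that by (intro Gamma_plus1) (auto dest: nonpos_Ints_nonpos)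
  have g32: "Gamma (3 / 2 :: real) = sqrt pi / 2"
    using gp[of "1/2"] by (simp add: Gamma_one_half_real)
  have eq: "berg i * Gamma (3 / 2) * Gamma (real i + 1) = Gamma (real i + 3 / 2)"
  proof (induction i)
    case (Suc i)
    have "Gamma (real (Suc i) + 1) = (real i + 1) * Gamma (real i + 1)"
      using gp[of "real i + 1"] by (simp add: add_ac)
    moreover have "Gamma (real (Suc i) + 3 / 2) = (real i + 3 / 2) * Gamma (real i + 3 / 2)"
      using gp[of "real i + 3 / 2"] by (simp add: add_ac)
    moreover have "real (Suc i) = real i + 1" by simp
    ultimately show ?case unfolding berg_Suc Suc[symmetric] by (simp only:) (simp add: field_simps)
  qed (simp add: berg_0)
  define x where "x = real i + 1"
  have x: "x > 0" by (simp add: x_def)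
  have "(ln \<circ> Gamma) ((1 - 1 / 2) *\<^sub>R x + (1 / 2) *\<^sub>R (x + 1))
      \<le> (1 - 1 / 2) * (ln \<circ> Gamma) x + 1 / 2 * (ln \<circ> Gamma) (x + 1)"
    by (rule convex_onD[OF log_convex_Gamma_real]) (use x in auto)
  then have "2 * ln (Gamma (x + 1 / 2)) \<le> ln (Gamma x) + ln (Gamma (x + 1))"
    by (simp add: field_simps)
  also have "\<dots> = ln (Gamma x * Gamma (x + 1))" using x by (subst ln_mult_pos) auto
  also have "2 * ln (Gamma (x + 1 / 2)) = ln ((Gamma (x + 1 / 2))\<^sup>2)" using x by (simp add: ln_realpow)
  finally have l: "ln ((Gamma (x + 1 / 2))\<^sup>2) \<le> ln (Gamma x * Gamma (x + 1))" .
  have pos: "Gamma (x + 1 / 2) \<noteq> 0" using x Gamma_real_pos[of "x + 1 / 2"] by linarith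
  have "(Gamma (x + 1 / 2))\<^sup>2 \<le> Gamma x * Gamma (x + 1)"
    by (rule iffD1[OF ln_le_cancel_iff, OF _ _ l])
      (use x pos in \<open>auto intro!: mult_pos_pos\<close>)
  also have "Gamma (x + 1) = x * Gamma x" by (rule gp[OF x])
  finally have "(Gamma (x + 1 / 2))\<^sup>2 \<le> x * (Gamma x)\<^sup>2" by (simp add: power2_eq_square mult.left_commute)
  moreover have "Gamma (x + 1 / 2) = berg i * Gamma (3 / 2) * Gamma x"
    using eq by (simp add: x_def add.assoc)
  ultimately have "(berg i)\<^sup>2 * (pi / 4) * (Gamma x)\<^sup>2 \<le> x * (Gamma x)\<^sup>2"
    by (simp add: g32 power_mult_distrib power_divide)
  then have "(berg i)\<^sup>2 * (pi / 4) \<le> x"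
    using Gamma_real_pos[OF x] by (simp add: mult_le_cancel_right)
  then show ?thesis by (simp add: x_def field_simps)
qed


section \<open>Means over polar grids in the disc\<close>

definition grid_point :: "nat \<Rightarrow> nat \<Rightarrow> nat \<Rightarrow> complex" where
  "grid_point N p q = of_real (real p / real N) * cis (2 * pi * real q / real N)"

text \<open>
  A Riemann sum for \<open>\<pi>\<^sup>-\<^sup>1\<close> times the integral of \<open>f (z\<^sup>2)\<close> over the unit disc: for \<open>w = z\<^sup>2\<close> the area
  measure makes \<open>|w|\<close>, and not \<open>|w|\<^sup>2\<close>, equidistributed in the unit interval.
\<close>

definition disc_mean :: "nat \<Rightarrow> (complex \<Rightarrow> 'a::real_vector) \<Rightarrow> 'a" where
  "disc_mean N f = (\<Sum>p<N. \<Sum>q<N. f (grid_point N p q)) /\<^sub>R (real N)\<^sup>2"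

definition power_mean :: "nat \<Rightarrow> nat \<Rightarrow> real" where
  "power_mean k N = (\<Sum>p<N. (real p / real N) ^ k) / real N"

lemma norm_grid_point: "cmod (grid_point N p q) = real p / real N"
  by (simp add: grid_point_def norm_mult norm_divide)

lemma norm_grid_point_less: "p < N \<Longrightarrow> cmod (grid_point N p q) < 1"
  by (simp add: norm_grid_point)

lemma disc_mean_zero: "disc_mean N (\<lambda>w. 0) = 0"
  by (simp add: disc_mean_def)

lemma disc_mean_add: "disc_mean N (\<lambda>w. f w + g w) = disc_mean N f + disc_mean N g"
  by (simp add: disc_mean_def sum.distrib scaleR_add_right)

lemma disc_mean_diff: "disc_mean N (\<lambda>w. f w - g w) = disc_mean N f - disc_mean N g"
  by (simp add: disc_mean_def sum_subtractf scaleR_diff_right)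

lemma disc_mean_sum: "disc_mean N (\<lambda>w. \<Sum>i\<in>I. f i w) = (\<Sum>i\<in>I. disc_mean N (f i))"
  by (induction I rule: infinite_finite_induct) (simp_all add: disc_mean_add disc_mean_zero)

lemma disc_mean_cmult:
  fixes c :: "'a :: real_algebra"
  shows "disc_mean N (\<lambda>w. c * f w) = c * disc_mean N f"
  by (simp add: disc_mean_def sum_distrib_left)

lemma disc_mean_mono:
  fixes f g :: "complex \<Rightarrow> real"
  assumes "\<And>w. cmod w < 1 \<Longrightarrow> f w \<le> g w"
  shows "disc_mean N f \<le> disc_mean N g"
  unfolding disc_mean_def real_scaleR_def
  by (intro mult_left_mono sum_mono assms norm_grid_point_less) auto

lemma norm_disc_mean_le: "norm (disc_mean N f) \<le> disc_mean N (\<lambda>w. norm (f w))"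
  unfolding disc_mean_def
  by (auto intro!: mult_left_mono order_trans[OF norm_sum] sum_mono)

lemma Re_disc_mean: "Re (disc_mean N f) = disc_mean N (\<lambda>w. Re (f w))"
  by (simp add: disc_mean_def)

lemma sum_power_bounds:
  "real (Suc k) * (\<Sum>p<N. real p ^ k) \<le> real N ^ Suc k"
  "real N ^ Suc k \<le> real (Suc k) * ((\<Sum>p<N. real p ^ k) + real N ^ k)"
proof -
  have d: "real (Suc p) ^ Suc k - real p ^ Suc k = (\<Sum>i<Suc k. real p ^ (k - i) * real (Suc p) ^ i)" for p
    using power_diff_sumr2[of "real (Suc p)" "Suc k" "real p"] by simp
  have lo: "real (Suc k) * real p ^ k \<le> real (Suc p) ^ Suc k - real p ^ Suc k" for p
  proof -
    have "(\<Sum>i<Suc k. real p ^ k) \<le> (\<Sum>i<Suc k. real p ^ (k - i) * real (Suc p) ^ i)"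
    proof (rule sum_mono)
      fix i assume "i \<in> {..<Suc k}"
      then have "real p ^ k = real p ^ (k - i) * real p ^ i" by (simp flip: power_add)
      also have "\<dots> \<le> real p ^ (k - i) * real (Suc p) ^ i" by (intro mult_left_mono power_mono) auto
      finally show "real p ^ k \<le> real p ^ (k - i) * real (Suc p) ^ i" .
    qed
    then show ?thesis unfolding d by simp
  qed
  have hi: "real (Suc p) ^ Suc k - real p ^ Suc k \<le> real (Suc k) * real (Suc p) ^ k" for p
  proof -
    have "(\<Sum>i<Suc k. real p ^ (k - i) * real (Suc p) ^ i) \<le> (\<Sum>i<Suc k. real (Suc p) ^ k)"
    proof (rule sum_mono)
      fix i assume i: "i \<in> {..<Suc k}"
      have "real p ^ (k - i) * real (Suc p) ^ i \<le> real (Suc p) ^ (k - i) * real (Suc p) ^ i"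
        by (intro mult_right_mono power_mono) auto
      also have "\<dots> = real (Suc p) ^ k" using i by (simp flip: power_add)
      finally show "real p ^ (k - i) * real (Suc p) ^ i \<le> real (Suc p) ^ k" .
    qed
    then show ?thesis unfolding d by simp
  qed
  have tele: "(\<Sum>p<N. real (Suc p) ^ Suc k - real p ^ Suc k) = real N ^ Suc k"
    using sum_lessThan_telescope[of "\<lambda>p. real p ^ Suc k" N] by simp
  have "real (Suc k) * (\<Sum>p<N. real p ^ k) \<le> (\<Sum>p<N. real (Suc p) ^ Suc k - real p ^ Suc k)"
    unfolding sum_distrib_left by (rule sum_mono[OF lo])
  then show "real (Suc k) * (\<Sum>p<N. real p ^ k) \<le> real N ^ Suc k" unfolding tele .
  have "real N ^ Suc k \<le> (\<Sum>p<N. real (Suc k) * real (Suc p) ^ k)"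
    unfolding tele[symmetric] by (rule sum_mono[OF hi])
  also have "\<dots> = real (Suc k) * (\<Sum>p<N. real (Suc p) ^ k)" by (simp only: sum_distrib_left)
  also have "\<dots> \<le> real (Suc k) * ((\<Sum>p<N. real p ^ k) + real N ^ k)"
  proof (rule mult_left_mono)
    have "real 0 ^ k + (\<Sum>p<N. real (Suc p) ^ k) = (\<Sum>p<Suc N. real p ^ k)"
      by (rule sum.lessThan_Suc_shift[symmetric])
    also have "\<dots> = (\<Sum>p<N. real p ^ k) + real N ^ k" by simp
    finally show "(\<Sum>p<N. real (Suc p) ^ k) \<le> (\<Sum>p<N. real p ^ k) + real N ^ k"
      using zero_le_power[of "real 0" k] by linarith
  qed simp
  finally show "real N ^ Suc k \<le> real (Suc k) * ((\<Sum>p<N. real p ^ k) + real N ^ k)" .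
qed

lemma power_mean_eq: "power_mean k N = (\<Sum>p<N. real p ^ k) / real N ^ Suc k"
  by (simp add: power_mean_def power_divide sum_divide_distrib[symmetric] mult.commute)

lemma power_mean_le: "power_mean k N \<le> 1 / real (Suc k)"
proof (cases "N = 0")
  case False
  then show ?thesis using sum_power_bounds(1)[of k N] by (simp add: power_mean_eq field_simps)
qed (simp add: power_mean_def)

lemma power_mean_ge:
  assumes "N > 0"
  shows "1 / real (Suc k) - 1 / real N \<le> power_mean k N"
proof -
  have "real N ^ Suc k / real N ^ Suc k
      \<le> real (Suc k) * ((\<Sum>p<N. real p ^ k) + real N ^ k) / real N ^ Suc k"
    by (rule divide_right_mono[OF sum_power_bounds(2)]) simp
  also have "\<dots> = real (Suc k) * (power_mean k N + 1 / real N)"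
    using assms by (simp add: power_mean_eq field_simps)
  finally have "1 \<le> real (Suc k) * (power_mean k N + 1 / real N)" using assms by simp
  then have "1 / real (Suc k) \<le> power_mean k N + 1 / real N" by (simp add: field_simps)
  then show ?thesis by simp
qed

lemma power_mean_tendsto: "(\<lambda>N. power_mean k N) \<longlonglongrightarrow> 1 / real (Suc k)"
proof (rule tendsto_sandwich[OF _ _ _ tendsto_const])
  show "\<forall>\<^sub>F N in sequentially. 1 / real (Suc k) - 1 / real N \<le> power_mean k N"
    using eventually_gt_at_top[of 0] by eventually_elim (rule power_mean_ge)
  show "(\<lambda>N. 1 / real (Suc k) - 1 / real N) \<longlonglongrightarrow> 1 / real (Suc k)"
    using tendsto_diff[OF tendsto_const lim_1_over_n, of "1 / real (Suc k)"] by simp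
  show "\<forall>\<^sub>F N in sequentially. power_mean k N \<le> 1 / real (Suc k)"
    by (intro always_eventually allI power_mean_le)
qed

lemma sum_cis_powers:
  assumes "i < N" "j < N"
  shows "(\<Sum>q<N. cis (2 * pi * real q / real N) ^ i * cnj (cis (2 * pi * real q / real N)) ^ j)
    = (if i = j then of_nat N else 0)"
proof -
  define w where "w = cis (2 * pi / real N)"
  have N: "N > 0" using assms by simp
  have pw: "w ^ k = cis (2 * pi * real k / real N)" for k
    by (simp add: w_def Complex.DeMoivre mult_ac)
  define z where "z = w ^ i * cnj w ^ j"
  have ww: "w * cnj w = 1" by (simp add: w_def cis_cnj cis_mult)
  have zq: "cis (2 * pi * real q / real N) ^ i * cnj (cis (2 * pi * real q / real N)) ^ j = z ^ q" for q
    by (simp only: pw[symmetric] complex_cnj_power z_def power_mult_distrib power_mult[symmetric]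
        mult.commute[of q])
  have wN: "w ^ N = 1" using N by (simp add: pw)
  have zN: "z ^ N = 1"
    using wN by (simp add: z_def power_mult_distrib power_mult[symmetric] mult.commute[of _ N])
      (simp add: power_mult complex_cnj_power[symmetric])
  show ?thesis
  proof (cases "i = j")
    case True
    then have "z = 1" by (simp add: z_def ww power_mult_distrib[symmetric])
    then show ?thesis unfolding zq using True by simp
  next
    case False
    have "z \<noteq> 1"
    proof
      assume "z = 1"
      have "w ^ i = w ^ i * (w * cnj w) ^ j" by (simp add: ww)
      also have "\<dots> = z * w ^ j" by (simp add: z_def power_mult_distrib)
      finally have "w ^ i = w ^ j" using \<open>z = 1\<close> by simp
      moreover have "inj_on (\<lambda>k. w ^ k) {..<N}"
        using Complex.bij_betw_roots_unity[OF N] by (simp add: pw bij_betw_def)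
      ultimately show False using assms False by (auto simp: inj_on_def)
    qed
    then show ?thesis using False by (simp add: zq geometric_sum zN)
  qed
qed

lemma disc_mean_monomial:
  assumes "i < N" "j < N"
  shows "disc_mean N (\<lambda>w. of_real (cmod w ^ e) * (w ^ i * cnj w ^ j))
    = (if i = j then of_real (power_mean (2 * i + e) N) else 0)"
proof -
  have N: "N > 0" using assms by simp
  have aux: "of_real (r ^ e) * ((of_real r * c) ^ i * cnj (of_real r * c) ^ j)
      = of_real (r ^ (i + j + e)) * (c ^ i * cnj c ^ j)" for r c
    by (simp add: power_mult_distrib power_add mult_ac)
  have "(\<Sum>q<N. of_real (cmod (grid_point N p q) ^ e) * (grid_point N p q ^ i * cnj (grid_point N p q) ^ j))
      = of_real ((real p / real N) ^ (i + j + e)) * (if i = j then of_nat N else 0)" for p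
    unfolding sum_cis_powers[OF assms, symmetric] sum_distrib_left
    by (rule sum.cong) (simp_all only: norm_grid_point, simp only: grid_point_def aux)
  then have "disc_mean N (\<lambda>w. of_real (cmod w ^ e) * (w ^ i * cnj w ^ j))
      = (of_real (\<Sum>p<N. (real p / real N) ^ (i + j + e)) * (if i = j then of_nat N else 0)) /\<^sub>R (real N)\<^sup>2"
    unfolding disc_mean_def by (simp only: sum_distrib_right[symmetric] of_real_sum)
  also have "\<dots> = (if i = j then of_real (power_mean (2 * i + e) N) else 0)"
    using N by (simp add: power_mean_def scaleR_conv_of_real power2_eq_square mult_2[symmetric] field_simps
        del: of_real_sum)
  finally show ?thesis .
qed

lemma disc_mean_norm_power:
  assumes "N > 0"
  shows "disc_mean N (\<lambda>w. cmod w ^ k) = power_mean k N"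
  using disc_mean_monomial[of 0 N 0 k, THEN arg_cong[of _ _ Re]] assms
  by (simp add: Re_disc_mean)

lemma disc_mean_quadratic_form:
  assumes "L \<le> N"
  shows "disc_mean N (\<lambda>w. cmod w ^ e *
       Re (\<Sum>i<L. \<Sum>j<L. B i j * (of_real (x j) * w ^ j) * cnj (of_real (x i) * w ^ i)))
    = (\<Sum>i<L. Re (B i i) * (x i)\<^sup>2 * power_mean (2 * i + e) N)"
proof -
  have "cmod w ^ e * Re (\<Sum>i<L. \<Sum>j<L. B i j * (of_real (x j) * w ^ j) * cnj (of_real (x i) * w ^ i))
      = Re (\<Sum>i<L. \<Sum>j<L. (B i j * of_real (x j * x i)) * (of_real (cmod w ^ e) * (w ^ j * cnj w ^ i)))" for w
  proof -
    have "(\<Sum>i<L. \<Sum>j<L. (B i j * of_real (x j * x i)) * (of_real (cmod w ^ e) * (w ^ j * cnj w ^ i)))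
      = of_real (cmod w ^ e) * (\<Sum>i<L. \<Sum>j<L. B i j * (of_real (x j) * w ^ j) * cnj (of_real (x i) * w ^ i))"
      by (simp add: sum_distrib_left mult_ac)
    then show ?thesis by (simp del: Re_sum of_real_power)
  qed
  then have "disc_mean N (\<lambda>w. cmod w ^ e *
       Re (\<Sum>i<L. \<Sum>j<L. B i j * (of_real (x j) * w ^ j) * cnj (of_real (x i) * w ^ i)))
    = Re (\<Sum>i<L. \<Sum>j<L. (B i j * of_real (x j * x i)) *
        disc_mean N (\<lambda>w. of_real (cmod w ^ e) * (w ^ j * cnj w ^ i)))"
    by (simp only: Re_disc_mean[symmetric] disc_mean_sum disc_mean_cmult)
  also have "(\<Sum>i<L. \<Sum>j<L. (B i j * of_real (x j * x i)) *
        disc_mean N (\<lambda>w. of_real (cmod w ^ e) * (w ^ j * cnj w ^ i)))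
      = (\<Sum>i<L. \<Sum>j<L. if j = i then B i i * of_real (x i * x i) * of_real (power_mean (2 * i + e) N) else 0)"
    using assms by (intro sum.cong refl) (subst disc_mean_monomial; auto)
  also have "\<dots> = (\<Sum>i<L. B i i * of_real (x i * x i) * of_real (power_mean (2 * i + e) N))"
    by (rule sum.cong) auto
  also have "Re \<dots> = (\<Sum>i<L. Re (B i i) * (x i)\<^sup>2 * power_mean (2 * i + e) N)"
    by (simp add: power2_eq_square mult.assoc flip: of_real_mult)
  finally show ?thesis .
qed

lemma disc_mean_coefficient:
  assumes "D \<le> N" "n < N"
  shows "disc_mean N (\<lambda>w. (\<Sum>m<D. g m * w ^ m) * of_real (1 - cmod w) * cnj w ^ n)
    = (if n < D then g n * of_real (power_mean (2 * n) N - power_mean (2 * n + 1) N) else 0)"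
proof -
  have "(\<Sum>m<D. g m * w ^ m) * of_real (1 - cmod w) * cnj w ^ n
      = (\<Sum>m<D. g m * (of_real (cmod w ^ 0) * (w ^ m * cnj w ^ n) - of_real (cmod w ^ 1) * (w ^ m * cnj w ^ n)))" for w
    by (simp only: sum_distrib_right) (rule sum.cong, simp_all add: algebra_simps)
  then have "disc_mean N (\<lambda>w. (\<Sum>m<D. g m * w ^ m) * of_real (1 - cmod w) * cnj w ^ n)
      = (\<Sum>m<D. g m * (disc_mean N (\<lambda>w. of_real (cmod w ^ 0) * (w ^ m * cnj w ^ n))
          - disc_mean N (\<lambda>w. of_real (cmod w ^ 1) * (w ^ m * cnj w ^ n))))"
    by (simp only: disc_mean_sum disc_mean_cmult disc_mean_diff)
  also have "\<dots> = (\<Sum>m<D. if m = n then g n * of_real (power_mean (2 * n) N - power_mean (2 * n + 1) N) else 0)"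
    using assms by (intro sum.cong refl) (subst disc_mean_monomial, simp, simp, subst disc_mean_monomial, auto)
  finally show ?thesis by simp
qed

section \<open>A discrete integral representation\<close>

text \<open>
  The weight of \<open>a m\<close> in \<open>u\<^sup>T h u + v\<^sup>T k v\<close> for vectors of length \<open>L\<close>. The matrices \<open>h\<close> and \<open>k\<close> are the
  diagonal blocks, for even and for odd indices, of one Hankel matrix with entries \<open>a ((l + l') / 2)\<close>
  for even \<open>l + l'\<close> and \<open>0\<close> otherwise.
\<close>

definition kernel_weight :: "nat \<Rightarrow> nat \<Rightarrow> real" where
  "kernel_weight L m = (\<Sum>l<2 * L. \<Sum>l'<2 * L. if l + l' = 2 * m then berg l * berg l' else 0)"

lemma kernel_weight_eq:
  "kernel_weight L m = (\<Sum>l\<in>{l. l < 2 * L \<and> l \<le> 2 * m \<and> 2 * m - l < 2 * L}. berg l * berg (2 * m - l))"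
proof -
  have "(\<Sum>l'<2 * L. if l + l' = 2 * m then berg l * berg l' else 0)
      = (if l \<le> 2 * m \<and> 2 * m - l < 2 * L then berg l * berg (2 * m - l) else 0)" for l
  proof -
    have "(\<Sum>l'<2 * L. if l + l' = 2 * m then berg l * berg l' else 0)
        = (\<Sum>l'<2 * L. if l' = 2 * m - l then (if l \<le> 2 * m then berg l * berg l' else 0) else 0)"
      by (rule sum.cong) auto
    then show ?thesis by auto
  qed
  then have "kernel_weight L m = (\<Sum>l<2 * L. if l \<le> 2 * m \<and> 2 * m - l < 2 * L then berg l * berg (2 * m - l) else 0)"
    by (simp add: kernel_weight_def)
  also have "\<dots> = (\<Sum>l\<in>{l \<in> {..<2 * L}. l \<le> 2 * m \<and> 2 * m - l < 2 * L}. berg l * berg (2 * m - l))"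
    by (rule sum.inter_filter[symmetric]) simp
  finally show ?thesis by simp
qed

lemma kernel_weight_nonneg: "0 \<le> kernel_weight L m"
  unfolding kernel_weight_eq by (intro sum_nonneg mult_nonneg_nonneg berg_nonneg)

lemma kernel_weight_le: "kernel_weight L m \<le> real ((2 * m + 1) * (2 * m + 2)) / 2"
  unfolding kernel_weight_eq berg_convolution[of "2 * m", symmetric]
  by (rule sum_mono2) (auto intro!: mult_nonneg_nonneg berg_nonneg)

lemma kernel_weight_full:
  assumes "m < L"
  shows "kernel_weight L m = real ((2 * m + 1) * (2 * m + 2)) / 2"
  unfolding kernel_weight_eq berg_convolution[of "2 * m", symmetric]
  by (rule sum.cong) (use assms in auto)

lemma sum_even_odd: "(\<Sum>l<2 * L. f l) = (\<Sum>i<L. f (2 * i) + f (2 * i + 1 :: nat))"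
  for f :: "nat \<Rightarrow> 'a :: comm_monoid_add"
  by (induction L) (simp_all add: add_ac)

lemma kernel_polynomial:
  fixes a :: "nat \<Rightarrow> complex"
  shows "(\<Sum>m<2 * L. of_real (kernel_weight L m) * a m * w ^ m)
    = (\<Sum>i<L. \<Sum>j<L. of_real (berg (2 * i) * berg (2 * j)) * a (i + j) * w ^ (i + j))
      + (\<Sum>i<L. \<Sum>j<L. of_real (berg (2 * i + 1) * berg (2 * j + 1)) * a (i + j + 1) * w ^ (i + j + 1))"
proof -
  define h where "h l l' = of_real (berg l * berg l') * a ((l + l') div 2) * w ^ ((l + l') div 2)" for l l'
  have "(\<Sum>m<2 * L. of_real (kernel_weight L m) * a m * w ^ m)
      = (\<Sum>m<2 * L. \<Sum>l<2 * L. \<Sum>l'<2 * L. if l + l' = 2 * m then h l l' else 0)"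
    unfolding kernel_weight_def of_real_sum sum_distrib_right
    by (intro sum.cong refl) (auto simp: h_def)
  also have "\<dots> = (\<Sum>l<2 * L. \<Sum>l'<2 * L. \<Sum>m<2 * L. if l + l' = 2 * m then h l l' else 0)"
    by (subst sum.swap, rule sum.cong[OF refl], rule sum.swap)
  also have "\<dots> = (\<Sum>l<2 * L. \<Sum>l'<2 * L. if even (l + l') then h l l' else 0)"
  proof (intro sum.cong refl)
    fix l l' assume "l \<in> {..<2 * L}" "l' \<in> {..<2 * L}"
    then have lt: "(l + l') div 2 < 2 * L" by auto
    show "(\<Sum>m<2 * L. if l + l' = 2 * m then h l l' else 0) = (if even (l + l') then h l l' else 0)"
    proof (cases "even (l + l')")
      case True
      then have "(\<Sum>m<2 * L. if l + l' = 2 * m then h l l' else 0)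
          = (\<Sum>m<2 * L. if m = (l + l') div 2 then h l l' else 0)"
        by (intro sum.cong) auto
      then show ?thesis using True lt by simp
    next
      case False
      then have "l + l' \<noteq> 2 * m" for m by (metis dvd_triv_left)
      then show ?thesis using False by simp
    qed
  qed
  also have "\<dots> = (\<Sum>i<L. (\<Sum>j<L. h (2 * i) (2 * j)) + (\<Sum>j<L. h (2 * i + 1) (2 * j + 1)))"
    unfolding sum_even_odd by (rule sum.cong) simp_all
  also have "\<dots> = (\<Sum>i<L. \<Sum>j<L. h (2 * i) (2 * j)) + (\<Sum>i<L. \<Sum>j<L. h (2 * i + 1) (2 * j + 1))"
    by (rule sum.distrib)
  finally have sum_h: "(\<Sum>m<2 * L. of_real (kernel_weight L m) * a m * w ^ m)
      = (\<Sum>i<L. \<Sum>j<L. h (2 * i) (2 * j)) + (\<Sum>i<L. \<Sum>j<L. h (2 * i + 1) (2 * j + 1))" .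
  have h0: "h (2 * i) (2 * j) = of_real (berg (2 * i) * berg (2 * j)) * a (i + j) * w ^ (i + j)" for i j
    by (simp add: h_def)
  have h1: "h (2 * i + 1) (2 * j + 1)
      = of_real (berg (2 * i + 1) * berg (2 * j + 1)) * a (i + j + 1) * w ^ (i + j + 1)" for i j
  proof -
    have "(2 * i + 1 + (2 * j + 1)) div 2 = i + j + 1" by simp
    then show ?thesis unfolding h_def by (simp only:)
  qed
  show ?thesis unfolding sum_h h0 h1 ..
qed

text \<open>
  For \<open>u i = berg (2 i + e) w ^ i\<close> the mean of \<open>|w| ^ e (u\<^sup>* B u)\<close> sees only the diagonal of \<open>B\<close>, with
  weights at most \<open>berg (2 i + e)\<^sup>2 / (2 i + e + 1) \<le> 4 / pi\<close>. The matrices \<open>h\<close> and \<open>k\<close> take \<open>e = 0\<close> and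
  \<open>e = 1\<close>.
\<close>

lemma disc_mean_form_le:
  fixes A B :: cmatrix
  assumes LN: "L \<le> N" and B0: "\<And>i. 0 \<le> Re (B i i)"
    and AB: "\<And>u. cmod (\<Sum>i<L. \<Sum>j<L. A i j * u j * u i) \<le> Re (\<Sum>i<L. \<Sum>j<L. B i j * u j * cnj (u i))"
  shows "disc_mean N (\<lambda>w. cmod (\<Sum>i<L. \<Sum>j<L. of_real (berg (2 * i + e) * berg (2 * j + e)) * A i j * w ^ (i + j + e)))
    \<le> 4 / pi * (\<Sum>i<L. Re (B i i))"
proof -
  let ?u = "\<lambda>w i. of_real (berg (2 * i + e)) * w ^ i"
  have "disc_mean N (\<lambda>w. cmod (\<Sum>i<L. \<Sum>j<L. of_real (berg (2 * i + e) * berg (2 * j + e)) * A i j * w ^ (i + j + e)))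
      \<le> disc_mean N (\<lambda>w. cmod w ^ e * Re (\<Sum>i<L. \<Sum>j<L. B i j * ?u w j * cnj (?u w i)))"
  proof (rule disc_mean_mono)
    fix w
    have "(\<Sum>i<L. \<Sum>j<L. of_real (berg (2 * i + e) * berg (2 * j + e)) * A i j * w ^ (i + j + e))
        = w ^ e * (\<Sum>i<L. \<Sum>j<L. A i j * ?u w j * ?u w i)"
      by (simp add: sum_distrib_left power_add mult_ac)
    then show "cmod (\<Sum>i<L. \<Sum>j<L. of_real (berg (2 * i + e) * berg (2 * j + e)) * A i j * w ^ (i + j + e))
        \<le> cmod w ^ e * Re (\<Sum>i<L. \<Sum>j<L. B i j * ?u w j * cnj (?u w i))"
      using mult_left_mono[OF AB[of "?u w"], of "cmod w ^ e"] by (simp add: norm_mult norm_power del: Re_sum)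
  qed
  also have "\<dots> = (\<Sum>i<L. Re (B i i) * (berg (2 * i + e))\<^sup>2 * power_mean (2 * i + e) N)"
    by (rule disc_mean_quadratic_form[OF LN])
  also have "\<dots> \<le> (\<Sum>i<L. Re (B i i) * (4 / pi))"
  proof (rule sum_mono)
    fix i
    have "(berg (2 * i + e))\<^sup>2 * power_mean (2 * i + e) N
        \<le> (4 / pi * real (Suc (2 * i + e))) * (1 / real (Suc (2 * i + e)))"
      by (rule mult_mono[OF berg_square_le power_mean_le]) (auto simp: power_mean_def intro!: sum_nonneg divide_nonneg_nonneg)
    also have "\<dots> = 4 / pi" by (simp del: of_nat_Suc)
    finally show "Re (B i i) * (berg (2 * i + e))\<^sup>2 * power_mean (2 * i + e) N \<le> Re (B i i) * (4 / pi)"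
      using B0[of i] by (simp only: mult.assoc mult_left_mono)
  qed
  finally show ?thesis by (simp add: sum_distrib_left mult.commute)
qed

text \<open>
  Passing to the limit in telescoping sums; the bound \<open>K / (n + 1)\<close> controls the tails uniformly.
\<close>

lemma tendsto_telescope:
  fixes F :: "nat \<Rightarrow> nat \<Rightarrow> complex"
  assumes diff: "\<And>n. (\<lambda>N. F N n - F N (Suc n)) \<longlonglongrightarrow> b n"
    and b0: "\<And>n. n \<ge> D \<Longrightarrow> b n = 0"
    and bound: "\<And>N n. cmod (F N n) \<le> K / real (Suc n)"
  shows "(\<lambda>N. F N n) \<longlonglongrightarrow> (\<Sum>m\<in>{n..<D}. b m)"
  unfolding tendsto_iff
proof (intro allI impI)
  fix e :: real assume e: "e > 0"
  have "(\<lambda>k. K * (1 / real (Suc k))) \<longlonglongrightarrow> K * 0"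
    by (intro tendsto_mult tendsto_const) (use LIMSEQ_inverse_real_of_nat in \<open>simp add: inverse_eq_divide\<close>)
  then have "\<forall>\<^sub>F k in sequentially. K * (1 / real (Suc k)) < e / 2"
    using e by (intro order_tendstoD(2)) auto
  then obtain k0 where k0: "\<And>k. k \<ge> k0 \<Longrightarrow> K * (1 / real (Suc k)) < e / 2"
    by (auto simp: eventually_sequentially)
  define k where "k = max k0 (max n D)"
  have k: "K / real (Suc k) < e / 2" "n \<le> k" "D \<le> k" using k0[of k] by (auto simp: k_def)
  have F: "F N n = (\<Sum>m\<in>{n..<k}. F N m - F N (Suc m)) + F N k" for N
    using sum_Suc_diff'[OF k(2), of "\<lambda>m. - F N m"] by simp
  have s: "(\<Sum>m\<in>{n..<D}. b m) = (\<Sum>m\<in>{n..<k}. b m)"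
    using k by (intro sum.mono_neutral_left) (auto simp: b0)
  have "(\<lambda>N. \<Sum>m\<in>{n..<k}. F N m - F N (Suc m)) \<longlonglongrightarrow> (\<Sum>m\<in>{n..<k}. b m)"
    by (intro tendsto_sum diff)
  then have "\<forall>\<^sub>F N in sequentially. dist (\<Sum>m\<in>{n..<k}. F N m - F N (Suc m)) (\<Sum>m\<in>{n..<k}. b m) < e / 2"
    by (rule tendstoD) (use e in simp)
  then show "\<forall>\<^sub>F N in sequentially. dist (F N n) (\<Sum>m\<in>{n..<D}. b m) < e"
  proof eventually_elim
    case (elim N)
    have "dist (F N n) (\<Sum>m\<in>{n..<D}. b m)
        \<le> cmod ((\<Sum>m\<in>{n..<k}. F N m - F N (Suc m)) - (\<Sum>m\<in>{n..<k}. b m)) + cmod (F N k)"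
      unfolding s dist_norm by (subst F) (rule order_trans[OF _ norm_triangle_ineq], simp add: algebra_simps)
    also have "\<dots> < e / 2 + e / 2"
      using elim le_less_trans[OF bound[of N k] k(1)] by (intro add_strict_mono) (auto simp: dist_norm)
    finally show ?case by simp
  qed
qed

lemma schur_ball_mono:
  assumes "schur_ball G M \<phi>" "M \<le> M'"
  shows "schur_ball G M' \<phi>"
  using assms unfolding schur_ball_def by (meson order_trans)

lemma form_bound_diag:
  fixes A B :: cmatrix
  assumes "\<And>u L. cmod (\<Sum>i<L. \<Sum>j<L. A i j * u j * u i) \<le> Re (\<Sum>i<L. \<Sum>j<L. B i j * u j * cnj (u i))"
  shows "cmod (A n n) \<le> Re (B n n)"
proof -
  have d: "(\<Sum>i<Suc n. \<Sum>j<Suc n. X i j * of_bool (j = n) * of_bool (i = n)) = X n n" for X :: cmatrix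
    by (simp add: of_bool_def if_distrib[of "(*) _"] cong: if_cong)
  have cb: "cnj (of_bool P) = of_bool P" for P by (cases P) simp_all
  show ?thesis using assms[of "\<lambda>i. of_bool (i = n)" "Suc n"] by (simp only: cb d)
qed

lemma one_minus_cnj_neq_0:
  assumes "cmod w < 1"
  shows "1 - cnj w \<noteq> 0"
  using assms by (metis complex_mod_cnj eq_iff_diff_eq_0 norm_one order_less_irrefl)

text \<open>
  The factor \<open>(1 - |w|) / (1 - cnj w)\<close> cancels the growth of the bound for \<open>s = cnj w\<close>.
\<close>

lemma schur_ball_disc_mean:
  assumes pow: "\<And>s. cmod s < 1 \<Longrightarrow> schur_ball G (C * (cmod (1 - s) / (1 - cmod s))) (\<lambda>x. s ^ len x)"
  shows "schur_ball G (C * disc_mean N (\<lambda>w. cmod (P w)))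
    (\<lambda>x. disc_mean N (\<lambda>w. P w * of_real (1 - cmod w) / (1 - cnj w) * cnj w ^ len x))"
proof -
  define r where "r = inverse ((real N)\<^sup>2)"
  have r0: "r \<ge> 0" by (simp add: r_def)
  define f where "f w = of_real r * (P w * of_real (1 - cmod w) / (1 - cnj w))" for w
  define M where "M w = cmod (f w) * (C * (cmod (1 - cnj w) / (1 - cmod (cnj w))))" for w
  have "schur_ball G (\<Sum>p<N. \<Sum>q<N. M (grid_point N p q))
      (\<lambda>x. \<Sum>p<N. \<Sum>q<N. f (grid_point N p q) * cnj (grid_point N p q) ^ len x)"
    unfolding M_def by (intro schur_ball_sum schur_ball_cmult pow) (auto intro: norm_grid_point_less)
  moreover have "(\<Sum>p<N. \<Sum>q<N. f (grid_point N p q) * cnj (grid_point N p q) ^ n)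
      = disc_mean N (\<lambda>w. P w * of_real (1 - cmod w) / (1 - cnj w) * cnj w ^ n)" for n
    by (simp add: disc_mean_def f_def r_def scaleR_conv_of_real sum_distrib_left mult.assoc)
  moreover have "M (grid_point N p q) = C * (r * cmod (P (grid_point N p q)))" if "p < N" for p q
  proof -
    let ?w = "grid_point N p q"
    have w: "cmod ?w < 1" using that by (rule norm_grid_point_less)
    have "cmod (of_real (1 - cmod ?w)) = 1 - cmod ?w" using w by (simp only: norm_of_real)
    then have "M ?w = r * (cmod (P ?w) * (1 - cmod ?w) / cmod (1 - cnj ?w)) * (C * (cmod (1 - cnj ?w) / (1 - cmod ?w)))"
      using r0 by (simp only: M_def f_def norm_mult norm_divide complex_mod_cnj norm_of_real abs_of_nonneg)
    then show ?thesis using w one_minus_cnj_neq_0[OF w] by simp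
  qed
  ultimately show ?thesis
    by (simp add: disc_mean_def r_def sum_distrib_left)
qed

lemma norm_disc_mean_kernel_le:
  assumes N: "N > 0" and K: "\<And>w. cmod w < 1 \<Longrightarrow> cmod (P w) \<le> K"
  shows "cmod (disc_mean N (\<lambda>w. P w * of_real (1 - cmod w) / (1 - cnj w) * cnj w ^ n)) \<le> K / real (Suc n)"
proof -
  have K0: "0 \<le> K" using order_trans[OF norm_ge_zero K[of 0]] by simp
  have "cmod (disc_mean N (\<lambda>w. P w * of_real (1 - cmod w) / (1 - cnj w) * cnj w ^ n))
      \<le> disc_mean N (\<lambda>w. cmod (P w * of_real (1 - cmod w) / (1 - cnj w) * cnj w ^ n))"
    by (rule norm_disc_mean_le)
  also have "\<dots> \<le> disc_mean N (\<lambda>w. K * cmod w ^ n)"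
  proof (rule disc_mean_mono)
    fix w :: complex assume w: "cmod w < 1"
    have "(1 - cmod w) / cmod (1 - cnj w) \<le> 1"
      using norm_triangle_ineq2[of 1 "cnj w"] w by (simp add: divide_le_eq_1)
    then have "cmod (P w) * ((1 - cmod w) / cmod (1 - cnj w)) * cmod w ^ n \<le> K * 1 * cmod w ^ n"
      using w K0 by (intro mult_right_mono mult_mono K) auto
    moreover have "cmod (of_real (1 - cmod w)) = 1 - cmod w" using w by (simp only: norm_of_real)
    ultimately show "cmod (P w * of_real (1 - cmod w) / (1 - cnj w) * cnj w ^ n) \<le> K * cmod w ^ n"
      by (simp only: norm_mult norm_divide norm_power complex_mod_cnj mult_1_right times_divide_eq_right)
  qed
  also have "\<dots> = K * power_mean n N"
    by (simp only: disc_mean_cmult disc_mean_norm_power[OF N])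
  also have "\<dots> \<le> K * (1 / real (Suc n))" by (intro mult_left_mono power_mean_le K0)
  finally show ?thesis by simp
qed

lemma disc_mean_kernel_diff:
  "disc_mean N (\<lambda>w. P w * of_real (1 - cmod w) / (1 - cnj w) * cnj w ^ n)
    - disc_mean N (\<lambda>w. P w * of_real (1 - cmod w) / (1 - cnj w) * cnj w ^ Suc n)
    = disc_mean N (\<lambda>w. P w * of_real (1 - cmod w) * cnj w ^ n)"
proof -
  have "P w * of_real (1 - cmod w) / (1 - cnj w) * cnj w ^ n
      - P w * of_real (1 - cmod w) / (1 - cnj w) * cnj w ^ Suc n
      = P w * of_real (1 - cmod w) * cnj w ^ n" if "cmod w < 1" for w
  proof -
    have "P w * of_real (1 - cmod w) / (1 - cnj w) * cnj w ^ n
      - P w * of_real (1 - cmod w) / (1 - cnj w) * cnj w ^ Suc n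
      = P w * of_real (1 - cmod w) / (1 - cnj w) * (1 - cnj w) * cnj w ^ n"
      by (simp add: right_diff_distrib left_diff_distrib mult.assoc del: of_real_diff)
    then show ?thesis using one_minus_cnj_neq_0[OF that] by (simp del: of_real_diff)
  qed
  then show ?thesis
    unfolding disc_mean_diff[symmetric] unfolding disc_mean_def
    by (intro arg_cong[of _ _ "\<lambda>x. x /\<^sub>R _"] sum.cong refl) (simp add: norm_grid_point_less)
qed

text \<open>
  The case of a polynomial density. A mean of multipliers is a finite sum, and the means of
  \<open>P w (1 - |w|) cnj w ^ n\<close> converge to the \<open>n\<close>-th coefficient of \<open>P\<close> times
  \<open>1 / (2 n + 1) - 1 / (2 n + 2)\<close>. The singularity of \<open>1 / (1 - cnj w)\<close> at \<open>1\<close> is avoided by passing to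
  differences in \<open>n\<close>.
\<close>

lemma schur_ball_polynomial:
  fixes g :: "nat \<Rightarrow> complex"
  assumes G: "group G" and count: "countable (carrier G)" and C: "0 \<le> C"
    and pow: "\<And>s. cmod s < 1 \<Longrightarrow> schur_ball G (C * (cmod (1 - s) / (1 - cmod s))) (\<lambda>x. s ^ len x)"
    and mean: "\<And>N. D \<le> N \<Longrightarrow> disc_mean N (\<lambda>w. cmod (\<Sum>m<D. g m * w ^ m)) \<le> M"
  shows "schur_ball G (C * M) (\<lambda>x. \<Sum>m\<in>{len x..<D}. g m / of_nat ((2 * m + 1) * (2 * m + 2)))"
proof -
  define P where "P w = (\<Sum>m<D. g m * w ^ m)" for w
  define b where "b m = (if m < D then g m / of_nat ((2 * m + 1) * (2 * m + 2)) else 0)" for m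
  define N' where "N' N = N + D + 1" for N
  define F where "F N n = disc_mean (N' N) (\<lambda>w. P w * of_real (1 - cmod w) / (1 - cnj w) * cnj w ^ n)" for N n
  have ball: "schur_ball G (C * M) (\<lambda>x. F N (len x))" for N
    unfolding F_def
    by (rule schur_ball_mono[OF schur_ball_disc_mean[OF pow]], assumption, rule mult_left_mono[OF _ C])
      (use mean[of "N' N"] in \<open>simp add: P_def N'_def\<close>)
  have "(\<lambda>N. F N n) \<longlonglongrightarrow> (\<Sum>m\<in>{n..<D}. b m)" for n
  proof (rule tendsto_telescope)
    fix n
    have Fd: "F N n - F N (Suc n) = (if n < D then
        g n * of_real (power_mean (2 * n) (N' N) - power_mean (2 * n + 1) (N' N)) else 0)" if "n < N' N" for N
      unfolding F_def disc_mean_kernel_diff P_def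
      by (rule disc_mean_coefficient) (use that in \<open>auto simp: N'_def\<close>)
    have ev: "\<forall>\<^sub>F N in sequentially. (if n < D then
        g n * of_real (power_mean (2 * n) (N' N) - power_mean (2 * n + 1) (N' N)) else 0) = F N n - F N (Suc n)"
      using eventually_ge_at_top[of n]
    proof eventually_elim
      case (elim N)
      show ?case by (rule Fd[symmetric]) (use elim in \<open>simp add: N'_def\<close>)
    qed
    have pm: "(\<lambda>N. power_mean k (N' N)) \<longlonglongrightarrow> 1 / real (Suc k)" for k
      using LIMSEQ_ignore_initial_segment[OF power_mean_tendsto[of k], of "D + 1"] by (simp add: N'_def add_ac)
    have "(\<lambda>N. g n * of_real (power_mean (2 * n) (N' N) - power_mean (2 * n + 1) (N' N)))
        \<longlonglongrightarrow> g n * of_real (1 / real (Suc (2 * n)) - 1 / real (Suc (2 * n + 1)))"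
      by (intro tendsto_intros pm)
    also have "1 / real (Suc (2 * n)) - 1 / real (Suc (2 * n + 1)) = 1 / real ((2 * n + 1) * (2 * n + 2))"
      by (simp add: field_simps)
    also have "g n * of_real (1 / real ((2 * n + 1) * (2 * n + 2))) = g n / of_nat ((2 * n + 1) * (2 * n + 2))"
      by (simp only: of_real_divide of_real_1 of_real_of_nat_eq times_divide_eq_right mult_1_right)
    finally have "(\<lambda>N. if n < D then
        g n * of_real (power_mean (2 * n) (N' N) - power_mean (2 * n + 1) (N' N)) else 0) \<longlonglongrightarrow> b n"
      by (cases "n < D") (simp_all only: b_def if_True if_False tendsto_const)
    then show "(\<lambda>N. F N n - F N (Suc n)) \<longlonglongrightarrow> b n" using ev by (rule Lim_transform_eventually)
  next
    show "b n = 0" if "n \<ge> D" for n using that by (simp add: b_def)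
  next
    fix N n
    have "cmod (P w) \<le> (\<Sum>m<D. cmod (g m))" if "cmod w < 1" for w
      unfolding P_def
      by (rule order_trans[OF norm_sum], rule sum_mono)
        (use that in \<open>auto simp: norm_mult norm_power intro!: mult_left_le power_le_one\<close>)
    then show "cmod (F N n) \<le> (\<Sum>m<D. cmod (g m)) / real (Suc n)"
      unfolding F_def by (intro norm_disc_mean_kernel_le) (simp_all add: N'_def)
  qed
  moreover have "(\<Sum>m\<in>{n..<D}. b m) = (\<Sum>m\<in>{n..<D}. g m / of_nat ((2 * m + 1) * (2 * m + 2)))" for n
    by (rule sum.cong) (simp_all add: b_def)
  ultimately have "(\<lambda>N. F N n) \<longlonglongrightarrow> (\<Sum>m\<in>{n..<D}. g m / of_nat ((2 * m + 1) * (2 * m + 2)))" for n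
    by simp
  then show ?thesis
    by (intro schur_ball_limit[OF count ball _ tendsto_const G])
qed

section \<open>Radial multipliers\<close>

text \<open>
  The diagonal entries of \<open>|h|\<close> and \<open>|k|\<close> dominate \<open>|a m|\<close> for even and odd \<open>m\<close>, so \<open>a\<close> is absolutely
  summable. This gives the limit of \<open>\<phi>\<close> and lets the cut-off \<open>L\<close> tend to infinity.
\<close>

theorem schur_ball_radial:
  fixes G :: "('a, 'b) monoid_scheme" and len :: "'a \<Rightarrow> nat" and \<phi> :: "nat \<Rightarrow> complex"
  assumes G: "group G" and count: "countable (carrier G)" and C: "0 \<le> C"
    and pow: "\<And>s. cmod s < 1 \<Longrightarrow> schur_ball G (C * (cmod (1 - s) / (1 - cmod s))) (\<lambda>x. s ^ len x)"
    and t: "has_trace_norm (hankel_diff \<phi> 0) t" and t': "has_trace_norm (hankel_diff \<phi> 1) t'"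
  shows "convergent \<phi>" and "schur_ball G (8 * C / pi * (t + t')) (\<lambda>x. \<phi> (len x) - lim \<phi>)"
proof -
  define a where "a m = \<phi> m - \<phi> (Suc m)" for m
  have h: "hankel_diff \<phi> 0 i j = a (i + j)" and k: "hankel_diff \<phi> 1 i j = a (i + j + 1)" for i j
    by (simp_all add: hankel_diff_def a_def)
  have sym: "hankel_diff \<phi> 0 i j = hankel_diff \<phi> 0 j i"
    and sym': "hankel_diff \<phi> 1 i j = hankel_diff \<phi> 1 j i" for i j
    by (simp_all only: h k add.commute)
  obtain B where B: "(\<lambda>n. Re (B n n)) sums t" and B_form:
    "\<And>u L. cmod (\<Sum>i<L. \<Sum>j<L. a (i + j) * u j * u i) \<le> Re (\<Sum>i<L. \<Sum>j<L. B i j * u j * cnj (u i))"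
    using has_trace_norm_form[OF t sym, unfolded h] by blast
  obtain B' where B': "(\<lambda>n. Re (B' n n)) sums t'" and B'_form:
    "\<And>u L. cmod (\<Sum>i<L. \<Sum>j<L. a (i + j + 1) * u j * u i) \<le> Re (\<Sum>i<L. \<Sum>j<L. B' i j * u j * cnj (u i))"
    using has_trace_norm_form[OF t' sym', unfolded k] by blast
  have B0: "cmod (a (2 * n)) \<le> Re (B n n)" for n
    using form_bound_diag[OF B_form, of n] by (simp add: mult_2)
  have B'0: "cmod (a (2 * n + 1)) \<le> Re (B' n n)" for n
    using form_bound_diag[OF B'_form, of n] by (simp add: mult_2)
  have nn: "0 \<le> Re (B n n)" "0 \<le> Re (B' n n)" for n
    using order_trans[OF norm_ge_zero B0] order_trans[OF norm_ge_zero B'0] by blast+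
  have trace_le: "(\<Sum>n<L. Re (B n n)) \<le> t" "(\<Sum>n<L. Re (B' n n)) \<le> t'" for L
    using sum_le_suminf[OF sums_summable[OF B], of "{..<L}"] sum_le_suminf[OF sums_summable[OF B'], of "{..<L}"]
      nn sums_unique[OF B] sums_unique[OF B'] by auto
  have suma: "summable (\<lambda>m. cmod (a m))"
  proof (rule summableI_nonneg_bounded)
    fix n
    have "(\<Sum>m<n. cmod (a m)) \<le> (\<Sum>m<2 * n. cmod (a m))" by (rule sum_mono2) auto
    also have "\<dots> \<le> (\<Sum>i<n. Re (B i i) + Re (B' i i))"
      unfolding sum_even_odd by (intro sum_mono add_mono B0 B'0)
    also have "\<dots> \<le> t + t'" using trace_le[of n] by (simp add: sum.distrib)
    finally show "(\<Sum>m<n. cmod (a m)) \<le> t + t'" .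
  qed simp
  have suma': "summable (\<lambda>m. a (m + n))" for n
    using summable_norm_cancel[OF suma] by (subst summable_iff_shift)
  have tele: "(\<Sum>m<k. a (m + n)) = \<phi> n - \<phi> (k + n)" for n k
    by (induction k) (simp_all add: a_def)
  have lim: "\<phi> \<longlonglongrightarrow> \<phi> 0 - suminf a"
  proof -
    have "(\<lambda>k. \<phi> 0 - (\<Sum>m<k. a (m + 0))) \<longlonglongrightarrow> \<phi> 0 - (\<Sum>m. a (m + 0))"
      by (intro tendsto_diff tendsto_const summable_LIMSEQ[OF suma'])
    then show ?thesis unfolding tele by simp
  qed
  then show "convergent \<phi>" by (auto simp: convergent_def)
  have tail: "(\<Sum>m. a (m + n)) = \<phi> n - lim \<phi>" for n
  proof (rule LIMSEQ_unique[OF summable_LIMSEQ[OF suma']])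
    show "(\<lambda>k. \<Sum>m<k. a (m + n)) \<longlonglongrightarrow> \<phi> n - lim \<phi>"
      unfolding tele limI[OF lim] by (intro tendsto_diff tendsto_const LIMSEQ_ignore_initial_segment lim)
  qed
  \<comment> \<open>for \<open>m < L\<close> the coefficient is \<open>a m\<close>; the others are damped by a factor in \<open>[0, 1]\<close>\<close>
  define b where "b L m = (if m < 2 * L then
      2 * of_real (kernel_weight L m) * a m / of_nat ((2 * m + 1) * (2 * m + 2)) else 0)" for L m
  have b_le: "cmod (b L m) \<le> cmod (a m)" for L m
  proof (cases "m < 2 * L")
    case True
    define y where "y = real ((2 * m + 1) * (2 * m + 2))"
    have y: "y > 0" unfolding y_def by (subst of_nat_0_less_iff) simp
    have "cmod (b L m) = 2 * kernel_weight L m / y * cmod (a m)"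
      using True kernel_weight_nonneg[of L m]
      by (simp only: b_def y_def if_True norm_mult norm_divide norm_of_real norm_of_nat) simp
    also have "\<dots> \<le> 1 * cmod (a m)"
      using kernel_weight_le[of L m, folded y_def] y by (intro mult_right_mono) (simp_all add: field_simps)
    finally show ?thesis by simp
  qed (simp add: b_def)
  have b_eq: "b L m = a m" if "m < L" for L m
  proof -
    have "(of_nat ((2 * m + 1) * (2 * m + 2)) :: complex) \<noteq> 0" by (subst of_nat_eq_0_iff) simp
    then show ?thesis
      using that by (simp add: b_def kernel_weight_full[OF that] del: of_nat_mult of_nat_add of_nat_Suc)
  qed
  have step: "schur_ball G (8 * C / pi * (t + t')) (\<lambda>x. \<Sum>m\<in>{len x..<2 * L}. b L m)" for L
  proof -
    define g where "g m = 2 * of_real (kernel_weight L m) * a m" for m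
    define P where "P w = (\<Sum>m<2 * L. g m * w ^ m)" for w
    have P_eq: "P w = 2 * (\<Sum>i<L. \<Sum>j<L. of_real (berg (2 * i + 0) * berg (2 * j + 0)) * a (i + j) * w ^ (i + j + 0))
        + 2 * (\<Sum>i<L. \<Sum>j<L. of_real (berg (2 * i + 1) * berg (2 * j + 1)) * a (i + j + 1) * w ^ (i + j + 1))" for w
    proof -
      have "P w = 2 * (\<Sum>m<2 * L. of_real (kernel_weight L m) * a m * w ^ m)"
        by (simp add: P_def g_def sum_distrib_left mult_ac)
      then show ?thesis unfolding kernel_polynomial by (simp only: distrib_left add_0_right)
    qed
    have mean: "disc_mean N (\<lambda>w. cmod (P w)) \<le> 8 / pi * (t + t')" if N: "2 * L \<le> N" for N
    proof -
      let ?X = "\<lambda>w. \<Sum>i<L. \<Sum>j<L. of_real (berg (2 * i + 0) * berg (2 * j + 0)) * a (i + j) * w ^ (i + j + 0)"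
      let ?Y = "\<lambda>w. \<Sum>i<L. \<Sum>j<L. of_real (berg (2 * i + 1) * berg (2 * j + 1)) * a (i + j + 1) * w ^ (i + j + 1)"
      have "disc_mean N (\<lambda>w. cmod (P w)) \<le> disc_mean N (\<lambda>w. 2 * cmod (?X w) + 2 * cmod (?Y w))"
      proof (rule disc_mean_mono)
        fix w show "cmod (P w) \<le> 2 * cmod (?X w) + 2 * cmod (?Y w)"
          unfolding P_eq by (rule order_trans[OF norm_triangle_ineq]) (simp only: norm_mult norm_numeral order_refl)
      qed
      also have "\<dots> = 2 * disc_mean N (\<lambda>w. cmod (?X w)) + 2 * disc_mean N (\<lambda>w. cmod (?Y w))"
        by (simp only: disc_mean_add disc_mean_cmult)
      also have "\<dots> \<le> 2 * (4 / pi * (\<Sum>i<L. Re (B i i))) + 2 * (4 / pi * (\<Sum>i<L. Re (B' i i)))"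
        by (intro add_mono mult_left_mono disc_mean_form_le nn B_form B'_form) (use N in auto)
      also have "\<dots> = 8 / pi * ((\<Sum>i<L. Re (B i i)) + (\<Sum>i<L. Re (B' i i)))"
        by (simp add: field_simps)
      also have "\<dots> \<le> 8 / pi * (t + t')" using trace_le[of L] by (intro mult_left_mono add_mono) auto
      finally show ?thesis .
    qed
    have "schur_ball G (C * (8 / pi * (t + t'))) (\<lambda>x. \<Sum>m\<in>{len x..<2 * L}. g m / of_nat ((2 * m + 1) * (2 * m + 2)))"
      using mean by (intro schur_ball_polynomial[OF G count C pow]) (simp_all add: P_def)
    moreover have "(\<Sum>m\<in>{n..<2 * L}. g m / of_nat ((2 * m + 1) * (2 * m + 2))) = (\<Sum>m\<in>{n..<2 * L}. b L m)" for n
      by (rule sum.cong) (simp_all add: b_def g_def)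
    moreover have "C * (8 / pi * (t + t')) = 8 * C / pi * (t + t')" by simp
    ultimately show ?thesis by (simp only:)
  qed
  show "schur_ball G (8 * C / pi * (t + t')) (\<lambda>x. \<phi> (len x) - lim \<phi>)"
  proof (rule schur_ball_limit[OF count step _ tendsto_const G])
    fix x
    define n where "n = len x"
    have fin: "(\<Sum>m\<in>{n..<2 * L}. b L m) = (\<Sum>m. b L (m + n))" for L
    proof -
      have "(\<Sum>m. b L (m + n)) = (\<Sum>m\<in>{..<2 * L}. b L (m + n))"
        by (rule suminf_finite) (auto simp: b_def)
      also have "\<dots> = (\<Sum>m\<in>{n..<2 * L + n}. b L m)"
        using sum.shift_bounds_nat_ivl[of "b L" 0 n "2 * L"] by (simp add: atLeast0LessThan)
      also have "\<dots> = (\<Sum>m\<in>{n..<2 * L}. b L m)"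
        by (rule sum.mono_neutral_right) (auto simp: b_def)
      finally show ?thesis ..
    qed
    have "(\<lambda>L. \<Sum>m. b L (m + n)) \<longlonglongrightarrow> (\<Sum>m. a (m + n))"
    proof (rule tannerys_theorem[where M = "\<lambda>m. cmod (a (m + n))", THEN conjunct2, THEN conjunct2])
      show "(\<lambda>L. b L (m + n)) \<longlonglongrightarrow> a (m + n)" for m
        by (rule tendsto_eventually) (auto intro!: eventually_mono[OF eventually_gt_at_top[of "m + n"]] b_eq)
      show "summable (\<lambda>m. cmod (a (m + n)))" using suma by (subst summable_iff_shift)
      show "\<forall>\<^sub>F (m, L) in at_top \<times>\<^sub>F sequentially. cmod (b L (m + n)) \<le> cmod (a (m + n))"
        by (rule always_eventually) (auto simp: b_le)
    qed simp
    then show "(\<lambda>L. \<Sum>m\<in>{len x..<2 * L}. b L m) \<longlonglongrightarrow> \<phi> (len x) - lim \<phi>"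
      by (simp add: fin[unfolded n_def] tail n_def)
  qed
qed

lemma ell2_shift:
  assumes "y \<in> ell2"
  shows "(\<lambda>i. y (Suc i)) \<in> ell2" and "ell2_norm (\<lambda>i. y (Suc i)) \<le> ell2_norm y"
proof -
  have s: "summable (\<lambda>n. (cmod (y n))\<^sup>2)" using assms by (simp add: ell2_def)
  then show "(\<lambda>i. y (Suc i)) \<in> ell2"
    unfolding ell2_def mem_Collect_eq by (subst summable_Suc_iff)
  show "ell2_norm (\<lambda>i. y (Suc i)) \<le> ell2_norm y"
    unfolding ell2_norm_def suminf_split_head[OF s] by simp
qed

lemma trace_class_hankel_shift:
  assumes tr: "trace_class (hankel_diff \<phi> 0)"
  shows "trace_class (hankel_diff \<phi> 1)"
proof (rule trace_class_mono[OF tr])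
  let ?h = "hankel_diff \<phi> 0" and ?k = "hankel_diff \<phi> 1"
  have hk: "?k i j = ?h (Suc i) j" for i j by (simp add: hankel_diff_def)
  have app: "mat_apply ?k x = (\<lambda>i. mat_apply ?h x (Suc i))" for x
    by (simp only: mat_apply_def hk)
  have h: "bounded_matrix ?h" using tr by (auto simp: trace_class_def has_trace_norm_def)
  then obtain K where K: "\<And>x. x \<in> ell2 \<Longrightarrow> (\<forall>i. summable (\<lambda>j. ?h i j * x j)) \<and>
        mat_apply ?h x \<in> ell2 \<and> ell2_norm (mat_apply ?h x) \<le> K * ell2_norm x"
    by (auto simp: bounded_matrix_def)
  show k: "bounded_matrix ?k"
    unfolding bounded_matrix_def app hk
    using K ell2_shift by (intro exI[of _ K]) (blast intro: order_trans)
  show "norm (mat_op ?k x) \<le> norm (mat_op ?h x)" for x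
    using K[OF Rep_l2[of x]]
    by (simp only: norm_l2_eq Rep_mat_op[OF h] Rep_mat_op[OF k] app ell2_shift)
qed (simp_all add: hankel_diff_def add.commute)

lemma has_trace_norm_trace_norm: "trace_class A \<Longrightarrow> has_trace_norm A (trace_norm A)"
  unfolding trace_class_def trace_norm_def by (rule someI_ex)

lemma word_dist_self: "word_dist G S x x = 0"
  unfolding word_dist_def by (rule Least_eq_0) simp

theorem mainTheorem3:
  fixes G :: "('a, 'b) monoid_scheme" and S :: "'a set" and d :: "'a \<Rightarrow> 'a \<Rightarrow> nat"
    and C :: real and \<phi> :: "nat \<Rightarrow> complex"
  assumes "hyperbolic_group G"
    and "finite_symmetric_generating_set G S"
    and "d = word_dist G S"
    and "\<And>s :: complex. cmod s < 1 \<Longrightarrow>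
           (\<lambda>x. s ^ d x \<one>\<^bsub>G\<^esub>) \<in> M0A G \<and>
           M0A_norm G (\<lambda>x. s ^ d x \<one>\<^bsub>G\<^esub>) \<le> C * (cmod (1 - s) / (1 - cmod s))"
    and "\<phi> \<in> hankel_space"
  shows "(\<lambda>x. \<phi> (d x \<one>\<^bsub>G\<^esub>)) \<in> M0A G \<and>
         M0A_norm G (\<lambda>x. \<phi> (d x \<one>\<^bsub>G\<^esub>)) \<le> 8 * C / pi * hankel_space_norm \<phi>"
proof -
  have G: "group G" using assms(1) by (simp add: hyperbolic_group_def)
  interpret group G by (rule G)
  have count: "countable (carrier G)" by (rule countable_carrier[OF G assms(2)])
  have pow: "schur_ball G (C * (cmod (1 - s) / (1 - cmod s))) (\<lambda>x. s ^ d x \<one>\<^bsub>G\<^esub>)" if "cmod s < 1" for s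
    using assms(4)[OF that] by (intro schur_ball_if_M0A[OF G count]) auto
  have "d \<one>\<^bsub>G\<^esub> \<one>\<^bsub>G\<^esub> = 0" unfolding assms(3) by (rule word_dist_self)
  \<comment> \<open>for \<open>s = 0\<close> the multiplier is the indicator function of the unit\<close>
  then have C1: "1 \<le> C"
    using schur_ball_norm_le[OF pow[of 0] one_closed one_closed] by simp
  define t where "t = trace_norm (hankel_diff \<phi> 0)"
  define t' where "t' = trace_norm (hankel_diff \<phi> 1)"
  have tr: "trace_class (hankel_diff \<phi> 0)" using assms(5) by (simp add: hankel_space_def)
  have "schur_ball G (8 * C / pi * (t + t')) (\<lambda>x. \<phi> (d x \<one>\<^bsub>G\<^esub>) - lim \<phi>)"
    unfolding t_def t'_def
    using C1 by (intro schur_ball_radial(2)[OF G count _ pow] has_trace_norm_trace_norm tr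
        trace_class_hankel_shift[OF tr]) simp
  from schur_ball_add[OF this schur_ball_cmult[OF schur_ball_one, where c = "lim \<phi>"]]
  have "schur_ball G (8 * C / pi * (t + t') + cmod (lim \<phi>)) (\<lambda>x. \<phi> (d x \<one>\<^bsub>G\<^esub>))" by simp
  moreover have "8 * C / pi * (t + t') + cmod (lim \<phi>) \<le> 8 * C / pi * hankel_space_norm \<phi>"
  proof -
    have "1 \<le> 8 * C / pi" using C1 pi_less_4 by (simp add: field_simps)
    from mult_right_mono[OF this norm_ge_zero[of "lim \<phi>"]] show ?thesis
      by (simp add: hankel_space_norm_def t_def t'_def distrib_left)
  qed
  ultimately have "schur_ball G (8 * C / pi * hankel_space_norm \<phi>) (\<lambda>x. \<phi> (d x \<one>\<^bsub>G\<^esub>))"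
    by (rule schur_ball_mono)
  then show ?thesis using M0A_if_schur_ball[OF G count] by blast
qed

end
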